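(* Let $1<p\leq 2$, $q=p/(p-1)$, $0<s<(2\alpha+d+2)/q$ and $t>0$. Then there is a positive constant $K(s,t)$ (not depending on $\varphi$) such that for all $\varphi\in L^p_\alpha(\mathbb{R}^{d+1}_+)$, $$\left\|\mathcal{F}_{W,\alpha}(\varphi)\right\|_{\alpha,q}\leq K(s,t)\,\left\||x|^s\varphi\right\|_{\alpha,p}^{\frac{t}{s+t}}\,\left\||y|^t\mathcal{F}_{W,\alpha}(\varphi)\right\|_{\alpha,q}^{\frac{s}{s+t}}.$$
   Context: Fix an integer $d\geq 1$ and a real number $\alpha>-1/2$. Let $\mathbb{R}^{d+1}_+=\mathbb{R}^d\times(0,\infty)$, write $x=(x',x_{d+1})$ with $x'\in\mathbb{R}^d$, and let $|x|$ be the Euclidean norm. Equip $\mathbb{R}^{d+1}_+$ with the measure $$d\mu_\alpha(x)=\frac{x_{d+1}^{2\alpha+1}}{(2\pi)^{d/2}2^{\alpha}\Gamma(\alpha+1)}\,dx .$$ $L^p_\alpha(\mathbb{R}^{d+1}_+)$ is the $L^p$ space of this measure (complex-valued functions), with norm $\|\cdot\|_{\alpha,p}$, $1\le p\le\infty$. Norms of measurable functions not in the space are understood to be $+\infty$. The Weinstein kernel is $\Lambda^d_\alpha(\lambda,x)=e^{-i\langle x',\lambda'\rangle}j_\alpha(x_{d+1}\lambda_{d+1})$, where $j_\alpha(r)=\Gamma(\alpha+1)\sum_{k\ge0}\frac{(-1)^k r^{2k}}{2^{2k}k!\,\Gamma(\alpha+k+1)}$ is the normalized Bessel function. The Weinstein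 transform of $\varphi\in L^1_\alpha(\mathbb{R}^{d+1}_+)$ is $$\mathcal{F}_{W,\alpha}(\varphi)(\lambda)=\int_{\mathbb{R}^{d+1}_+}\varphi(x)\Lambda^d_\alpha(x,\lambda)\,d\mu_\alpha(x),\quad \lambda\in\mathbb{R}^{d+1}_+.$$ It extends to an isometric isomorphism of $L^2_\alpha(\mathbb{R}^{d+1}_+)$ and, for $1\le p\le 2$, $q=p/(p-1)$ ($q=\infty$ if $p=1$), to a bounded linear map $L^p_\alpha\to L^q_\alpha$ satisfying $\|\mathcal{F}_{W,\alpha}(\varphi)\|_{\alpha,q}\le\|\varphi\|_{\alpha,p}$. In $\||x|^s\varphi\|_{\alpha,p}$ and $\||y|^t\mathcal{F}_{W,\alpha}(\varphi)\|_{\alpha,q}$ the weights $|x|^s$, $|y|^t$ are functions of the integration variable. *)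

theory Defs
  imports "HOL-Analysis.Analysis"
begin

(* The half-space is a subset of the Euclidean space (real ^ 'd) * real, whose norm is
   sqrt (norm x' ^ 2 + x_{d+1} ^ 2); d = CARD('d) is arbitrary and positive. *)

definition half_space :: "((real ^ 'd) \<times> real) set" where
  "half_space = {x. 0 < snd x}"

definition weinstein_measure :: "real \<Rightarrow> ((real ^ 'd) \<times> real) measure" where
  "weinstein_measure \<alpha> =
     density (restrict_space lborel half_space)
       (\<lambda>x. ennreal (snd x powr (2 * \<alpha> + 1) /
          ((2 * pi) powr (real CARD('d) / 2) * 2 powr \<alpha> * Gamma (\<alpha> + 1))))"

(* Real power with values in [0, infinity]; only used for exponents a > 0. *)
definition ennreal_powr :: "ennreal \<Rightarrow> real \<Rightarrow> ennreal" where
  "ennreal_powr c a = (if c = \<infinity> then \<infinity> else ennreal (enn2real c powr a))"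

(* The norm for finite exponents p; it is infinite for measurable f outside the space. *)
definition Lnorm :: "real \<Rightarrow> real \<Rightarrow> ((real ^ 'd) \<times> real \<Rightarrow> complex) \<Rightarrow> ennreal" where
  "Lnorm \<alpha> p f =
     ennreal_powr (\<integral>\<^sup>+ x. ennreal (cmod (f x) powr p) \<partial>weinstein_measure \<alpha>) (1 / p)"

definition Lspace :: "real \<Rightarrow> real \<Rightarrow> ((real ^ 'd) \<times> real \<Rightarrow> complex) set" where
  "Lspace \<alpha> p = {f \<in> borel_measurable (weinstein_measure \<alpha>). Lnorm \<alpha> p f < \<infinity>}"

definition bessel_j :: "real \<Rightarrow> real \<Rightarrow> real" where
  "bessel_j \<alpha> r =
     Gamma (\<alpha> + 1) *
     (\<Sum>k. (- 1) ^ k * r ^ (2 * k) / (2 ^ (2 * k) * fact k * Gamma (\<alpha> + real k + 1)))"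

definition weinstein_kernel ::
    "real \<Rightarrow> (real ^ 'd) \<times> real \<Rightarrow> (real ^ 'd) \<times> real \<Rightarrow> complex" where
  "weinstein_kernel \<alpha> l x =
     exp (- (\<i> * complex_of_real (fst x \<bullet> fst l))) * complex_of_real (bessel_j \<alpha> (snd x * snd l))"

(* The integral transform; meaningful for f in Lspace \<alpha> 1. *)
definition weinstein_L1 ::
    "real \<Rightarrow> ((real ^ 'd) \<times> real \<Rightarrow> complex) \<Rightarrow> (real ^ 'd) \<times> real \<Rightarrow> complex" where
  "weinstein_L1 \<alpha> f l = (LINT x|weinstein_measure \<alpha>. f x * weinstein_kernel \<alpha> x l)"

(* Graph of the continuous extension of the integral transform from L^1 \<inter> L^p, which is
   dense in L^p, to a map from L^p to L^q, where q = p / (p - 1). *)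
definition is_weinstein_transform ::
    "real \<Rightarrow> real \<Rightarrow> ((real ^ 'd) \<times> real \<Rightarrow> complex) \<Rightarrow> ((real ^ 'd) \<times> real \<Rightarrow> complex) \<Rightarrow> bool" where
  "is_weinstein_transform \<alpha> p f F \<longleftrightarrow>
     F \<in> Lspace \<alpha> (p / (p - 1)) \<and>
     (\<exists>u :: nat \<Rightarrow> (real ^ 'd) \<times> real \<Rightarrow> complex.
        (\<forall>n. u n \<in> Lspace \<alpha> 1 \<inter> Lspace \<alpha> p) \<and>
        (\<lambda>n. Lnorm \<alpha> p (\<lambda>x. u n x - f x)) \<longlonglongrightarrow> 0 \<and>
        (\<lambda>n. Lnorm \<alpha> (p / (p - 1)) (\<lambda>y. weinstein_L1 \<alpha> (u n) y - F y)) \<longlonglongrightarrow> 0)"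

(* The transform on L^p for 1 < p \<le> 2. By the Hausdorff-Young inequality an F as required
   exists and is unique up to null sets, so the choice only picks a representative. *)
definition weinstein ::
    "real \<Rightarrow> real \<Rightarrow> ((real ^ 'd) \<times> real \<Rightarrow> complex) \<Rightarrow> (real ^ 'd) \<times> real \<Rightarrow> complex" where
  "weinstein \<alpha> p f = (SOME F. is_weinstein_transform \<alpha> p f F)"

end

theory Submission
  imports Defs "HOL-Probability.Characteristic_Functions"
begin

text \<open>
  The inequality is an optimization over a radius \<open>r\<close>. High frequencies \<open>\<bar>y\<bar> \<ge> r\<close> are bounded by
  \<open>r powr (- t)\<close> times the weighted norm of the transform. For low frequencies, \<open>\<phi>\<close> is cut at
  \<open>\<bar>x\<bar> = 1 / r\<close>: the inner part is integrable by Hoelder's inequality, because \<open>\<bar>x\<bar> powr (- s * q)\<close> is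
  integrable near the origin for \<open>s * q < 2 * \<alpha> + d + 2\<close>, and hence has a bounded transform; the outer part
  is small in \<open>L\<^sup>p\<close>, and the Hausdorff-Young inequality carries this over to \<open>L\<^sup>q\<close>. Since balls of
  radius \<open>r\<close> have measure \<open>O(r powr (2 * \<alpha> + d + 2))\<close>, both parts contribute a constant times \<open>r powr s\<close> times the weighted norm
  of \<open>\<phi>\<close>; balancing with the high frequencies gives the exponents \<open>t / (s + t)\<close> and \<open>s / (s + t)\<close>
  (lemmas \<open>extends_transform_low_high_split\<close> and \<open>extends_transform_uncertainty\<close>).

  The constant \<open>K\<close> is free, so a Hausdorff-Young inequality with any constant suffices, and real
  interpolation gives one in a few lines (\<open>hausdorff_young_off_diagonal\<close>). Its inputs are the bounds of the transform
  from \<open>L\<^sup>1\<close> to \<open>L\<^sup>\<infinity>\<close> and from \<open>L\<^sup>2\<close> to \<open>L\<^sup>2\<close>. The first one is \<open>\<bar>j\<^sub>\<alpha>\<bar> \<le> 1\<close>, an energy estimate for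
  Bessel's equation (\<open>bessel_series_bound\<close>). For the second one, the square of the transform is
  integrated against a Gaussian weight. The resulting quadratic form has the heat kernel of the Weinstein operator
  as its kernel, which is positive, symmetric and of total mass \<open>1\<close>, so that Schur's test applies
  (\<open>schur_weighted_L2\<close>). The heat kernel is a product of a Gaussian, by the Fourier
  transform of Gaussians, and of a modified Bessel function, by Weber's integral (\<open>weber_integral\<close>). The latter
  is obtained by multiplying power series; the identity needed for the coefficients is that of Chu and
  Vandermonde (\<open>bessel_coeff_Vandermonde\<close>).

  The transform on \<open>L\<^sup>p\<close> is a choice among the limits of transforms of integrable functions, so the
  existence of such a limit has to be shown (\<open>extends_transform_exists\<close>). The estimates do not depend on
  the choice, because they hold for every limit (\<open>extends_transform_approx\<close>).
\<close>

section \<open>The Bessel series\<close>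

text \<open>
  With \<open>b = \<alpha> + 1\<close>, the function \<open>j\<^sub>\<alpha>\<close> is the power series with coefficients
  \<open>(-1)^k * bessel_coeff b k\<close> at the point \<open>r\<^sup>2 / 4\<close>. The parameter \<open>b\<close> is used throughout in
  place of \<open>\<alpha>\<close>: the condition \<open>\<alpha> > -1/2\<close> gives \<open>b \<ge> 1/2\<close>, the weight \<open>t powr (2 * \<alpha> + 1)\<close> is
  \<open>t powr (2 * b - 1)\<close>, and Gamma quotients become Pochhammer symbols.
\<close>

definition bessel_coeff :: "real \<Rightarrow> nat \<Rightarrow> real" where
  "bessel_coeff b k = 1 / (fact k * pochhammer b k)"

lemma bessel_coeff_pos: "b > 0 \<Longrightarrow> bessel_coeff b k > 0"
  by (simp add: bessel_coeff_def pochhammer_pos)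

lemma bessel_coeff_le:
  assumes "b \<ge> 1/2"
  shows "bessel_coeff b k \<le> 2 ^ k / fact k"
proof -
  have "(1/2) ^ k \<le> pochhammer b k"
  proof (induction k)
    case (Suc k)
    have "(1/2) ^ k * (1/2) \<le> pochhammer b k * (b + real k)"
      using Suc assms by (intro mult_mono) (auto intro: pochhammer_nonneg)
    then show ?case by (simp add: pochhammer_Suc mult.commute)
  qed auto
  then have "1 / pochhammer b k \<le> 1 / (1/2) ^ k"
    by (intro divide_left_mono) (use assms in \<open>auto simp: pochhammer_pos\<close>)
  then have "1 / pochhammer b k / fact k \<le> 1 / (1/2) ^ k / fact k"
    by (intro divide_right_mono) auto
  then show ?thesis by (simp add: bessel_coeff_def field_simps power_divide)
qed

lemma summable_bessel_coeff:
  assumes "b \<ge> 1/2"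
  shows "summable (\<lambda>k. bessel_coeff b k * z ^ k)"
proof (rule summable_comparison_test')
  show "summable (\<lambda>k. (2 * \<bar>z\<bar>) ^ k / fact k)"
    using summable_exp[of "2 * \<bar>z\<bar>"] by (simp add: field_simps)
  fix k :: nat assume "k \<ge> 0"
  have "norm (bessel_coeff b k * z ^ k) = bessel_coeff b k * \<bar>z\<bar> ^ k"
    using bessel_coeff_pos[of b k] assms by (simp add: abs_mult power_abs)
  also have "\<dots> \<le> (2 ^ k / fact k) * \<bar>z\<bar> ^ k"
    by (intro mult_right_mono bessel_coeff_le assms) auto
  finally show "norm (bessel_coeff b k * z ^ k) \<le> (2 * \<bar>z\<bar>) ^ k / fact k"
    by (simp add: power_mult_distrib)
qed

lemma bessel_coeff_alt_summable:
  assumes "b \<ge> 1/2"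
  shows "summable (\<lambda>k. (-1) ^ k * bessel_coeff b k * z ^ k)"
  using summable_bessel_coeff[OF assms, of "-z"]
  by (simp add: power_minus[of z] mult_ac)

lemma bessel_j_series:
  assumes "\<alpha> > -1/2"
  shows "bessel_j \<alpha> r = (\<Sum>k. (-1) ^ k * bessel_coeff (\<alpha> + 1) k * (r\<^sup>2 / 4) ^ k)"
proof -
  have nz: "\<alpha> + 1 \<notin> \<int>\<^sub>\<le>\<^sub>0" using assms by (auto elim!: nonpos_Ints_cases)
  have G: "Gamma (\<alpha> + 1) > 0" using assms by (intro Gamma_real_pos) auto
  have eq: "(- 1) ^ k * r ^ (2 * k) / (2 ^ (2 * k) * fact k * Gamma (\<alpha> + real k + 1))
     = ((-1) ^ k * bessel_coeff (\<alpha> + 1) k * (r\<^sup>2 / 4) ^ k) / Gamma (\<alpha> + 1)" for k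
  proof -
    have "pochhammer (\<alpha> + 1) k = Gamma (\<alpha> + real k + 1) / Gamma (\<alpha> + 1)"
      using pochhammer_Gamma[OF nz, of k] by (simp add: add_ac)
    moreover have "Gamma (\<alpha> + real k + 1) > 0" using assms by (intro Gamma_real_pos) auto
    moreover have "(r\<^sup>2 / 4) ^ k = r ^ (2 * k) / 2 ^ (2 * k)"
      by (simp add: power_divide power_mult)
    ultimately show ?thesis using G by (simp add: bessel_coeff_def field_simps)
  qed
  have "bessel_j \<alpha> r = Gamma (\<alpha> + 1) *
     (\<Sum>k. ((-1) ^ k * bessel_coeff (\<alpha> + 1) k * (r\<^sup>2 / 4) ^ k) / Gamma (\<alpha> + 1))"
    unfolding bessel_j_def eq ..
  also have "\<dots> = (\<Sum>k. (-1) ^ k * bessel_coeff (\<alpha> + 1) k * (r\<^sup>2 / 4) ^ k)"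
    using less_imp_neq[OF G] assms by (subst suminf_divide) (auto intro!: bessel_coeff_alt_summable)
  finally show ?thesis .
qed

text \<open>
  Bessel's equation in the variable \<open>z = r\<^sup>2 / 4\<close>; it amounts to a two-term recursion for the
  coefficients.
\<close>

lemma bessel_series_ode:
  fixes b z :: real
  assumes b: "b \<ge> 1/2"
  defines "c \<equiv> \<lambda>k. (-1) ^ k * bessel_coeff b k"
  shows "z * (\<Sum>k. diffs (diffs c) k * z ^ k) + b * (\<Sum>k. diffs c k * z ^ k) + (\<Sum>k. c k * z ^ k) = 0"
proof -
  have s0: "summable (\<lambda>k. c k * z ^ k)" for z
    unfolding c_def by (rule bessel_coeff_alt_summable[OF b])
  have s1: "summable (\<lambda>k. diffs c k * z ^ k)" for z
    by (rule termdiff_converges_all[OF s0])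
  have s2: "summable (\<lambda>k. diffs (diffs c) k * z ^ k)" for z
    by (rule termdiff_converges_all[OF s1])
  have rec: "real k * diffs c k + b * diffs c k + c k = 0" for k
  proof -
    have "b + real k > 0" "pochhammer b k > 0" using b by (auto simp: pochhammer_pos)
    then show ?thesis
      by (simp add: diffs_def c_def bessel_coeff_def pochhammer_Suc divide_simps) (simp add: algebra_simps)
  qed
  have e: "(\<Sum>k. real k * diffs c k * z ^ k) = z * (\<Sum>k. diffs (diffs c) k * z ^ k)"
    and es: "summable (\<lambda>k. real k * diffs c k * z ^ k)"
  proof -
    have "(\<lambda>k. z * (diffs (diffs c) k * z ^ k)) sums (z * (\<Sum>k. diffs (diffs c) k * z ^ k))"
      by (intro sums_mult summable_sums s2)
    then have "(\<lambda>k. real (Suc k) * diffs c (Suc k) * z ^ Suc k) sums (z * (\<Sum>k. diffs (diffs c) k * z ^ k))"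
      by (simp add: diffs_def[of "diffs c"] mult_ac)
    then have "(\<lambda>k. real k * diffs c k * z ^ k) sums (z * (\<Sum>k. diffs (diffs c) k * z ^ k))"
      by (subst (asm) sums_Suc_iff) simp
    then show "(\<Sum>k. real k * diffs c k * z ^ k) = z * (\<Sum>k. diffs (diffs c) k * z ^ k)"
      "summable (\<lambda>k. real k * diffs c k * z ^ k)"
      by (auto simp: sums_iff)
  qed
  have "(\<lambda>k. (real k * diffs c k * z ^ k + b * (diffs c k * z ^ k)) + c k * z ^ k) sums
     ((z * (\<Sum>k. diffs (diffs c) k * z ^ k) + b * (\<Sum>k. diffs c k * z ^ k)) + (\<Sum>k. c k * z ^ k))"
    unfolding e[symmetric] by (intro sums_add sums_mult summable_sums es s0 s1)
  moreover have "(real k * diffs c k * z ^ k + b * (diffs c k * z ^ k)) + c k * z ^ k = 0" for k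
    using rec[of k] by (metis (no_types, opaque_lifting) distrib_right mult.assoc mult_zero_left)
  ultimately have "(\<lambda>k. 0) sums ((z * (\<Sum>k. diffs (diffs c) k * z ^ k) + b * (\<Sum>k. diffs c k * z ^ k)) + (\<Sum>k. c k * z ^ k))"
    by simp
  then show ?thesis by (metis sums_unique2 sums_zero)
qed

text \<open>
  An energy argument: for a solution \<open>g\<close> of the equation above, \<open>g\<^sup>2 + z * g'\<^sup>2\<close> has derivative
  \<open>(1 - 2 * b) * g'\<^sup>2 \<le> 0\<close> and equals \<open>1\<close> at \<open>0\<close>.
\<close>

lemma bessel_series_bound:
  fixes b z :: real
  assumes b: "b \<ge> 1/2" and z: "z \<ge> 0"
  shows "\<bar>\<Sum>k. (-1) ^ k * bessel_coeff b k * z ^ k\<bar> \<le> 1"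
proof -
  define c where "c = (\<lambda>k. (-1) ^ k * bessel_coeff b k)"
  have s0: "summable (\<lambda>k. c k * z ^ k)" for z
    unfolding c_def by (rule bessel_coeff_alt_summable[OF b])
  define g where "g = (\<lambda>z. \<Sum>k. c k * z ^ k)"
  define g1 where "g1 = (\<lambda>z. \<Sum>k. diffs c k * z ^ k)"
  define g2 where "g2 = (\<lambda>z. \<Sum>k. diffs (diffs c) k * z ^ k)"
  have d0: "(g has_field_derivative g1 z) (at z)" for z
    unfolding g_def g1_def by (rule termdiffs_strong_converges_everywhere[OF s0])
  have d1: "(g1 has_field_derivative g2 z) (at z)" for z
    unfolding g1_def g2_def
    by (rule termdiffs_strong_converges_everywhere[OF termdiff_converges_all[OF s0]])
  define H where "H = (\<lambda>z. (g z)\<^sup>2 + z * (g1 z)\<^sup>2)"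
  have dH: "(H has_field_derivative (1 - 2 * b) * (g1 z)\<^sup>2) (at z)" for z
  proof -
    have "z * g2 z + b * g1 z + g z = 0"
      using bessel_series_ode[OF b, of z] by (simp add: g_def g1_def g2_def c_def)
    then have e: "z * g2 z + g z = - b * g1 z" by simp
    have "(H has_field_derivative (2 * g z * g1 z + ((g1 z)\<^sup>2 + 2 * z * g1 z * g2 z))) (at z)"
      unfolding H_def by (auto intro!: derivative_eq_intros d0 d1 simp: algebra_simps)
    moreover have "2 * g z * g1 z + ((g1 z)\<^sup>2 + 2 * z * g1 z * g2 z) =
        2 * g1 z * (z * g2 z + g z) + (g1 z)\<^sup>2" by (simp add: algebra_simps)
    moreover have "\<dots> = (1 - 2 * b) * (g1 z)\<^sup>2"
      unfolding e by (simp add: power2_eq_square algebra_simps)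
    ultimately show ?thesis by simp
  qed
  have "H z \<le> H 0"
    using z by (rule DERIV_nonpos_imp_nonincreasing)
      (use dH b in \<open>auto intro!: exI[of _ "(1 - 2 * b) * (g1 _)\<^sup>2"] mult_nonpos_nonneg\<close>)
  moreover have "H 0 = 1"
  proof -
    have "g 0 = c 0" unfolding g_def by (rule powser_zero)
    then show ?thesis by (simp add: H_def c_def bessel_coeff_def)
  qed
  moreover have "(g z)\<^sup>2 \<le> H z" using z by (simp add: H_def)
  ultimately have "(g z)\<^sup>2 \<le> 1" by simp
  then show ?thesis
    by (simp add: g_def c_def abs_square_le_1)
qed

lemma bessel_j_bound: "\<alpha> > -1/2 \<Longrightarrow> \<bar>bessel_j \<alpha> r\<bar> \<le> 1"
  by (subst bessel_j_series) (auto intro!: bessel_series_bound)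

lemma continuous_bessel_j:
  assumes "\<alpha> > -1/2"
  shows "continuous_on UNIV (bessel_j \<alpha>)"
proof -
  have s0: "summable (\<lambda>k. ((-1) ^ k * bessel_coeff (\<alpha> + 1) k) * z ^ k)" for z
    by (rule bessel_coeff_alt_summable) (use assms in auto)
  have d: "isCont (\<lambda>z. \<Sum>k. ((-1) ^ k * bessel_coeff (\<alpha> + 1) k) * z ^ k) z" for z
    by (rule DERIV_isCont[OF termdiffs_strong_converges_everywhere[OF s0]])
  have "continuous_on UNIV (\<lambda>z. \<Sum>k. ((-1) ^ k * bessel_coeff (\<alpha> + 1) k) * z ^ k)"
    by (intro continuous_at_imp_continuous_on ballI d)
  moreover have "continuous_on UNIV (\<lambda>r::real. r\<^sup>2 / 4)"
    by (intro continuous_intros) auto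
  ultimately have "continuous_on UNIV (\<lambda>r. \<Sum>k. ((-1) ^ k * bessel_coeff (\<alpha> + 1) k) * (r\<^sup>2 / 4) ^ k)"
    by (rule continuous_on_compose2) simp
  then show ?thesis
    by (simp add: bessel_j_series[OF assms] cong: continuous_on_cong)
qed

text \<open>
  The Chu-Vandermonde identity
  \<open>(l + (b + k - 1)) gchoose k = (\<Sum>m\<le>k. (l gchoose m) * ((b + k - 1) gchoose (k - m)))\<close>, rewritten in
  the form in which it is met when two Bessel series are multiplied and integrated termwise
  against a Gaussian.
\<close>

lemma bessel_coeff_Vandermonde:
  assumes b: "b > 0"
  shows "pochhammer b (k + l) * bessel_coeff b k * bessel_coeff b l =
     (\<Sum>m\<le>min k l. bessel_coeff b m / (fact (k - m) * fact (l - m)))"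
proof -
  have pos: "pochhammer b n > 0" for n using b by (simp add: pochhammer_pos)
  have V: "(\<Sum>m\<le>k. (real l gchoose m) * ((b - 1 + real k) gchoose (k - m))) = (real l + (b - 1 + real k)) gchoose k"
    using gbinomial_Vandermonde[of "real l" "b - 1 + real k" k] by (simp add: atLeast0AtMost)
  have "(real l + (b - 1 + real k)) gchoose k = pochhammer (b + real l) k / fact k"
    by (simp add: gbinomial_pochhammer' add_ac)
  also have "\<dots> = pochhammer b (k + l) / (pochhammer b l * fact k)"
    using pochhammer_product'[of b l k] pos[of l] by (simp add: add_ac)
  finally have R: "(real l + (b - 1 + real k)) gchoose k = pochhammer b (k + l) / (pochhammer b l * fact k)" .
  have L: "(real l gchoose m) * ((b - 1 + real k) gchoose (k - m)) =
     (if m \<le> l then fact l * pochhammer b k * (bessel_coeff b m / (fact (k - m) * fact (l - m))) else 0)"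
    if "m \<le> k" for m
  proof (cases "m \<le> l")
    case True
    have "(real l gchoose m) = fact l / (fact m * fact (l - m))"
      using True by (simp add: binomial_fact flip: binomial_gbinomial)
    moreover have "((b - 1 + real k) gchoose (k - m)) = pochhammer (b + real m) (k - m) / fact (k - m)"
      using that by (simp add: gbinomial_pochhammer' of_nat_diff)
    moreover have "pochhammer b k = pochhammer b m * pochhammer (b + real m) (k - m)"
      using pochhammer_product[OF that, of b] .
    ultimately show ?thesis using True pos[of m]
      by (simp add: bessel_coeff_def)
  next
    case False
    then have "real l gchoose m = 0" by (simp flip: binomial_gbinomial)
    then show ?thesis using False by simp
  qed
  have "pochhammer b (k + l) / (pochhammer b l * fact k) =
     (\<Sum>m\<le>k. (if m \<le> l then fact l * pochhammer b k * (bessel_coeff b m / (fact (k - m) * fact (l - m))) else 0))"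
    unfolding R[symmetric] V[symmetric] by (intro sum.cong) (auto simp: L)
  also have "\<dots> = (\<Sum>m\<le>min k l. fact l * pochhammer b k * (bessel_coeff b m / (fact (k - m) * fact (l - m))))"
    by (intro sum.mono_neutral_cong_right) auto
  also have "\<dots> = fact l * pochhammer b k * (\<Sum>m\<le>min k l. bessel_coeff b m / (fact (k - m) * fact (l - m)))"
    by (simp add: sum_distrib_left)
  finally show ?thesis using pos[of k] pos[of l] by (simp add: bessel_coeff_def field_simps)
qed

section \<open>Weber's integral and the Bessel heat kernel\<close>

text \<open>
  The last coordinate of the Weinstein measure, up to the normalizing constant.
\<close>

definition radial_measure :: "real \<Rightarrow> real measure" where
  "radial_measure b = density lborel (\<lambda>t. ennreal (indicator {0<..} t * t powr (2 * b - 1)))"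

lemma sets_radial_measure [measurable_cong]: "sets (radial_measure b) = sets borel"
  and space_radial_measure [simp]: "space (radial_measure b) = UNIV"
  by (simp_all add: radial_measure_def)

text \<open>
  Euler's integral for \<open>Gamma b\<close> after the substitution \<open>u = e * t\<^sup>2\<close>.
\<close>

lemma nn_integral_radial_gauss:
  assumes b: "b > 0" and e: "e > 0"
  shows "(\<integral>\<^sup>+ t. ennreal (exp (- e * t\<^sup>2)) \<partial>radial_measure b) = ennreal (Gamma b / (2 * e powr b))"
proof -
  define f where "f = (\<lambda>u::real. u powr (b - 1) / exp u)"
  have "(f has_integral Gamma b) {0..}"
    unfolding f_def by (rule Gamma_integral_real[OF b])
  then have I: "(f has_integral Gamma b) {0<..}"
  proof (rule iffD1[OF has_integral_spike_set_eq, rotated 2])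
    show "negligible {x \<in> {0..} - {0<..}. f x \<noteq> 0}"
      by (rule negligible_subset[of "{0::real}"]) auto
    show "negligible {x \<in> {0<..} - {0..}. f x \<noteq> 0}"
      by (rule negligible_subset[of "{}"]) auto
  qed
  then have "f absolutely_integrable_on {0<..}"
    by (intro nonnegative_absolutely_integrable_1) (auto simp: f_def integrable_on_def)
  with I have abs: "f absolutely_integrable_on {0<..} \<and> integral {0<..} f = Gamma b"
    by (simp add: integral_unique)
  have im: "(\<lambda>t. e * t\<^sup>2) ` {0<..} = {0<..}"
  proof (intro equalityI subsetI)
    fix u :: real assume "u \<in> {0<..}"
    then have "u = e * (sqrt (u / e))\<^sup>2" "sqrt (u / e) \<in> {0<..}" using e by auto
    then show "u \<in> (\<lambda>t. e * t\<^sup>2) ` {0<..}" by (rule image_eqI)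
  qed (use e in auto)
  have inj: "inj_on (\<lambda>t. e * t\<^sup>2) {0<..}"
    using e by (auto simp: inj_on_def power2_eq_iff)
  have "(\<lambda>t. \<bar>2 * e * t\<bar> * f (e * t\<^sup>2)) absolutely_integrable_on {0<..} \<and>
      integral {0<..} (\<lambda>t. \<bar>2 * e * t\<bar> * f (e * t\<^sup>2)) = Gamma b"
    by (subst has_absolute_integral_change_of_variables_1'[where g = "\<lambda>t. e * t\<^sup>2"])
      (use abs im inj in \<open>auto intro!: derivative_eq_intros\<close>)
  then have "((\<lambda>t. \<bar>2 * e * t\<bar> * f (e * t\<^sup>2)) has_integral Gamma b) {0<..}"
    by (metis absolutely_integrable_on_def integrable_integral)
  then have *: "((\<lambda>t. (\<bar>2 * e * t\<bar> * f (e * t\<^sup>2)) / (2 * e powr b)) has_integral Gamma b / (2 * e powr b)) {0<..}"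
    by (rule has_integral_divide)
  have eq: "(\<bar>2 * e * t\<bar> * f (e * t\<^sup>2)) / (2 * e powr b) = t powr (2 * b - 1) * exp (- e * t\<^sup>2)" if "t > 0" for t
  proof -
    have "f (e * t\<^sup>2) = e powr (b - 1) * (t powr (2 * b - 2)) * exp (- e * t\<^sup>2)"
      using that e by (simp add: f_def powr_mult exp_minus divide_inverse powr_powr flip: powr_numeral)
    moreover have "t * t powr (2 * b - 2) = t powr (2 * b - 1)"
      using that powr_mult_base[of t "2 * b - 2"] by simp
    moreover have "e * e powr (b - 1) = e powr b"
      using e powr_mult_base[of e "b - 1"] by simp
    moreover have "\<bar>2 * e * t\<bar> * (e powr (b - 1) * (t powr (2 * b - 2)) * exp (- e * t\<^sup>2)) / (2 * e powr b)
        = (e * e powr (b - 1)) * (t * t powr (2 * b - 2)) * exp (- e * t\<^sup>2) / e powr b"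
      using that e by (simp add: mult_ac)
    ultimately show ?thesis using e by simp
  qed
  have "((\<lambda>t. t powr (2 * b - 1) * exp (- e * t\<^sup>2)) has_integral Gamma b / (2 * e powr b)) {0<..}"
    using * by (rule has_integral_eq[rotated]) (simp add: eq)
  then have "(\<integral>\<^sup>+ t. ennreal (t powr (2 * b - 1) * exp (- e * t\<^sup>2)) * indicator {0<..} t \<partial>lborel)
      = ennreal (Gamma b / (2 * e powr b))"
    by (intro nn_integral_has_integral_lebesgue') auto
  moreover have "(\<integral>\<^sup>+ t. ennreal (exp (- e * t\<^sup>2)) \<partial>radial_measure b) =
      (\<integral>\<^sup>+ t. ennreal (t powr (2 * b - 1) * exp (- e * t\<^sup>2)) * indicator {0<..} t \<partial>lborel)"
    unfolding radial_measure_def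
    by (subst nn_integral_density) (auto intro!: nn_integral_cong simp: indicator_def ennreal_mult'')
  ultimately show ?thesis by simp
qed

lemma nn_integral_radial_gauss_moment:
  assumes b: "b > 0" and e: "e > 0"
  shows "(\<integral>\<^sup>+ t. ennreal (t ^ (2 * m) * exp (- e * t\<^sup>2)) \<partial>radial_measure b)
    = ennreal (Gamma b * pochhammer b m / (2 * e powr b * e ^ m))"
proof -
  have nz: "b \<notin> \<int>\<^sub>\<le>\<^sub>0" using b by (auto elim!: nonpos_Ints_cases)
  have G: "Gamma b > 0" using b by (rule Gamma_real_pos)
  have "(\<integral>\<^sup>+ t. ennreal (t ^ (2 * m) * exp (- e * t\<^sup>2)) \<partial>radial_measure b)
    = (\<integral>\<^sup>+ t. ennreal (exp (- e * t\<^sup>2)) \<partial>radial_measure (b + real m))"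
  proof -
    have "ennreal (indicator {0<..} t * t powr (2 * b - 1)) * ennreal (t ^ (2 * m) * exp (- e * t\<^sup>2)) =
      ennreal (indicator {0<..} t * t powr (2 * (b + real m) - 1)) * ennreal (exp (- e * t\<^sup>2))" for t
    proof -
    have "t powr (2 * (b + real m) - 1) = t powr (2 * b - 1) * t ^ (2 * m)" if "t > 0"
    proof -
      have "t powr (2 * (b + real m) - 1) = t powr ((2 * b - 1) + real (2 * m))"
        by (simp add: algebra_simps)
      also have "\<dots> = t powr (2 * b - 1) * t ^ (2 * m)"
        unfolding powr_add using that by (subst powr_realpow) auto
      finally show ?thesis .
    qed
    then show ?thesis
      by (cases "t > 0") (auto simp: indicator_def mult.assoc simp flip: ennreal_mult)
    qed
    then show ?thesis
      unfolding radial_measure_def by (simp add: nn_integral_density)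
  qed
  also have "\<dots> = ennreal (Gamma (b + real m) / (2 * e powr (b + real m)))"
    using b e by (intro nn_integral_radial_gauss) auto
  also have "Gamma (b + real m) = Gamma b * pochhammer b m"
    using pochhammer_Gamma[OF nz, of m] G by simp
  also have "e powr (b + real m) = e powr b * e ^ m"
    using e by (simp add: powr_add powr_realpow)
  finally show ?thesis by (simp add: mult.assoc)
qed

text \<open>
  The \<open>n\<close>-th term of the Cauchy product of two Bessel series, with the factor that the \<open>n\<close>-th
  Gaussian moment contributes, is itself the \<open>n\<close>-th term of a Cauchy product: that of the exponential
  series at \<open>X + Y\<close> with the series \<open>\<Sum>m. bessel_coeff b m * (X * Y) ^ m\<close>, the latter placed in the even
  degrees. After the Chu-Vandermonde identity, the inner sums are binomial expansions of
  \<open>(X + Y) ^ (n - 2 * m)\<close>.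
\<close>

lemma bessel_Cauchy_product:
  assumes b: "b > 0"
  shows "pochhammer b n * (\<Sum>k\<le>n. (bessel_coeff b k * X ^ k) * (bessel_coeff b (n - k) * Y ^ (n - k))) =
     (\<Sum>i\<le>n. (if even i then bessel_coeff b (i div 2) * (X * Y) ^ (i div 2) else 0) * ((X + Y) ^ (n - i) / fact (n - i)))"
proof -
  have "pochhammer b n * (\<Sum>k\<le>n. (bessel_coeff b k * X ^ k) * (bessel_coeff b (n - k) * Y ^ (n - k)))
    = (\<Sum>k\<le>n. X ^ k * Y ^ (n - k) * (pochhammer b (k + (n - k)) * bessel_coeff b k * bessel_coeff b (n - k)))"
    by (auto simp: sum_distrib_left intro!: sum.cong)
  also have "\<dots> = (\<Sum>k\<le>n. \<Sum>m\<le>min k (n - k). X ^ k * Y ^ (n - k) * (bessel_coeff b m / (fact (k - m) * fact (n - k - m))))"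
    unfolding bessel_coeff_Vandermonde[OF b] by (simp add: sum_distrib_left)
  also have "\<dots> = (\<Sum>m\<le>n div 2. \<Sum>j\<le>n - 2 * m. X ^ (j + m) * Y ^ (n - (j + m)) * (bessel_coeff b m / (fact j * fact (n - (j + m) - m))))"
    unfolding sum.Sigma[OF finite_atMost ballI[OF finite_atMost]]
    by (rule sum.reindex_bij_witness[where i = "\<lambda>(m, j). (j + m, m)" and j = "\<lambda>(k, m). (m, k - m)"]) auto
  also have "\<dots> = (\<Sum>m\<le>n div 2. bessel_coeff b m * (X * Y) ^ m * ((X + Y) ^ (n - 2 * m) / fact (n - 2 * m)))"
  proof (intro sum.cong refl)
    fix m assume "m \<in> {..n div 2}"
    then have m: "2 * m \<le> n" by auto
    have "(\<Sum>j\<le>n - 2 * m. X ^ (j + m) * Y ^ (n - (j + m)) * (bessel_coeff b m / (fact j * fact (n - (j + m) - m))))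
      = (\<Sum>j\<le>n - 2 * m. bessel_coeff b m * (X * Y) ^ m / fact (n - 2 * m) * (real ((n - 2 * m) choose j) * X ^ j * Y ^ (n - 2 * m - j)))"
    proof (intro sum.cong refl)
      fix j assume j: "j \<in> {..n - 2 * m}"
      have e1: "n - (j + m) = (n - 2 * m - j) + m" "n - (j + m) - m = n - 2 * m - j" using j m by auto
      have "real ((n - 2 * m) choose j) = fact (n - 2 * m) / (fact j * fact (n - 2 * m - j))"
        using j by (intro binomial_fact) auto
      then show "X ^ (j + m) * Y ^ (n - (j + m)) * (bessel_coeff b m / (fact j * fact (n - (j + m) - m))) =
        bessel_coeff b m * (X * Y) ^ m / fact (n - 2 * m) * (real ((n - 2 * m) choose j) * X ^ j * Y ^ (n - 2 * m - j))"
        unfolding e1 by (simp add: power_add power_mult_distrib field_simps)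
    qed
    also have "\<dots> = bessel_coeff b m * (X * Y) ^ m / fact (n - 2 * m) * (X + Y) ^ (n - 2 * m)"
      by (simp add: binomial_ring sum_distrib_left)
    finally show "(\<Sum>j\<le>n - 2 * m. X ^ (j + m) * Y ^ (n - (j + m)) * (bessel_coeff b m / (fact j * fact (n - (j + m) - m))))
      = bessel_coeff b m * (X * Y) ^ m * ((X + Y) ^ (n - 2 * m) / fact (n - 2 * m))" by simp
  qed
  also have "\<dots> = (\<Sum>i\<in>{i. i \<le> n \<and> even i}. (if even i then bessel_coeff b (i div 2) * (X * Y) ^ (i div 2) else 0) * ((X + Y) ^ (n - i) / fact (n - i)))"
    by (rule sum.reindex_bij_witness[where i = "\<lambda>i. i div 2" and j = "\<lambda>m. 2 * m"]) auto
  also have "\<dots> = (\<Sum>i\<le>n. (if even i then bessel_coeff b (i div 2) * (X * Y) ^ (i div 2) else 0) * ((X + Y) ^ (n - i) / fact (n - i)))"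
    by (intro sum.mono_neutral_left) auto
  finally show ?thesis .
qed

lemma sums_even_terms:
  fixes f :: "nat \<Rightarrow> real"
  assumes "f sums s"
  shows "(\<lambda>i. if even i then f (i div 2) else 0) sums s"
proof -
  have "(\<lambda>m. (\<lambda>i. if even i then f (i div 2) else 0) (2 * m)) sums s" using assms by simp
  then show ?thesis
    by (subst (asm) sums_mono_reindex) (auto simp: strict_mono_def image_iff elim!: evenE)
qed

text \<open>
  Only even degrees carry the second factor, so the sign \<open>(-1) ^ n\<close> falls on the exponential
  series alone and turns \<open>exp (X + Y)\<close> into \<open>exp (- X - Y)\<close>. The series without signs converges too,
  which is what termwise integration requires.
\<close>

lemma bessel_Cauchy_sums:
  fixes X Y :: real
  assumes b: "b \<ge> 1/2" and X: "X \<ge> 0" and Y: "Y \<ge> 0"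
  defines "Q \<equiv> \<lambda>n. pochhammer b n * (\<Sum>k\<le>n. (bessel_coeff b k * X ^ k) * (bessel_coeff b (n - k) * Y ^ (n - k)))"
  shows "summable Q"
    and "(\<lambda>n. (-1) ^ n * Q n) sums ((\<Sum>m. bessel_coeff b m * (X * Y) ^ m) * exp (- X - Y))"
proof -
  define B where "B = (\<lambda>i. if even i then bessel_coeff b (i div 2) * (X * Y) ^ (i div 2) else 0)"
  have Qeq: "Q n = (\<Sum>i\<le>n. B i * ((X + Y) ^ (n - i) / fact (n - i)))" for n
    unfolding Q_def B_def using b by (intro bessel_Cauchy_product) auto
  have Bs: "B sums (\<Sum>m. bessel_coeff b m * (X * Y) ^ m)"
    unfolding B_def by (intro sums_even_terms summable_sums summable_bessel_coeff b)
  have Bn: "norm (B i) = B i" for i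
    using X Y bessel_coeff_pos[of b "i div 2"] b by (auto simp: B_def)
  have E: "summable (\<lambda>n. z ^ n / fact n)" "(\<Sum>n. z ^ n / fact n) = exp z" for z :: real
    using summable_exp[of z] by (auto simp: exp_def divide_inverse mult.commute)
  have En: "summable (\<lambda>n. norm (z ^ n / fact n))" for z :: real
    using E(1)[of "\<bar>z\<bar>"] by (simp add: power_abs)
  have Bsn: "summable (\<lambda>i. norm (B i))" using Bs by (simp only: Bn) (simp add: sums_iff)
  show "summable Q"
    using Cauchy_product_sums[OF Bsn En[of "X + Y"]] by (simp add: Qeq[abs_def] sums_iff)
  have "(-1) ^ n * Q n = (\<Sum>i\<le>n. B i * ((- X - Y) ^ (n - i) / fact (n - i)))" for n
  proof -
    have "(-1) ^ n * (B i * ((X + Y) ^ (n - i) / fact (n - i))) = B i * ((- X - Y) ^ (n - i) / fact (n - i))"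
      if "i \<le> n" for i
    proof (cases "even i")
      case True
      then have "(-1::real) ^ n = (-1) ^ (n - i)" using that by (auto simp: uminus_power_if)
      moreover have "(- X - Y) ^ (n - i) = (-1) ^ (n - i) * (X + Y) ^ (n - i)"
        by (simp flip: power_mult_distrib)
      ultimately show ?thesis by simp
    qed (simp add: B_def)
    then show ?thesis unfolding Qeq sum_distrib_left by (intro sum.cong) auto
  qed
  then show "(\<lambda>n. (-1) ^ n * Q n) sums ((\<Sum>m. bessel_coeff b m * (X * Y) ^ m) * exp (- X - Y))"
    using Cauchy_product_sums[OF Bsn En[of "- X - Y"]] Bs E(2)[of "- X - Y"] by (simp add: sums_iff)
qed

text \<open>
  The normalized Bessel function of order \<open>b - 1\<close>.
\<close>

definition bessel_series :: "real \<Rightarrow> real \<Rightarrow> real" where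
  "bessel_series b r = (\<Sum>k. (-1) ^ k * bessel_coeff b k * (r\<^sup>2 / 4) ^ k)"

text \<open>
  The heat kernel of the Bessel operator at time \<open>e\<close>, up to a constant; the series is the modified
  Bessel function.
\<close>

definition hankel_kernel :: "real \<Rightarrow> real \<Rightarrow> real \<Rightarrow> real \<Rightarrow> real" where
  "hankel_kernel b e x y =
     (\<Sum>m. bessel_coeff b m * (x\<^sup>2 / (4 * e) * (y\<^sup>2 / (4 * e))) ^ m) * exp (- (x\<^sup>2 / (4 * e)) - y\<^sup>2 / (4 * e))"

text \<open>
  Weber's second exponential integral, by termwise integration of the product of the two series.
  What matters for the sequel is the positivity of the right-hand side.
\<close>

lemma weber_integral:
  assumes b: "b \<ge> 1/2" and e: "e > 0"
  shows "has_bochner_integral (radial_measure b)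
      (\<lambda>t. exp (- e * t\<^sup>2) * (bessel_series b (x * t) * bessel_series b (y * t)))
      (Gamma b / (2 * e powr b) * hankel_kernel b e x y)"
proof -
  define P where "P = (\<lambda>n. \<Sum>k\<le>n. (bessel_coeff b k * (x\<^sup>2 / 4) ^ k) * (bessel_coeff b (n - k) * (y\<^sup>2 / 4) ^ (n - k)))"
  define Q where "Q = (\<lambda>n. pochhammer b n * (\<Sum>k\<le>n. (bessel_coeff b k * (x\<^sup>2 / (4 * e)) ^ k) * (bessel_coeff b (n - k) * (y\<^sup>2 / (4 * e)) ^ (n - k))))"
  define f where "f = (\<lambda>n t. (-1) ^ n * P n * (t ^ (2 * n) * exp (- e * t\<^sup>2)))"
  have b0: "b > 0" using b by simp
  have G: "Gamma b > 0" using b0 by (rule Gamma_real_pos)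
  have P0: "P n \<ge> 0" for n
    unfolding P_def using b0 by (intro sum_nonneg mult_nonneg_nonneg) (auto intro: less_imp_le[OF bessel_coeff_pos])
  have PQ: "P n * pochhammer b n / e ^ n = Q n" for n
  proof -
    have "P n / e ^ n = (\<Sum>k\<le>n. (bessel_coeff b k * (x\<^sup>2 / (4 * e)) ^ k) * (bessel_coeff b (n - k) * (y\<^sup>2 / (4 * e)) ^ (n - k)))"
      unfolding P_def sum_divide_distrib
    proof (intro sum.cong refl)
      fix k assume "k \<in> {..n}"
      then have "e ^ n = e ^ k * e ^ (n - k)" by (simp flip: power_add)
      then show "bessel_coeff b k * (x\<^sup>2 / 4) ^ k * (bessel_coeff b (n - k) * (y\<^sup>2 / 4) ^ (n - k)) / e ^ n =
        bessel_coeff b k * (x\<^sup>2 / (4 * e)) ^ k * (bessel_coeff b (n - k) * (y\<^sup>2 / (4 * e)) ^ (n - k))"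
        by (simp add: power_divide power_mult_distrib)
    qed
    then have "Q n = pochhammer b n * (P n / e ^ n)" unfolding Q_def by (simp only:)
    then show ?thesis by simp
  qed
  have mom: "has_bochner_integral (radial_measure b) (\<lambda>t. t ^ (2 * n) * exp (- e * t\<^sup>2))
      (Gamma b * pochhammer b n / (2 * e powr b * e ^ n))" for n
    using G b0 by (intro has_bochner_integral_nn_integral nn_integral_radial_gauss_moment b0 e)
      (use G e in \<open>auto simp: pochhammer_nonneg less_imp_le\<close>)
  have fi: "has_bochner_integral (radial_measure b) (f n) ((-1) ^ n * (Gamma b / (2 * e powr b) * Q n))" for n
    using has_bochner_integral_mult_right[OF mom[of n], of "(-1) ^ n * P n"]
    by (simp add: f_def PQ[symmetric] mult_ac)
  have fn: "(LINT t|radial_measure b. norm (f n t)) = Gamma b / (2 * e powr b) * Q n" for n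
  proof -
    have "norm (f n t) = P n * (t ^ (2 * n) * exp (- e * t\<^sup>2))" for t
      using P0[of n] by (simp add: f_def abs_mult power_even_abs)
    then show ?thesis
      using has_bochner_integral_mult_right[OF mom[of n], of "P n"]
      by (simp add: has_bochner_integral_iff PQ[symmetric] mult_ac)
  qed
  have sQ: "summable Q" and aQ: "(\<lambda>n. (-1) ^ n * Q n) sums hankel_kernel b e x y"
    using bessel_Cauchy_sums[OF b, of "x\<^sup>2 / (4 * e)" "y\<^sup>2 / (4 * e)"] e
    by (auto simp: Q_def hankel_kernel_def)
  have series: "(\<lambda>k. norm ((-1) ^ k * bessel_coeff b k * z ^ k)) = (\<lambda>k. bessel_coeff b k * \<bar>z\<bar> ^ k)" for z :: real
    using less_imp_le[OF bessel_coeff_pos[OF b0]] by (auto simp: abs_mult power_abs)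
  have prod: "(\<lambda>n. f n t) sums (exp (- e * t\<^sup>2) * (bessel_series b (x * t) * bessel_series b (y * t)))"
    and abs_sum: "summable (\<lambda>n. norm (f n t))" for t
  proof -
    have eq: "(\<Sum>k\<le>n. ((-1) ^ k * bessel_coeff b k * ((x * t)\<^sup>2 / 4) ^ k) * ((-1) ^ (n - k) * bessel_coeff b (n - k) * ((y * t)\<^sup>2 / 4) ^ (n - k)))
        = (-1) ^ n * P n * t ^ (2 * n)" for n
      unfolding P_def sum_distrib_left sum_distrib_right
    proof (intro sum.cong refl)
      fix k assume "k \<in> {..n}"
      then have "(-1::real) ^ n = (-1) ^ k * (-1) ^ (n - k)" "t ^ (2 * n) = (t\<^sup>2) ^ k * (t\<^sup>2) ^ (n - k)"
        by (simp_all add: power_mult flip: power_add)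
      then show "((-1) ^ k * bessel_coeff b k * ((x * t)\<^sup>2 / 4) ^ k) * ((-1) ^ (n - k) * bessel_coeff b (n - k) * ((y * t)\<^sup>2 / 4) ^ (n - k)) =
        (- 1) ^ n * (bessel_coeff b k * (x\<^sup>2 / 4) ^ k * (bessel_coeff b (n - k) * (y\<^sup>2 / 4) ^ (n - k))) * t ^ (2 * n)"
        by (simp add: power_divide power_mult_distrib)
    qed
    have "(\<lambda>n. (-1) ^ n * P n * t ^ (2 * n)) sums (bessel_series b (x * t) * bessel_series b (y * t))"
      unfolding eq[symmetric] bessel_series_def
      by (intro Cauchy_product_sums) (simp_all only: series summable_bessel_coeff[OF b])
    from sums_mult[OF this, of "exp (- e * t\<^sup>2)"]
    show "(\<lambda>n. f n t) sums (exp (- e * t\<^sup>2) * (bessel_series b (x * t) * bessel_series b (y * t)))"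
      by (simp add: f_def mult_ac)
    have eq': "(\<Sum>k\<le>n. (bessel_coeff b k * ((x * t)\<^sup>2 / 4) ^ k) * (bessel_coeff b (n - k) * ((y * t)\<^sup>2 / 4) ^ (n - k)))
        = P n * t ^ (2 * n)" for n
      unfolding P_def sum_distrib_left sum_distrib_right
    proof (intro sum.cong refl)
      fix k assume "k \<in> {..n}"
      then have "t ^ (2 * n) = (t\<^sup>2) ^ k * (t\<^sup>2) ^ (n - k)"
        by (simp_all add: power_mult flip: power_add)
      then show "(bessel_coeff b k * ((x * t)\<^sup>2 / 4) ^ k) * (bessel_coeff b (n - k) * ((y * t)\<^sup>2 / 4) ^ (n - k)) =
        (bessel_coeff b k * (x\<^sup>2 / 4) ^ k * (bessel_coeff b (n - k) * (y\<^sup>2 / 4) ^ (n - k))) * t ^ (2 * n)"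
        by (simp add: power_divide power_mult_distrib)
    qed
    have nb: "summable (\<lambda>k. norm (bessel_coeff b k * (r\<^sup>2 / 4) ^ k))" for r
      using summable_bessel_coeff[OF b, of "r\<^sup>2 / 4"] less_imp_le[OF bessel_coeff_pos[OF b0]] by simp
    have "summable (\<lambda>n. P n * t ^ (2 * n))"
      unfolding eq'[symmetric] by (intro summable_Cauchy_product nb)
    from summable_mult[OF this, of "exp (- e * t\<^sup>2)"]
    have "summable (\<lambda>n. exp (- e * t\<^sup>2) * (P n * t ^ (2 * n)))" .
    moreover have "norm (f n t) = exp (- e * t\<^sup>2) * (P n * t ^ (2 * n))" for n
      using P0[of n] by (simp add: f_def abs_mult power_even_abs)
    ultimately show "summable (\<lambda>n. norm (f n t))" by simp
  qed
  have int: "integrable (radial_measure b) (f n)" for n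
    using fi[of n] by (simp add: has_bochner_integral_iff)
  have sn: "summable (\<lambda>n. LINT t|radial_measure b. norm (f n t))"
    unfolding fn by (intro summable_mult sQ)
  have feq: "(\<lambda>t. \<Sum>n. f n t) = (\<lambda>t. exp (- e * t\<^sup>2) * (bessel_series b (x * t) * bessel_series b (y * t)))"
    using prod by (auto simp: sums_iff)
  have "integrable (radial_measure b) (\<lambda>t. \<Sum>n. f n t)"
    by (intro integrable_suminf int sn AE_I2 abs_sum)
  moreover have "(LINT t|radial_measure b. (\<Sum>n. f n t)) = (\<Sum>n. LINT t|radial_measure b. f n t)"
    by (intro integral_suminf int sn AE_I2 abs_sum)
  moreover have "(\<Sum>n. LINT t|radial_measure b. f n t) = Gamma b / (2 * e powr b) * hankel_kernel b e x y"
  proof -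
    have "(LINT t|radial_measure b. f n t) = Gamma b / (2 * e powr b) * ((-1) ^ n * Q n)" for n
      using fi[of n] by (simp add: has_bochner_integral_iff mult_ac)
    then show ?thesis
      using sums_mult[OF aQ, of "Gamma b / (2 * e powr b)"] by (simp add: sums_iff)
  qed
  ultimately show ?thesis unfolding feq by (simp add: has_bochner_integral_iff)
qed

lemma hankel_kernel_nonneg:
  assumes "b \<ge> 1/2" and "e > 0"
  shows "hankel_kernel b e x y \<ge> 0"
  unfolding hankel_kernel_def
  using assms less_imp_le[OF bessel_coeff_pos[of b]]
  by (intro mult_nonneg_nonneg suminf_nonneg summable_bessel_coeff) auto

text \<open>
  The heat kernel has constant total mass: integrated termwise against the Gaussian moments, the
  Pochhammer symbols cancel and the exponential series of \<open>x\<^sup>2 / (4 * e)\<close> remains.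
\<close>

lemma nn_integral_hankel_kernel:
  assumes b: "b \<ge> 1/2" and e: "e > 0"
  shows "(\<integral>\<^sup>+ y. ennreal (hankel_kernel b e x y) \<partial>radial_measure b) = ennreal (Gamma b * (4 * e) powr b / 2)"
proof -
  define X where "X = x\<^sup>2 / (4 * e)"
  have b0: "b > 0" using b by simp
  have G: "Gamma b > 0" using b0 by (rule Gamma_real_pos)
  have X0: "X \<ge> 0" using e by (simp add: X_def)
  have bc: "bessel_coeff b m \<ge> 0" for m using bessel_coeff_pos[OF b0] by (simp add: less_imp_le)
  have eq: "ennreal (hankel_kernel b e x y) =
     (\<Sum>m. ennreal (exp (- X) * bessel_coeff b m * X ^ m / (4 * e) ^ m) * ennreal (y ^ (2 * m) * exp (- (1 / (4 * e)) * y\<^sup>2)))" for y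
  proof -
    have "(\<lambda>m. bessel_coeff b m * (X * (y\<^sup>2 / (4 * e))) ^ m * exp (- X - y\<^sup>2 / (4 * e))) sums hankel_kernel b e x y"
      unfolding hankel_kernel_def X_def[symmetric]
      by (intro sums_mult2 summable_sums summable_bessel_coeff b)
    moreover have "bessel_coeff b m * (X * (y\<^sup>2 / (4 * e))) ^ m * exp (- X - y\<^sup>2 / (4 * e))
       = exp (- X) * bessel_coeff b m * X ^ m / (4 * e) ^ m * (y ^ (2 * m) * exp (- (1 / (4 * e)) * y\<^sup>2))" for m
    proof -
      have "exp (- X - y\<^sup>2 / (4 * e)) = exp (- X) * exp (- (1 / (4 * e)) * y\<^sup>2)"
        by (simp add: exp_add[symmetric])
      moreover have "(X * (y\<^sup>2 / (4 * e))) ^ m = X ^ m * y ^ (2 * m) / (4 * e) ^ m"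
        by (simp only: power_mult_distrib[of X] power_divide power_mult[of y 2 m] times_divide_eq_right)
      ultimately show ?thesis by (simp only:) (simp only: mult.assoc mult.commute mult.left_commute times_divide_eq_right times_divide_eq_left)
    qed
    ultimately have s: "(\<lambda>m. exp (- X) * bessel_coeff b m * X ^ m / (4 * e) ^ m * (y ^ (2 * m) * exp (- (1 / (4 * e)) * y\<^sup>2))) sums hankel_kernel b e x y"
      by simp
    then have "ennreal (hankel_kernel b e x y) = (\<Sum>m. ennreal (exp (- X) * bessel_coeff b m * X ^ m / (4 * e) ^ m * (y ^ (2 * m) * exp (- (1 / (4 * e)) * y\<^sup>2))))"
      using bc X0 e by (subst suminf_ennreal2) (auto simp: sums_iff)
    then show ?thesis using bc X0 e by (subst (asm) ennreal_mult') auto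
  qed
  have sX: "(\<lambda>m. X ^ m / fact m) sums exp X"
    using summable_exp[of X] by (auto simp: exp_def divide_inverse mult.commute intro!: summable_sums)
  have "(\<integral>\<^sup>+ y. ennreal (hankel_kernel b e x y) \<partial>radial_measure b) =
     (\<Sum>m. ennreal (exp (- X) * bessel_coeff b m * X ^ m / (4 * e) ^ m) *
        (\<integral>\<^sup>+ y. ennreal (y ^ (2 * m) * exp (- (1 / (4 * e)) * y\<^sup>2)) \<partial>radial_measure b))"
    unfolding eq by (subst nn_integral_suminf) (auto simp: nn_integral_cmult)
  also have "\<dots> = (\<Sum>m. ennreal (Gamma b * (4 * e) powr b / 2 * exp (- X) * (X ^ m / fact m)))"
  proof (intro suminf_cong)
    fix m
    have pe: "(1 / (4 * e)) powr b = 1 / (4 * e) powr b" using e by (simp add: powr_divide)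
    have pp: "pochhammer b m > 0" "(4 * e) powr b > 0" using b0 e by (auto simp: pochhammer_pos)
    show "ennreal (exp (- X) * bessel_coeff b m * X ^ m / (4 * e) ^ m) *
        (\<integral>\<^sup>+ y. ennreal (y ^ (2 * m) * exp (- (1 / (4 * e)) * y\<^sup>2)) \<partial>radial_measure b)
       = ennreal (Gamma b * (4 * e) powr b / 2 * exp (- X) * (X ^ m / fact m))"
    proof (subst nn_integral_radial_gauss_moment)
      have "exp (- X) * bessel_coeff b m * X ^ m / (4 * e) ^ m * (Gamma b * pochhammer b m / (2 * (1 / (4 * e)) powr b * (1 / (4 * e)) ^ m))
         = Gamma b * (4 * e) powr b / 2 * exp (- X) * (X ^ m / fact m)"
        unfolding pe bessel_coeff_def power_divide using pp e by (simp add: divide_simps)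
      then show "ennreal (exp (- X) * bessel_coeff b m * X ^ m / (4 * e) ^ m) *
          ennreal (Gamma b * pochhammer b m / (2 * (1 / (4 * e)) powr b * (1 / (4 * e)) ^ m)) =
          ennreal (Gamma b * (4 * e) powr b / 2 * exp (- X) * (X ^ m / fact m))"
        using bc X0 e by (subst ennreal_mult'[symmetric]) auto
    qed (use b0 e in auto)
  qed
  also have "\<dots> = ennreal (Gamma b * (4 * e) powr b / 2 * exp (- X) * exp X)"
    by (rule suminf_ennreal_eq[OF _ sums_mult[OF sX]]) (use G X0 in auto)
  also have "Gamma b * (4 * e) powr b / 2 * exp (- X) * exp X = Gamma b * (4 * e) powr b / 2 * (exp (- X) * exp X)"
    by (simp only: mult.assoc)
  also have "exp (- X) * exp X = 1" by (simp flip: exp_add)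
  finally show ?thesis by simp
qed

section \<open>Gaussian Fourier integrals\<close>

text \<open>
  A rescaling of the characteristic function of the standard normal distribution.
\<close>

lemma gauss_fourier_1:
  fixes e z :: real
  assumes e: "e > 0"
  shows "has_bochner_integral lborel (\<lambda>u. complex_of_real (exp (- e * u\<^sup>2)) * exp (- (\<i> * complex_of_real (u * z))))
     (complex_of_real (sqrt (pi / e) * exp (- z\<^sup>2 / (4 * e))))"
proof -
  define c where "c = sqrt (2 * e)"
  have c: "c > 0" "c\<^sup>2 = 2 * e" using e by (auto simp: c_def)
  define t where "t = - z / c"
  define f where "f = (\<lambda>x::real. complex_of_real (exp (- x\<^sup>2 / 2)) * iexp (t * x))"
  have nd: "complex_of_real (std_normal_density x) * iexp (t * x) = f x / complex_of_real (sqrt (2 * pi))" for x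
    by (simp add: f_def std_normal_density_def)
  have int1: "integrable lborel (\<lambda>x. std_normal_density x *\<^sub>R iexp (t * x))"
  proof (rule Bochner_Integration.integrable_bound[OF integrable_normal_density[of 1 0]])
    show "AE x in lborel. norm (std_normal_density x *\<^sub>R iexp (t * x)) \<le> norm (std_normal_density x)"
      by (auto simp: norm_mult)
  qed auto
  have fi: "integrable lborel f"
  proof -
    have "integrable lborel (\<lambda>x. complex_of_real (sqrt (2 * pi)) * (std_normal_density x *\<^sub>R iexp (t * x)))"
      using int1 by (intro integrable_mult_right)
    moreover have "complex_of_real (sqrt (2 * pi)) * (std_normal_density x *\<^sub>R iexp (t * x)) = f x" for x
      unfolding scaleR_conv_of_real nd by simp
    ultimately show ?thesis by simp
  qed
  have "char std_normal_distribution t = (\<integral>x. std_normal_density x *\<^sub>R iexp (t * x) \<partial>lborel)"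
    unfolding char_def by (subst integral_density) auto
  also have "\<dots> = (\<integral>x. f x \<partial>lborel) / complex_of_real (sqrt (2 * pi))"
    by (simp only: scaleR_conv_of_real nd) simp
  finally have "(\<integral>x. f x \<partial>lborel) = complex_of_real (sqrt (2 * pi)) * complex_of_real (exp (- t\<^sup>2 / 2))"
    by (simp add: char_std_normal_distribution)
  then have hf: "has_bochner_integral lborel f (complex_of_real (sqrt (2 * pi) * exp (- t\<^sup>2 / 2)))"
    using fi by (simp add: has_bochner_integral_iff)
  have "has_bochner_integral lborel (\<lambda>u. f (0 + c * u)) (complex_of_real (sqrt (2 * pi) * exp (- t\<^sup>2 / 2)) /\<^sub>R \<bar>c\<bar>)"
    using hf c by (subst (asm) lborel_has_bochner_integral_real_affine_iff[of c _ _ 0]) auto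
  moreover have "f (0 + c * u) = complex_of_real (exp (- e * u\<^sup>2)) * exp (- (\<i> * complex_of_real (u * z)))" for u
    using c by (simp add: f_def t_def power_mult_distrib mult_ac)
  moreover have "complex_of_real (sqrt (2 * pi) * exp (- t\<^sup>2 / 2)) /\<^sub>R \<bar>c\<bar> = complex_of_real (sqrt (pi / e) * exp (- z\<^sup>2 / (4 * e)))"
  proof -
    have "sqrt (2 * pi) / c = sqrt (pi / e)"
      unfolding c_def by (simp add: real_sqrt_divide[symmetric])
    moreover have "t\<^sup>2 / 2 = z\<^sup>2 / (4 * e)" using c by (simp add: t_def power_divide)
    moreover have "complex_of_real r /\<^sub>R \<bar>c\<bar> = complex_of_real (r / c)" for r
      using c(1) by (simp add: scaleR_conv_of_real divide_inverse mult.commute)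
    moreover have "sqrt (2 * pi) * exp (- t\<^sup>2 / 2) / c = sqrt (2 * pi) / c * exp (- (t\<^sup>2 / 2))"
      by simp
    ultimately show ?thesis by (simp only:) simp
  qed
  ultimately show ?thesis by simp
qed

lemma nn_integral_gauss_1:
  fixes e a :: real
  assumes e: "e > 0"
  shows "(\<integral>\<^sup>+ u. ennreal (exp (- (u - a)\<^sup>2 / (4 * e))) \<partial>lborel) = ennreal (sqrt (4 * pi * e))"
proof -
  have s: "sqrt (2 * e) > 0" using e by simp
  have eq: "exp (- (u - a)\<^sup>2 / (4 * e)) = sqrt (4 * pi * e) * normal_density a (sqrt (2 * e)) u" for u
    using e by (simp add: normal_density_def) (simp add: mult.assoc)
  have "has_bochner_integral lborel (\<lambda>u. sqrt (4 * pi * e) * normal_density a (sqrt (2 * e)) u) (sqrt (4 * pi * e) * 1)"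
    using integrable_normal_density[OF s, of a] integral_normal_density[OF s, of a]
    by (intro has_bochner_integral_mult_right) (simp add: has_bochner_integral_iff)
  then show ?thesis unfolding eq
    using e by (subst nn_integral_eq_integral) (auto simp: has_bochner_integral_iff)
qed

lemma has_bochner_integral_lborel_prod:
  fixes f :: "'a::euclidean_space \<Rightarrow> real \<Rightarrow> complex"
  assumes "\<And>b. b \<in> Basis \<Longrightarrow> has_bochner_integral lborel (f b) (I b)"
  shows "has_bochner_integral lborel (\<lambda>x::'a. \<Prod>b\<in>Basis. f b (x \<bullet> b)) (\<Prod>b\<in>Basis. I b)"
proof -
  interpret product_sigma_finite "\<lambda>_::'a. lborel :: real measure" by standard
  have i: "integrable lborel (f b)" "integral\<^sup>L lborel (f b) = I b" if "b \<in> Basis" for b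
    using assms[OF that] by (auto simp: has_bochner_integral_iff)
  have [measurable]: "f b \<in> borel_measurable borel" if "b \<in> Basis" for b
    using borel_measurable_integrable[OF i(1)[OF that]] by simp
  have eq: "(\<lambda>x. \<Prod>b\<in>Basis. f b ((\<Sum>b\<in>Basis. x b *\<^sub>R b) \<bullet> b)) = (\<lambda>x. \<Prod>b\<in>Basis. f b (x b))"
    by (auto intro!: prod.cong simp: inner_sum_left inner_Basis if_distrib cong: if_cong)
  have "has_bochner_integral (\<Pi>\<^sub>M b\<in>(Basis::'a set). lborel) (\<lambda>x. \<Prod>b\<in>Basis. f b (x b)) (\<Prod>b\<in>Basis. I b)"
    using product_integrable_prod[OF finite_Basis, of f] product_integral_prod[OF finite_Basis, of f] i
    by (auto simp: has_bochner_integral_iff)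
  then have "has_bochner_integral (\<Pi>\<^sub>M b\<in>(Basis::'a set). lborel)
     (\<lambda>x. (\<lambda>x::'a. \<Prod>b\<in>Basis. f b (x \<bullet> b)) (\<Sum>b\<in>Basis. x b *\<^sub>R b)) (\<Prod>b\<in>Basis. I b)"
    by (simp add: eq)
  then show ?thesis
    unfolding lborel_eq[where 'a = 'a]
    by (rule has_bochner_integral_distr[rotated 2]) auto
qed

lemma power_sqrt_powr: "a > 0 \<Longrightarrow> sqrt a ^ n = a powr (real n / 2)"
  by (simp add: powr_half_sqrt[symmetric] powr_powr flip: powr_realpow)

lemma gauss_fourier:
  fixes z :: "'a::euclidean_space"
  assumes e: "e > 0"
  shows "has_bochner_integral lborel (\<lambda>v::'a. complex_of_real (exp (- e * (norm v)\<^sup>2)) * exp (- (\<i> * complex_of_real (v \<bullet> z))))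
     (complex_of_real ((pi / e) powr (real DIM('a) / 2) * exp (- (norm z)\<^sup>2 / (4 * e))))"
proof -
  have n2: "(norm v)\<^sup>2 = (\<Sum>b\<in>Basis. (v \<bullet> b)\<^sup>2)" for v :: 'a
    unfolding power2_norm_eq_inner euclidean_inner[of v v] by (simp add: power2_eq_square)
  have "(\<lambda>v::'a. complex_of_real (exp (- e * (norm v)\<^sup>2)) * exp (- (\<i> * complex_of_real (v \<bullet> z)))) =
     (\<lambda>v. \<Prod>b\<in>Basis. complex_of_real (exp (- e * (v \<bullet> b)\<^sup>2)) * exp (- (\<i> * complex_of_real ((v \<bullet> b) * (z \<bullet> b)))))"
    unfolding n2 by (simp add: prod.distrib euclidean_inner[of _ z] sum_distrib_left exp_sum sum_negf[symmetric])
  moreover have "complex_of_real ((pi / e) powr (real DIM('a) / 2) * exp (- (norm z)\<^sup>2 / (4 * e))) =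
     (\<Prod>b\<in>(Basis::'a set). complex_of_real (sqrt (pi / e) * exp (- (z \<bullet> b)\<^sup>2 / (4 * e))))"
  proof -
    have "(\<Prod>b\<in>(Basis::'a set). sqrt (pi / e) * exp (- (z \<bullet> b)\<^sup>2 / (4 * e))) =
      sqrt (pi / e) ^ DIM('a) * exp (\<Sum>b\<in>(Basis::'a set). - (z \<bullet> b)\<^sup>2 / (4 * e))"
      by (simp add: prod.distrib exp_sum)
    also have "(\<Sum>b\<in>(Basis::'a set). - (z \<bullet> b)\<^sup>2 / (4 * e)) = - (norm z)\<^sup>2 / (4 * e)"
      unfolding n2 by (simp add: sum_divide_distrib sum_negf)
    also have "sqrt (pi / e) ^ DIM('a) = (pi / e) powr (real DIM('a) / 2)"
      using e by (intro power_sqrt_powr) simp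
    finally show ?thesis unfolding of_real_prod[symmetric] by simp
  qed
  ultimately show ?thesis
    by (simp only:) (intro has_bochner_integral_lborel_prod gauss_fourier_1 e)
qed

lemma nn_integral_gauss:
  fixes a :: "'a::euclidean_space"
  assumes e: "e > 0"
  shows "(\<integral>\<^sup>+ v. ennreal (exp (- (norm (a - v))\<^sup>2 / (4 * e))) \<partial>lborel) = ennreal ((4 * pi * e) powr (real DIM('a) / 2))"
proof -
  have "exp (- (norm (a - v))\<^sup>2 / (4 * e)) = (\<Prod>b\<in>Basis. exp (- (v \<bullet> b - a \<bullet> b)\<^sup>2 / (4 * e)))" for v
  proof -
    have "(norm (a - v))\<^sup>2 = (\<Sum>b\<in>Basis. (v \<bullet> b - a \<bullet> b)\<^sup>2)"
      unfolding power2_norm_eq_inner euclidean_inner[of "a - v" "a - v"]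
      by (simp add: inner_diff_left power2_eq_square algebra_simps)
    then show ?thesis by (simp add: exp_sum sum_divide_distrib sum_negf[symmetric])
  qed
  then have "(\<integral>\<^sup>+ v. ennreal (exp (- (norm (a - v))\<^sup>2 / (4 * e))) \<partial>lborel) =
    (\<integral>\<^sup>+ v. (\<Prod>b\<in>Basis. ennreal (exp (- (v \<bullet> b - a \<bullet> b)\<^sup>2 / (4 * e)))) \<partial>lborel)"
    by (simp add: prod_ennreal)
  also have "\<dots> = (\<Prod>b\<in>(Basis::'a set). ennreal (sqrt (4 * pi * e)))"
    by (subst nn_integral_lborel_prod) (simp_all only: nn_integral_gauss_1[OF e], simp_all)
  also have "\<dots> = ennreal (sqrt (4 * pi * e) ^ DIM('a))"
    using e by (simp add: ennreal_power)
  finally show ?thesis using e by (simp add: power_sqrt_powr)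
qed

section \<open>The Weinstein measure and its heat kernel\<close>

lemma has_bochner_integral_pair_mult:
  fixes g :: "'a \<Rightarrow> complex" and h :: "'b \<Rightarrow> complex"
  assumes "sigma_finite_measure M" "sigma_finite_measure N"
    and g: "has_bochner_integral M g I" and h: "has_bochner_integral N h J"
  shows "has_bochner_integral (M \<Otimes>\<^sub>M N) (\<lambda>z. g (fst z) * h (snd z)) (I * J)"
proof -
  interpret M: sigma_finite_measure M by fact
  interpret N: sigma_finite_measure N by fact
  interpret pair_sigma_finite M N ..
  have gi: "integrable M g" "integral\<^sup>L M g = I" and hi: "integrable N h" "integral\<^sup>L N h = J"
    using g h by (auto simp: has_bochner_integral_iff)
  note [measurable] = borel_measurable_integrable[OF gi(1)] borel_measurable_integrable[OF hi(1)]
  have int: "integrable (M \<Otimes>\<^sub>M N) (\<lambda>z. g (fst z) * h (snd z))"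
    by (rule Fubini_integrable) (use gi hi in \<open>auto simp: norm_mult\<close>)
  have "(\<integral>x. \<integral>y. g x * h y \<partial>N \<partial>M) = integral\<^sup>L (M \<Otimes>\<^sub>M N) (\<lambda>z. g (fst z) * h (snd z))"
    using integral_fst'[of "\<lambda>z. g (fst z) * h (snd z)"] int by simp
  moreover have "(\<integral>x. \<integral>y. g x * h y \<partial>N \<partial>M) = I * J" by (simp add: gi hi)
  ultimately show ?thesis using int by (simp add: has_bochner_integral_iff)
qed

lemma sigma_finite_radial_measure: "sigma_finite_measure (radial_measure b)"
  unfolding radial_measure_def
  by (subst sigma_finite_measure.sigma_finite_iff_density_finite[OF lborel.sigma_finite_measure_axioms]) auto

text \<open>
  The normalizing constant of the Weinstein measure in dimension \<open>n + 1\<close>.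
\<close>

definition weinstein_const :: "real \<Rightarrow> nat \<Rightarrow> real" where
  "weinstein_const \<alpha> n = 1 / ((2 * pi) powr (real n / 2) * 2 powr \<alpha> * Gamma (\<alpha> + 1))"

lemma snd_borel_measurable [measurable]:
  "snd \<in> borel_measurable (borel :: ('a::topological_space \<times> 'b::topological_space) measure)"
  by (intro borel_measurable_continuous_onI continuous_intros)

lemma half_space_borel [measurable]: "half_space \<in> sets borel"
  unfolding half_space_def by (intro borel_open open_Collect_less continuous_intros)

lemma pair_radial_measure:
  "(lborel :: (real ^ 'd) measure) \<Otimes>\<^sub>M radial_measure b =
   density lborel (\<lambda>x. ennreal (indicator {0<..} (snd x) * snd x powr (2 * b - 1)))"
proof -
  have "(lborel :: (real ^ 'd) measure) \<Otimes>\<^sub>M radial_measure b =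
     density lborel (\<lambda>_. 1) \<Otimes>\<^sub>M density lborel (\<lambda>t. ennreal (indicator {0<..} t * t powr (2 * b - 1)))"
    by (simp add: radial_measure_def density_1)
  also have "\<dots> = density (lborel \<Otimes>\<^sub>M lborel) (\<lambda>(x, t). 1 * ennreal (indicator {0<..} t * t powr (2 * b - 1)))"
    by (rule pair_measure_density)
      (auto intro: lborel.sigma_finite_measure_axioms sigma_finite_radial_measure[unfolded radial_measure_def])
  finally show ?thesis by (simp add: lborel_prod case_prod_unfold)
qed

lemma weinstein_const_pos: "\<alpha> > -1/2 \<Longrightarrow> weinstein_const \<alpha> n > 0"
  by (auto simp: weinstein_const_def Gamma_real_pos)

lemma weinstein_measure_alt:
  "(weinstein_measure \<alpha> :: ((real ^ 'd) \<times> real) measure) =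
    density (restrict_space lborel half_space)
      (\<lambda>x. ennreal (weinstein_const \<alpha> CARD('d) * snd x powr (2 * \<alpha> + 1)))"
  by (simp add: weinstein_measure_def weinstein_const_def)

text \<open>
  The Weinstein measure is a measure on the half-space only, with the trace \<open>\<sigma>\<close>-algebra. For functions that are
  measurable on the whole space, this lemma and the next one reduce its integrals to those of the product of Lebesgue
  measure with the radial measure, so that integrals of products factorize.
\<close>

lemma nn_integral_weinstein_measure:
  fixes f :: "(real ^ 'd) \<times> real \<Rightarrow> ennreal"
  assumes a: "\<alpha> > -1/2" and f [measurable]: "f \<in> borel_measurable borel"
  shows "(\<integral>\<^sup>+ x. f x \<partial>weinstein_measure \<alpha>) =
    ennreal (weinstein_const \<alpha> CARD('d)) * (\<integral>\<^sup>+ x. f x \<partial>(lborel \<Otimes>\<^sub>M radial_measure (\<alpha> + 1)))"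
proof -
  let ?c = "weinstein_const \<alpha> CARD('d)"
  have [measurable]: "f \<in> borel_measurable (restrict_space lborel half_space)"
    "(snd :: (real ^ 'd) \<times> real \<Rightarrow> real) \<in> borel_measurable (restrict_space lborel half_space)"
    by (auto intro!: measurable_restrict_space1)
  have "(\<integral>\<^sup>+ x. f x \<partial>weinstein_measure \<alpha>) =
     (\<integral>\<^sup>+ x. ennreal (?c * snd x powr (2 * \<alpha> + 1)) * f x * indicator half_space x \<partial>lborel)"
    unfolding weinstein_measure_alt
    by (subst nn_integral_density) (auto simp: nn_integral_restrict_space)
  also have "\<dots> = (\<integral>\<^sup>+ x. ennreal ?c * (ennreal (indicator {0<..} (snd x) * snd x powr (2 * (\<alpha> + 1) - 1)) * f x) \<partial>lborel)"
    using weinstein_const_pos[OF a, of "CARD('d)"]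
    by (intro nn_integral_cong) (auto simp: half_space_def indicator_def ennreal_mult' mult.assoc add.commute)
  also have "\<dots> = ennreal ?c * (\<integral>\<^sup>+ x. f x \<partial>(lborel \<Otimes>\<^sub>M radial_measure (\<alpha> + 1)))"
    unfolding pair_radial_measure by (simp add: nn_integral_cmult nn_integral_density)
  finally show ?thesis .
qed

lemma has_bochner_integral_weinstein_measure:
  fixes f :: "(real ^ 'd) \<times> real \<Rightarrow> complex"
  assumes a: "\<alpha> > -1/2" and f [measurable]: "f \<in> borel_measurable borel"
    and I: "has_bochner_integral (lborel \<Otimes>\<^sub>M radial_measure (\<alpha> + 1)) f I"
  shows "has_bochner_integral (weinstein_measure \<alpha>) f (weinstein_const \<alpha> CARD('d) *\<^sub>R I)"
proof -
  let ?c = "weinstein_const \<alpha> CARD('d)"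
  have [measurable]: "f \<in> borel_measurable (restrict_space lborel half_space)"
    "(snd :: (real ^ 'd) \<times> real \<Rightarrow> real) \<in> borel_measurable (restrict_space lborel half_space)"
    by (auto intro!: measurable_restrict_space1)
  let ?w = "\<lambda>x::(real ^ 'd) \<times> real. indicator {0<..} (snd x) * snd x powr (2 * (\<alpha> + 1) - 1)"
  have "has_bochner_integral lborel (\<lambda>x. ?w x *\<^sub>R f x) I"
    using I unfolding pair_radial_measure has_bochner_integral_iff
    by (subst (asm) integrable_density, simp_all, subst (asm) integral_density, simp_all)
  then have "has_bochner_integral lborel (\<lambda>x. ?c *\<^sub>R (?w x *\<^sub>R f x)) (?c *\<^sub>R I)"
    by (rule has_bochner_integral_scaleR_right)
  moreover have "(\<lambda>x. ?c *\<^sub>R (?w x *\<^sub>R f x)) =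
      (\<lambda>x. indicator half_space x *\<^sub>R ((?c * snd x powr (2 * \<alpha> + 1)) *\<^sub>R f x))"
    by (auto simp: half_space_def indicator_def add.commute)
  ultimately have "has_bochner_integral (restrict_space lborel half_space)
      (\<lambda>x. (?c * snd x powr (2 * \<alpha> + 1)) *\<^sub>R f x) (?c *\<^sub>R I)"
    by (subst has_bochner_integral_restrict_space) auto
  then show ?thesis
    unfolding weinstein_measure_alt
    using weinstein_const_pos[OF a, of "CARD('d)"] by (intro has_bochner_integral_density) auto
qed

lemma weinstein_kernel_conv_bessel_series:
  assumes "\<alpha> > -1/2"
  shows "weinstein_kernel \<alpha> x l =
    exp (- (\<i> * complex_of_real (fst l \<bullet> fst x))) * complex_of_real (bessel_series (\<alpha> + 1) (snd x * snd l))"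
  unfolding weinstein_kernel_def bessel_series_def bessel_j_series[OF assms] by (simp add: mult.commute)

text \<open>
  The integral of a Gaussian against a product of two Weinstein kernels
  (see \<open>gauss_weinstein_kernels\<close>): the Euclidean heat kernel in \<open>x'\<close> times the
  Bessel heat kernel in \<open>x\<^sub>d\<^sub>+\<^sub>1\<close>.
\<close>

definition heat_kernel :: "real \<Rightarrow> real \<Rightarrow> (real ^ 'd) \<times> real \<Rightarrow> (real ^ 'd) \<times> real \<Rightarrow> real" where
  "heat_kernel \<alpha> e x y = weinstein_const \<alpha> CARD('d) *
     ((pi / e) powr (real CARD('d) / 2) * exp (- (norm (fst x - fst y))\<^sup>2 / (4 * e))) *
     (Gamma (\<alpha> + 1) / (2 * e powr (\<alpha> + 1)) * hankel_kernel (\<alpha> + 1) e (snd x) (snd y))"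

lemma bessel_series_measurable [measurable]:
  "\<alpha> > -1/2 \<Longrightarrow> bessel_series (\<alpha> + 1) \<in> borel_measurable borel"
  using borel_measurable_continuous_onI[OF continuous_bessel_j[of \<alpha>]]
  by (simp add: bessel_series_def[abs_def] bessel_j_series cong: measurable_cong)

lemma gauss_weinstein_kernels:
  fixes x y :: "(real ^ 'd) \<times> real"
  assumes a: "\<alpha> > -1/2" and e: "e > 0"
  shows "has_bochner_integral (weinstein_measure \<alpha>)
     (\<lambda>l. complex_of_real (exp (- e * (norm l)\<^sup>2)) * (weinstein_kernel \<alpha> x l * cnj (weinstein_kernel \<alpha> y l)))
     (complex_of_real (heat_kernel \<alpha> e x y))"
proof -
  let ?b = "\<alpha> + 1"
  define g where "g = (\<lambda>v::real ^ 'd. complex_of_real (exp (- e * (norm v)\<^sup>2)) * exp (- (\<i> * complex_of_real (v \<bullet> (fst x - fst y)))))"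
  define h where "h = (\<lambda>t. complex_of_real (exp (- e * t\<^sup>2) * (bessel_series ?b (snd x * t) * bessel_series ?b (snd y * t))))"
  have eq: "complex_of_real (exp (- e * (norm l)\<^sup>2)) * (weinstein_kernel \<alpha> x l * cnj (weinstein_kernel \<alpha> y l))
     = g (fst l) * h (snd l)" for l
  proof -
    have "(norm l)\<^sup>2 = (norm (fst l))\<^sup>2 + (snd l)\<^sup>2" by (simp add: norm_prod_def)
    then have E: "complex_of_real (exp (- e * (norm l)\<^sup>2)) =
        complex_of_real (exp (- e * (norm (fst l))\<^sup>2)) * complex_of_real (exp (- e * (snd l)\<^sup>2))"
      by (simp add: distrib_left exp_diff exp_minus divide_inverse)
    have "exp (- (\<i> * complex_of_real (fst l \<bullet> fst x))) * cnj (exp (- (\<i> * complex_of_real (fst l \<bullet> fst y)))) =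
        exp (- (\<i> * complex_of_real (fst l \<bullet> (fst x - fst y))))"
      by (simp add: exp_cnj inner_diff_right algebra_simps flip: exp_add)
    then show ?thesis
      unfolding g_def h_def E weinstein_kernel_conv_bessel_series[OF a]
      by (simp add: mult_ac)
  qed
  have "has_bochner_integral lborel g (complex_of_real ((pi / e) powr (real CARD('d) / 2) * exp (- (norm (fst x - fst y))\<^sup>2 / (4 * e))))"
    unfolding g_def using gauss_fourier[OF e, of "fst x - fst y"] by simp
  moreover have "has_bochner_integral (radial_measure ?b) h
      (complex_of_real (Gamma ?b / (2 * e powr ?b) * hankel_kernel ?b e (snd x) (snd y)))"
    unfolding h_def using a by (intro has_bochner_integral_of_real weber_integral e) auto
  ultimately have "has_bochner_integral (lborel \<Otimes>\<^sub>M radial_measure ?b) (\<lambda>l. g (fst l) * h (snd l))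
     (complex_of_real ((pi / e) powr (real CARD('d) / 2) * exp (- (norm (fst x - fst y))\<^sup>2 / (4 * e))) *
      complex_of_real (Gamma ?b / (2 * e powr ?b) * hankel_kernel ?b e (snd x) (snd y)))"
    by (intro has_bochner_integral_pair_mult sigma_finite_radial_measure lborel.sigma_finite_measure_axioms)
  moreover have "(\<lambda>l. g (fst l) * h (snd l)) \<in> borel_measurable borel"
    unfolding g_def h_def borel_prod[symmetric] using a by measurable
  ultimately have "has_bochner_integral (weinstein_measure \<alpha>) (\<lambda>l. g (fst l) * h (snd l))
     (weinstein_const \<alpha> CARD('d) *\<^sub>R (complex_of_real ((pi / e) powr (real CARD('d) / 2) * exp (- (norm (fst x - fst y))\<^sup>2 / (4 * e))) *
      complex_of_real (Gamma ?b / (2 * e powr ?b) * hankel_kernel ?b e (snd x) (snd y))))"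
    by (intro has_bochner_integral_weinstein_measure a)
  then show ?thesis
    unfolding eq by (simp add: heat_kernel_def scaleR_conv_of_real mult.assoc)
qed

lemma heat_kernel_nonneg: "\<alpha> > -1/2 \<Longrightarrow> e > 0 \<Longrightarrow> heat_kernel \<alpha> e x y \<ge> 0"
  unfolding heat_kernel_def
  by (intro mult_nonneg_nonneg hankel_kernel_nonneg less_imp_le[OF weinstein_const_pos])
    (auto simp: Gamma_real_pos less_imp_le)

lemma hankel_kernel_measurable [measurable]:
  assumes "b \<ge> 1/2"
  shows "(\<lambda>(x, y). hankel_kernel b e x y) \<in> borel_measurable (borel \<Otimes>\<^sub>M borel)"
  unfolding hankel_kernel_def by measurable

text \<open>
  The constants of the Weinstein measure are chosen such that the transform is an isometry of
  \<open>L\<^sup>2\<close>; here this appears as total mass \<open>1\<close> of the heat kernel.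
\<close>

lemma nn_integral_heat_kernel:
  fixes x :: "(real ^ 'd) \<times> real"
  assumes a: "\<alpha> > -1/2" and e: "e > 0"
  shows "(\<integral>\<^sup>+ y. ennreal (heat_kernel \<alpha> e x y) \<partial>weinstein_measure \<alpha>) = 1"
proof -
  let ?b = "\<alpha> + 1"
  let ?c = "weinstein_const \<alpha> CARD('d)"
  let ?n = "real CARD('d) / 2"
  let ?G = "Gamma ?b / (2 * e powr ?b)"
  have b: "?b \<ge> 1/2" using a by simp
  have G: "Gamma ?b > 0" using a by (intro Gamma_real_pos) auto
  have c: "?c > 0" using a by (rule weinstein_const_pos)
  have [measurable]: "(\<lambda>t. hankel_kernel ?b e (snd x) t) \<in> borel_measurable borel"
    using measurable_Pair2[OF hankel_kernel_measurable[OF b, of e], of "snd x"] by simp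
  have [measurable]: "(\<lambda>y. hankel_kernel ?b e (snd x) (snd y)) \<in> borel_measurable (borel :: ((real ^ 'd) \<times> real) measure)"
    by measurable
  interpret R: sigma_finite_measure "radial_measure ?b" by (rule sigma_finite_radial_measure)
  define A where "A = (\<lambda>v::real ^ 'd. ennreal (exp (- (norm (fst x - v))\<^sup>2 / (4 * e))))"
  define H where "H = (\<lambda>t. ennreal (hankel_kernel ?b e (snd x) t))"
  define k where "k = ?c * (pi / e) powr ?n * ?G"
  have k: "k \<ge> 0" using c G e by (simp add: k_def)
  have [measurable]: "A \<in> borel_measurable borel" "H \<in> borel_measurable borel"
    unfolding A_def H_def by measurable
  have hk: "ennreal (heat_kernel \<alpha> e x y) = ennreal k * (A (fst y) * H (snd y))" for y
    using k hankel_kernel_nonneg[OF b e]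
    by (simp add: A_def H_def heat_kernel_def k_def mult_ac flip: ennreal_mult)
  have "(\<integral>\<^sup>+ y. ennreal (heat_kernel \<alpha> e x y) \<partial>weinstein_measure \<alpha>) =
     ennreal ?c * (\<integral>\<^sup>+ y. ennreal (heat_kernel \<alpha> e x y) \<partial>(lborel \<Otimes>\<^sub>M radial_measure ?b))"
    unfolding hk by (rule nn_integral_weinstein_measure[OF a]) (simp add: borel_prod[symmetric])
  also have "(\<integral>\<^sup>+ y. ennreal (heat_kernel \<alpha> e x y) \<partial>(lborel \<Otimes>\<^sub>M radial_measure ?b)) =
     (\<integral>\<^sup>+ v. \<integral>\<^sup>+ t. ennreal k * (A v * H t) \<partial>radial_measure ?b \<partial>lborel)"
    unfolding hk by (subst R.nn_integral_fst[symmetric]) auto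
  also have "\<dots> = ennreal k * ((\<integral>\<^sup>+ v. A v \<partial>lborel) * (\<integral>\<^sup>+ t. H t \<partial>radial_measure ?b))"
    by (simp add: nn_integral_cmult nn_integral_multc)
  also have "(\<integral>\<^sup>+ v. A v \<partial>lborel) = ennreal ((4 * pi * e) powr ?n)"
    unfolding A_def by (subst nn_integral_gauss[OF e]) simp
  also have "(\<integral>\<^sup>+ t. H t \<partial>radial_measure ?b) = ennreal (Gamma ?b * (4 * e) powr ?b / 2)"
    unfolding H_def by (rule nn_integral_hankel_kernel[OF b e])
  also have "ennreal ?c * (ennreal k * (ennreal ((4 * pi * e) powr ?n) * ennreal (Gamma ?b * (4 * e) powr ?b / 2))) =
     ennreal (?c * (k * ((4 * pi * e) powr ?n * (Gamma ?b * (4 * e) powr ?b / 2))))"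
    using c k G by (simp flip: ennreal_mult)
  also have "?c * (k * ((4 * pi * e) powr ?n * (Gamma ?b * (4 * e) powr ?b / 2))) = 1"
  proof -
    have 1: "(pi / e) powr ?n * (4 * pi * e) powr ?n = ((2 * pi) powr ?n)\<^sup>2"
    proof -
      have "(pi / e) powr ?n * (4 * pi * e) powr ?n = (pi / e * (4 * pi * e)) powr ?n"
        by (rule powr_mult[symmetric])
      also have "pi / e * (4 * pi * e) = (2 * pi) * (2 * pi)" using e by simp
      also have "\<dots> powr ?n = ((2 * pi) powr ?n)\<^sup>2"
        by (simp only: powr_mult power2_eq_square)
      finally show ?thesis .
    qed
    have 2: "(4 * e) powr ?b / (e powr ?b * 4) = (2 powr \<alpha>)\<^sup>2"
    proof -
      have "(4 * e) powr ?b = 4 powr ?b * e powr ?b" using e by (simp add: powr_mult)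
      also have "4 powr ?b = 4 * (2 * 2) powr \<alpha>" by (simp add: powr_add)
      also have "(2 * 2) powr \<alpha> = (2 powr \<alpha>)\<^sup>2" by (simp only: powr_mult power2_eq_square)
      finally show ?thesis using e by simp
    qed
    have "?c * (k * ((4 * pi * e) powr ?n * (Gamma ?b * (4 * e) powr ?b / 2))) =
       ?c\<^sup>2 * ((pi / e) powr ?n * (4 * pi * e) powr ?n) * (Gamma ?b)\<^sup>2 * ((4 * e) powr ?b / (e powr ?b * 4))"
      unfolding k_def power2_eq_square
      by (simp only: times_divide_eq_right times_divide_eq_left divide_divide_eq_left mult_ac)
    also have "\<dots> = 1" unfolding 1 2 using G by (simp add: weinstein_const_def power_divide power_mult_distrib)
    finally show ?thesis .
  qed
  finally show ?thesis by simp
qed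

section \<open>Bounded kernels and Schur's test\<close>

text \<open>
  The \<open>p\<close>-th power of the \<open>L\<^sup>p\<close> norm. All estimates are made for this quantity: the triangle
  inequality becomes \<open>mass_diff_triangle\<close>, whose factor goes into the constant, and roots are taken
  only in the final step.
\<close>

definition mass :: "'a measure \<Rightarrow> real \<Rightarrow> ('a \<Rightarrow> complex) \<Rightarrow> ennreal" where
  "mass M p f = (\<integral>\<^sup>+ x. ennreal (cmod (f x) powr p) \<partial>M)"

lemma cnj_borel_measurable [measurable]: "cnj \<in> borel_measurable borel"
  by (intro borel_measurable_continuous_onI continuous_intros)

text \<open>
  The argument uses just two properties of the Weinstein transform: its kernel is bounded by \<open>1\<close>, and
  it is bounded on \<open>L\<^sup>2\<close>. The general part of the proof is carried out for integral transforms
  on an arbitrary \<open>\<sigma>\<close>-finite measure space with these properties.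
\<close>

locale bounded_kernel = sigma_finite_measure M for M :: "'a measure" +
  fixes k :: "'a \<Rightarrow> 'a \<Rightarrow> complex"
  assumes kernel_measurable [measurable]: "(\<lambda>(x, y). k x y) \<in> borel_measurable (M \<Otimes>\<^sub>M M)"
    and kernel_bound: "\<And>x y. x \<in> space M \<Longrightarrow> y \<in> space M \<Longrightarrow> cmod (k x y) \<le> 1"
begin

definition transform :: "('a \<Rightarrow> complex) \<Rightarrow> 'a \<Rightarrow> complex" where
  "transform f y = (LINT x|M. f x * k x y)"

lemma transform_measurable [measurable]:
  assumes [measurable]: "f \<in> borel_measurable M"
  shows "transform f \<in> borel_measurable M"
  unfolding transform_def[abs_def] by measurable

lemma integrable_transform:
  assumes f: "integrable M f" and y: "y \<in> space M"
  shows "integrable M (\<lambda>x. f x * k x y)"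
proof (rule Bochner_Integration.integrable_bound[OF f])
  have "(\<lambda>x. k x y) \<in> borel_measurable M"
    using measurable_Pair1[OF kernel_measurable, of y] y by simp
  then show "(\<lambda>x. f x * k x y) \<in> borel_measurable M"
    using borel_measurable_integrable[OF f] by simp
  show "AE x in M. norm (f x * k x y) \<le> norm (f x)"
    using kernel_bound[OF _ y] by (intro AE_I2) (simp add: norm_mult mult_left_le)
qed

lemma transform_bound:
  assumes f: "integrable M f" and y: "y \<in> space M"
  shows "cmod (transform f y) \<le> (LINT x|M. cmod (f x))"
proof -
  have "cmod (transform f y) \<le> (LINT x|M. cmod (f x * k x y))"
    unfolding transform_def by (rule integral_norm_bound)
  also have "\<dots> \<le> (LINT x|M. cmod (f x))"
    using kernel_bound[OF _ y] f integrable_transform[OF f y]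
    by (intro integral_mono integrable_norm) (simp_all add: norm_mult mult_left_le)
  finally show ?thesis .
qed

lemma transform_add:
  "integrable M f \<Longrightarrow> integrable M g \<Longrightarrow> y \<in> space M \<Longrightarrow>
     transform (\<lambda>x. f x + g x) y = transform f y + transform g y"
  unfolding transform_def using integrable_transform[of f y] integrable_transform[of g y]
  by (simp add: distrib_right)

lemma transform_diff:
  "integrable M f \<Longrightarrow> integrable M g \<Longrightarrow> y \<in> space M \<Longrightarrow>
     transform (\<lambda>x. f x - g x) y = transform f y - transform g y"
  unfolding transform_def using integrable_transform[of f y] integrable_transform[of g y]
  by (simp add: left_diff_distrib)

text \<open>
  Expanding the square and interchanging the integrations turns the left-hand side into the
  quadratic form of \<open>H\<close> at \<open>f\<close>. As \<open>H\<close> is positive, symmetric and of total mass at most \<open>1\<close> in each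
  variable, Schur's test with \<open>2 * a * b \<le> a\<^sup>2 + b\<^sup>2\<close> bounds this form by the square of the \<open>L\<^sup>2\<close> norm. The
  weight \<open>G\<close> makes the triple integral absolutely convergent.
\<close>

lemma schur_weighted_L2:
  assumes f: "integrable M f"
    and G: "integrable M G" "\<And>l. G l \<ge> 0"
    and H: "\<And>x y. x \<in> space M \<Longrightarrow> y \<in> space M \<Longrightarrow>
        has_bochner_integral M (\<lambda>l. complex_of_real (G l) * (k x l * cnj (k y l))) (complex_of_real (H x y))"
    and H0: "\<And>x y. H x y \<ge> 0" and sym: "\<And>x y. H x y = H y x"
    and H1: "\<And>x. x \<in> space M \<Longrightarrow> (\<integral>\<^sup>+ y. ennreal (H x y) \<partial>M) \<le> 1"
  shows "(\<integral>\<^sup>+ l. ennreal (G l * (cmod (transform f l))\<^sup>2) \<partial>M) \<le> (\<integral>\<^sup>+ x. ennreal ((cmod (f x))\<^sup>2) \<partial>M)"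
proof -
  interpret MM: pair_sigma_finite M M by standard
  interpret T: pair_sigma_finite M "M \<Otimes>\<^sub>M M" by standard
  have [measurable]: "f \<in> borel_measurable M" "G \<in> borel_measurable M"
    using f G by (auto intro: borel_measurable_integrable)
  define F where "F = (\<lambda>l z. complex_of_real (G l) * ((f (fst z) * k (fst z) l) * cnj (f (snd z) * k (snd z) l)))"
  have kb: "cmod (f x * k x l) \<le> cmod (f x)" if "x \<in> space M" "l \<in> space M" for x l
    using kernel_bound[OF that] by (simp add: norm_mult mult_left_le)
  have FM [measurable]: "(\<lambda>(l, z). F l z) \<in> borel_measurable (M \<Otimes>\<^sub>M (M \<Otimes>\<^sub>M M))"
    unfolding F_def by measurable
  have cf: "has_bochner_integral M (\<lambda>x. complex_of_real (cmod (f x))) (complex_of_real (LINT x|M. cmod (f x)))"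
    using f by (intro has_bochner_integral_of_real) (simp add: has_bochner_integral_iff)
  have cG: "has_bochner_integral M (\<lambda>x. complex_of_real (G x)) (complex_of_real (LINT x|M. G x))"
    using G by (intro has_bochner_integral_of_real) (simp add: has_bochner_integral_iff)
  have dom: "integrable (M \<Otimes>\<^sub>M (M \<Otimes>\<^sub>M M)) (\<lambda>w. complex_of_real (G (fst w)) *
      (complex_of_real (cmod (f (fst (snd w)))) * complex_of_real (cmod (f (snd (snd w))))))"
    using has_bochner_integral_pair_mult[OF sigma_finite_measure_axioms MM.P.sigma_finite_measure_axioms cG
        has_bochner_integral_pair_mult[OF sigma_finite_measure_axioms sigma_finite_measure_axioms cf cf]]
    by (simp add: has_bochner_integral_iff)
  have Fint: "integrable (M \<Otimes>\<^sub>M (M \<Otimes>\<^sub>M M)) (\<lambda>(l, z). F l z)"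
  proof (rule Bochner_Integration.integrable_bound[OF dom FM], rule AE_I2)
    fix w assume "w \<in> space (M \<Otimes>\<^sub>M (M \<Otimes>\<^sub>M M))"
    then obtain l x y where w: "w = (l, (x, y))" "l \<in> space M" "x \<in> space M" "y \<in> space M"
      by (auto simp: space_pair_measure)
    have "cmod ((f x * k x l) * cnj (f y * k y l)) \<le> cmod (f x) * cmod (f y)"
      using kb w(2-4) by (simp only: norm_mult[of "f x * k x l"] complex_mod_cnj) (intro mult_mono, auto)
    then have "G l * cmod ((f x * k x l) * cnj (f y * k y l)) \<le> G l * (cmod (f x) * cmod (f y))"
      using G by (intro mult_left_mono) auto
    moreover have "norm (complex_of_real (G l) * ((f x * k x l) * cnj (f y * k y l)))
        = G l * cmod ((f x * k x l) * cnj (f y * k y l))"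
      using G(2)[of l] by (simp only: norm_mult[of "complex_of_real (G l)"] norm_of_real)
    ultimately show "norm (case w of (l, z) \<Rightarrow> F l z) \<le> norm (complex_of_real (G (fst w)) *
      (complex_of_real (cmod (f (fst (snd w)))) * complex_of_real (cmod (f (snd (snd w))))))"
      using G(2)[of l] unfolding w F_def by (simp add: norm_mult)
  qed
  have inner: "(LINT z|(M \<Otimes>\<^sub>M M). F l z) = complex_of_real (G l * (cmod (transform f l))\<^sup>2)"
    if l: "l \<in> space M" for l
  proof -
    have "has_bochner_integral M (\<lambda>x. f x * k x l) (transform f l)"
      using integrable_transform[OF f l] by (simp add: has_bochner_integral_iff transform_def)
    then have "has_bochner_integral (M \<Otimes>\<^sub>M M) (\<lambda>z. (f (fst z) * k (fst z) l) * cnj (f (snd z) * k (snd z) l))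
        (transform f l * cnj (transform f l))"
      by (intro has_bochner_integral_pair_mult has_bochner_integral_cnj sigma_finite_measure_axioms)
    then have "(LINT z|(M \<Otimes>\<^sub>M M). F l z) = complex_of_real (G l) * (transform f l * cnj (transform f l))"
      unfolding F_def by (intro has_bochner_integral_integral_eq has_bochner_integral_mult_right)
    then show ?thesis by (simp only: of_real_mult complex_norm_square)
  qed
  have outer: "(LINT l|M. F l z) = f (fst z) * cnj (f (snd z)) * complex_of_real (H (fst z) (snd z))"
    if z: "z \<in> space (M \<Otimes>\<^sub>M M)" for z
  proof -
    have h: "has_bochner_integral M (\<lambda>l. complex_of_real (G l) * (k (fst z) l * cnj (k (snd z) l))) (complex_of_real (H (fst z) (snd z)))"
      using z by (intro H) (auto simp: space_pair_measure)
    have "F l z = f (fst z) * cnj (f (snd z)) * (complex_of_real (G l) * (k (fst z) l * cnj (k (snd z) l)))" for l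
      unfolding F_def by (simp add: mult_ac)
    then show ?thesis
      using has_bochner_integral_mult_right[OF h, of "f (fst z) * cnj (f (snd z))"]
      by (simp add: has_bochner_integral_iff)
  qed
  have HM [measurable]: "(\<lambda>z. H (fst z) (snd z)) \<in> borel_measurable (M \<Otimes>\<^sub>M M)"
  proof (subst measurable_cong)
    show "(\<lambda>z. Re (LINT l|M. complex_of_real (G l) * (k (fst z) l * cnj (k (snd z) l)))) \<in> borel_measurable (M \<Otimes>\<^sub>M M)"
      by measurable
    fix z assume "z \<in> space (M \<Otimes>\<^sub>M M)"
    then show "H (fst z) (snd z) = Re (LINT l|M. complex_of_real (G l) * (k (fst z) l * cnj (k (snd z) l)))"
      using H[of "fst z" "snd z"] by (auto simp: space_pair_measure has_bochner_integral_iff)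
  qed
  have HMx: "(\<lambda>y. ennreal (H x y)) \<in> borel_measurable M" if "x \<in> space M" for x
    using measurable_Pair2[OF HM that] by simp
  have HMy: "(\<lambda>x. ennreal (H x y)) \<in> borel_measurable M" if "y \<in> space M" for y
    using measurable_Pair1[OF HM that] by simp
  have eq: "(LINT l|M. complex_of_real (G l * (cmod (transform f l))\<^sup>2)) =
      (LINT z|(M \<Otimes>\<^sub>M M). f (fst z) * cnj (f (snd z)) * complex_of_real (H (fst z) (snd z)))"
  proof -
    have "(LINT l|M. complex_of_real (G l * (cmod (transform f l))\<^sup>2)) = (LINT l|M. LINT z|(M \<Otimes>\<^sub>M M). F l z)"
      by (intro Bochner_Integration.integral_cong refl) (simp add: inner)
    also have "\<dots> = (LINT z|(M \<Otimes>\<^sub>M M). LINT l|M. F l z)"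
      by (rule T.Fubini_integral[OF Fint, symmetric])
    also have "\<dots> = (LINT z|(M \<Otimes>\<^sub>M M). f (fst z) * cnj (f (snd z)) * complex_of_real (H (fst z) (snd z)))"
      by (intro Bochner_Integration.integral_cong refl) (simp add: outer)
    finally show ?thesis .
  qed
  have int: "integrable M (\<lambda>l. G l * (cmod (transform f l))\<^sup>2)"
  proof -
    have "integrable M (\<lambda>l. LINT z|(M \<Otimes>\<^sub>M M). F l z)"
      using T.integrable_fst[OF Fint] .
    then have "integrable M (\<lambda>l. complex_of_real (G l * (cmod (transform f l))\<^sup>2))"
      by (rule Bochner_Integration.integrable_cong[THEN iffD1, rotated 2]) (auto simp: inner)
    then show ?thesis by (simp only: complex_of_real_integrable_eq)
  qed
  let ?I = "LINT l|M. G l * (cmod (transform f l))\<^sup>2"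
  have I0: "?I \<ge> 0" using G by (intro integral_nonneg_AE) auto
  have "(\<integral>\<^sup>+ l. ennreal (G l * (cmod (transform f l))\<^sup>2) \<partial>M) = ennreal ?I"
    using int G by (intro nn_integral_eq_integral) auto
  also have "?I = norm (LINT l|M. complex_of_real (G l * (cmod (transform f l))\<^sup>2))"
    using I0 by (simp only: integral_complex_of_real norm_of_real abs_of_nonneg)
  also have "ennreal \<dots> \<le> (\<integral>\<^sup>+ z. ennreal (norm (f (fst z) * cnj (f (snd z)) * complex_of_real (H (fst z) (snd z)))) \<partial>(M \<Otimes>\<^sub>M M))"
    unfolding eq
  proof (rule integral_norm_bound_ennreal)
    have "integrable (M \<Otimes>\<^sub>M M) (\<lambda>z. LINT l|M. F l z)"
      using T.integrable_snd[OF Fint] .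
    then show "integrable (M \<Otimes>\<^sub>M M) (\<lambda>z. f (fst z) * cnj (f (snd z)) * complex_of_real (H (fst z) (snd z)))"
      by (rule Bochner_Integration.integrable_cong[THEN iffD1, rotated 2]) (auto simp: outer)
  qed
  also have "\<dots> \<le> (\<integral>\<^sup>+ z. ennreal ((cmod (f (fst z)))\<^sup>2 / 2) * ennreal (H (fst z) (snd z)) +
        ennreal ((cmod (f (snd z)))\<^sup>2 / 2) * ennreal (H (fst z) (snd z)) \<partial>(M \<Otimes>\<^sub>M M))"
  proof (rule nn_integral_mono)
    fix z
    have "cmod (f (fst z)) * cmod (f (snd z)) \<le> (cmod (f (fst z)))\<^sup>2 / 2 + (cmod (f (snd z)))\<^sup>2 / 2"
      using sum_squares_bound[of "cmod (f (fst z))" "cmod (f (snd z))"] by simp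
    then have "cmod (f (fst z)) * cmod (f (snd z)) * H (fst z) (snd z) \<le> ((cmod (f (fst z)))\<^sup>2 / 2 + (cmod (f (snd z)))\<^sup>2 / 2) * H (fst z) (snd z)"
      using H0 by (intro mult_right_mono) auto
    then show "ennreal (norm (f (fst z) * cnj (f (snd z)) * complex_of_real (H (fst z) (snd z)))) \<le>
      ennreal ((cmod (f (fst z)))\<^sup>2 / 2) * ennreal (H (fst z) (snd z)) +
        ennreal ((cmod (f (snd z)))\<^sup>2 / 2) * ennreal (H (fst z) (snd z))"
      using H0[of "fst z" "snd z"]
      by (simp add: norm_mult distrib_right ennreal_leI flip: ennreal_mult' ennreal_plus)
  qed
  also have "\<dots> = (\<integral>\<^sup>+ z. ennreal ((cmod (f (fst z)))\<^sup>2 / 2) * ennreal (H (fst z) (snd z)) \<partial>(M \<Otimes>\<^sub>M M)) +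
        (\<integral>\<^sup>+ z. ennreal ((cmod (f (snd z)))\<^sup>2 / 2) * ennreal (H (fst z) (snd z)) \<partial>(M \<Otimes>\<^sub>M M))"
    by (rule nn_integral_add) measurable
  also have "(\<integral>\<^sup>+ z. ennreal ((cmod (f (fst z)))\<^sup>2 / 2) * ennreal (H (fst z) (snd z)) \<partial>(M \<Otimes>\<^sub>M M))
      = (\<integral>\<^sup>+ x. ennreal ((cmod (f x))\<^sup>2 / 2) * (\<integral>\<^sup>+ y. ennreal (H x y) \<partial>M) \<partial>M)"
    by (subst nn_integral_fst[symmetric]) (auto intro!: nn_integral_cong nn_integral_cmult HMx)
  also have "(\<integral>\<^sup>+ z. ennreal ((cmod (f (snd z)))\<^sup>2 / 2) * ennreal (H (fst z) (snd z)) \<partial>(M \<Otimes>\<^sub>M M))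
      = (\<integral>\<^sup>+ y. ennreal ((cmod (f y))\<^sup>2 / 2) * (\<integral>\<^sup>+ x. ennreal (H x y) \<partial>M) \<partial>M)"
    by (subst MM.nn_integral_snd[symmetric]) (auto intro!: nn_integral_cong nn_integral_cmult HMy)
  also have "(\<integral>\<^sup>+ x. ennreal ((cmod (f x))\<^sup>2 / 2) * (\<integral>\<^sup>+ y. ennreal (H x y) \<partial>M) \<partial>M) +
        (\<integral>\<^sup>+ y. ennreal ((cmod (f y))\<^sup>2 / 2) * (\<integral>\<^sup>+ x. ennreal (H x y) \<partial>M) \<partial>M)
      \<le> (\<integral>\<^sup>+ x. ennreal ((cmod (f x))\<^sup>2 / 2) \<partial>M) + (\<integral>\<^sup>+ y. ennreal ((cmod (f y))\<^sup>2 / 2) \<partial>M)"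
  proof (intro add_mono nn_integral_mono mult_left_le)
    show "(\<integral>\<^sup>+ x. ennreal (H x y) \<partial>M) \<le> 1" if "y \<in> space M" for y
      using H1[OF that] by (subst sym)
  qed (use H1 in auto)
  also have "\<dots> = (\<integral>\<^sup>+ x. ennreal ((cmod (f x))\<^sup>2) \<partial>M)"
    by (subst nn_integral_add[symmetric]) (auto intro!: nn_integral_cong simp flip: ennreal_plus)
  finally show ?thesis .
qed

text \<open>
  Removal of the weights by Fatou's lemma. With Gaussian weights this is the inequality
  \<open>\<le>\<close> in Plancherel's identity.
\<close>

lemma schur_L2:
  assumes f: "integrable M f"
    and G: "\<And>n. integrable M (G n)" "\<And>n l. G n l \<ge> 0" "\<And>l. (\<lambda>n. G n l) \<longlonglongrightarrow> 1"
    and H: "\<And>n x y. x \<in> space M \<Longrightarrow> y \<in> space M \<Longrightarrow>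
        has_bochner_integral M (\<lambda>l. complex_of_real (G n l) * (k x l * cnj (k y l))) (complex_of_real (H n x y))"
    and H0: "\<And>n x y. H n x y \<ge> 0" and sym: "\<And>n x y. H n x y = H n y x"
    and H1: "\<And>n x. x \<in> space M \<Longrightarrow> (\<integral>\<^sup>+ y. ennreal (H n x y) \<partial>M) \<le> 1"
  shows "mass M 2 (transform f) \<le> mass M 2 f"
proof -
  have [measurable]: "f \<in> borel_measurable M" "G n \<in> borel_measurable M" for n
    using f G by (auto intro: borel_measurable_integrable)
  have "mass M 2 (transform f) = (\<integral>\<^sup>+ l. liminf (\<lambda>n. ennreal (G n l * (cmod (transform f l))\<^sup>2)) \<partial>M)"
    unfolding mass_def
  proof (rule nn_integral_cong)
    fix l
    have "(\<lambda>n. ennreal (G n l * (cmod (transform f l))\<^sup>2)) \<longlonglongrightarrow> ennreal (1 * (cmod (transform f l))\<^sup>2)"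
      by (intro tendsto_intros G)
    then show "ennreal (cmod (transform f l) powr 2) = liminf (\<lambda>n. ennreal (G n l * (cmod (transform f l))\<^sup>2))"
      by (simp add: lim_imp_Liminf)
  qed
  also have "\<dots> \<le> liminf (\<lambda>n. \<integral>\<^sup>+ l. ennreal (G n l * (cmod (transform f l))\<^sup>2) \<partial>M)"
    by (rule nn_integral_liminf) measurable
  also have "\<dots> \<le> liminf (\<lambda>n::nat. mass M 2 f)"
  proof (intro Liminf_mono always_eventually allI)
    fix n
    show "(\<integral>\<^sup>+ l. ennreal (G n l * (cmod (transform f l))\<^sup>2) \<partial>M) \<le> mass M 2 f"
      using schur_weighted_L2[OF f G(1,2) H H0 sym H1, of n] by (simp add: mass_def)
  qed
  also have "\<dots> = mass M 2 f" by (simp add: Liminf_const)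
  finally show ?thesis .
qed

end

section \<open>The Hausdorff-Young inequality\<close>

lemma ennreal_mult3:
  "a \<ge> 0 \<Longrightarrow> b \<ge> 0 \<Longrightarrow> c \<ge> 0 \<Longrightarrow> ennreal a * ennreal b * ennreal c = ennreal (a * b * c)"
  by (simp add: ennreal_mult)

lemma powr_add_le:
  fixes a b q :: real
  assumes "a \<ge> 0" "b \<ge> 0" "q \<ge> 0"
  shows "(a + b) powr q \<le> 2 powr q * (a powr q + b powr q)"
proof -
  have "(a + b) powr q \<le> (2 * max a b) powr q"
    using assms by (intro powr_mono2) auto
  also have "\<dots> = 2 powr q * (max a b) powr q" by (simp add: powr_mult)
  also have "(max a b) powr q \<le> a powr q + b powr q" by (auto simp: max_def)
  finally show ?thesis by simp
qed

lemma mass_diff_triangle: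
  assumes q: "q \<ge> 0"
    and [measurable]: "f \<in> borel_measurable M" "g \<in> borel_measurable M" "h \<in> borel_measurable M"
  shows "mass M q (\<lambda>x. f x - h x) \<le> ennreal (2 powr q) * (mass M q (\<lambda>x. f x - g x) + mass M q (\<lambda>x. g x - h x))"
proof -
  have "mass M q (\<lambda>x. f x - h x) \<le>
      (\<integral>\<^sup>+ x. ennreal (2 powr q) * (ennreal (cmod (f x - g x) powr q) + ennreal (cmod (g x - h x) powr q)) \<partial>M)"
    unfolding mass_def
  proof (rule nn_integral_mono)
    fix x
    have "cmod (f x - h x) powr q \<le> (cmod (f x - g x) + cmod (g x - h x)) powr q"
      using q norm_triangle_ineq[of "f x - g x" "g x - h x"] by (intro powr_mono2) auto
    also have "\<dots> \<le> 2 powr q * (cmod (f x - g x) powr q + cmod (g x - h x) powr q)"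
      by (intro powr_add_le) (use q in auto)
    finally show "ennreal (cmod (f x - h x) powr q) \<le>
        ennreal (2 powr q) * (ennreal (cmod (f x - g x) powr q) + ennreal (cmod (g x - h x) powr q))"
      by (simp add: ennreal_leI flip: ennreal_mult ennreal_plus)
  qed
  also have "\<dots> = ennreal (2 powr q) * (mass M q (\<lambda>x. f x - g x) + mass M q (\<lambda>x. g x - h x))"
    unfolding mass_def by (simp add: nn_integral_cmult nn_integral_add)
  finally show ?thesis .
qed

text \<open>
  The case \<open>r = q\<close> writes \<open>u powr q\<close> as an integral over level sets; the case \<open>r = q - 2\<close> evaluates
  the integral over the levels after the order of integration has been reversed.
\<close>

lemma powr_layer_cake:
  fixes u r :: real
  assumes u: "u \<ge> 0" and r: "r > 0"
  shows "(\<integral>\<^sup>+ t. ennreal (t powr (r - 1)) * indicator {0..u} t \<partial>lborel) = ennreal (u powr r / r)"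
  using has_integral_powr_from_0[of "r - 1" u] u r
  by (intro nn_integral_has_integral_lebesgue') auto

locale L2_bounded_kernel = bounded_kernel +
  assumes L2_bound: "integrable M f \<Longrightarrow> mass M 2 (transform f) \<le> mass M 2 f"
begin

text \<open>
  Real interpolation between \<open>L\<^sup>1 \<rightarrow> L\<^sup>\<infinity>\<close> and \<open>L\<^sup>2 \<rightarrow> L\<^sup>2\<close> in the manner of Marcinkiewicz. For each level \<open>t\<close>
  the function is cut at the height where the large part has \<open>L\<^sup>1\<close> norm at most \<open>t / 2\<close>. The transform
  of the large part is then pointwise at most \<open>t / 2\<close>, so only the small part, which is
  controlled in \<open>L\<^sup>2\<close>, contributes to the level set \<open>t < \<bar>transform f\<bar>\<close>. Integration over \<open>t\<close> gives
  the Hausdorff-Young inequality with a constant that blows up as \<open>p \<rightarrow> 2\<close>.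
\<close>

lemma hausdorff_young_off_diagonal:
  fixes p q :: real
  assumes p: "1 < p" "p < 2" and q: "q = p / (p - 1)"
    and f: "integrable M f" and N: "N > 0" "mass M p f \<le> ennreal N"
  shows "mass M q (transform f) \<le> ennreal (4 * q / (q - 2) * 2 powr (q - 2) * N powr (q - 1))"
proof -
  interpret LM: pair_sigma_finite M lborel by standard
  have q2: "q > 2" unfolding q using p by (simp add: pos_less_divide_eq)
  have [measurable]: "f \<in> borel_measurable M" using f by (rule borel_measurable_integrable)
  define \<tau> where "\<tau> = (\<lambda>x. 2 * N * cmod (f x) powr (1 - p))"
  have weak: "emeasure M {y \<in> space M. t < cmod (transform f y)} \<le>
      ennreal (4 / t\<^sup>2) * (\<integral>\<^sup>+ x. ennreal ((cmod (f x))\<^sup>2) * indicator {..\<tau> x} t \<partial>M)"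
    if t: "t > 0" for t
  proof -
    \<comment> \<open>\<open>\<tau> x < t\<close> says that \<open>\<bar>f x\<bar>\<close> exceeds the cutting height \<open>(2 * N / t) powr (1 / (p - 1))\<close>.\<close>
    define big where "big = (\<lambda>x. f x \<noteq> 0 \<and> \<tau> x < t)"
    define g where "g = (\<lambda>x. if big x then 0 else f x)"
    define h where "h = (\<lambda>x. if big x then f x else 0)"
    have [measurable]: "\<tau> \<in> borel_measurable M" unfolding \<tau>_def by measurable
    have [measurable]: "Measurable.pred M big" unfolding big_def by measurable
    have [measurable]: "g \<in> borel_measurable M" "h \<in> borel_measurable M"
      unfolding g_def h_def by measurable
    have gi: "integrable M g" and hi: "integrable M h"
      by (auto intro!: Bochner_Integration.integrable_bound[OF f] simp: g_def h_def)
    have hle: "cmod (h x) \<le> t / (2 * N) * cmod (f x) powr p" for x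
    proof (cases "big x")
      case True
      then have f0: "cmod (f x) > 0" and "2 * N * cmod (f x) powr (1 - p) < t"
        by (auto simp: big_def \<tau>_def)
      then have "cmod (f x) powr (1 - p) \<le> t / (2 * N)" using N by (simp add: field_simps)
      then have "cmod (f x) powr (1 - p) * cmod (f x) powr p \<le> t / (2 * N) * cmod (f x) powr p"
        by (rule mult_right_mono) simp
      moreover have "cmod (f x) powr (1 - p) * cmod (f x) powr p = cmod (f x)"
        using f0 by (simp flip: powr_add)
      ultimately show ?thesis using True by (simp add: h_def)
    qed (use t N in \<open>simp add: h_def\<close>)
    have h1: "(LINT x|M. cmod (h x)) \<le> t / 2"
    proof -
      have "ennreal (LINT x|M. cmod (h x)) = (\<integral>\<^sup>+ x. ennreal (cmod (h x)) \<partial>M)"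
        using hi by (intro nn_integral_eq_integral[symmetric]) auto
      also have "\<dots> \<le> (\<integral>\<^sup>+ x. ennreal (t / (2 * N)) * ennreal (cmod (f x) powr p) \<partial>M)"
        using hle t N by (intro nn_integral_mono) (simp add: ennreal_leI flip: ennreal_mult')
      also have "\<dots> = ennreal (t / (2 * N)) * mass M p f"
        unfolding mass_def by (rule nn_integral_cmult) measurable
      also have "\<dots> \<le> ennreal (t / (2 * N)) * ennreal N"
        using N by (intro mult_left_mono) auto
      also have "\<dots> = ennreal (t / 2)"
        using N t by (simp flip: ennreal_mult')
      finally show ?thesis using t by simp
    qed
    have Tf: "cmod (transform f y) \<le> cmod (transform g y) + t / 2" if y: "y \<in> space M" for y
    proof -
      have "transform f y = transform g y + transform h y"
        using transform_add[OF gi hi y] by (simp add: g_def h_def if_distrib cong: if_cong)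
      then show ?thesis
        using transform_bound[OF hi y] h1 norm_triangle_ineq[of "transform g y" "transform h y"] by simp
    qed
    have "emeasure M {y \<in> space M. t < cmod (transform f y)} =
        (\<integral>\<^sup>+ y. indicator {y \<in> space M. t < cmod (transform f y)} y \<partial>M)"
      by simp
    also have "\<dots> \<le> (\<integral>\<^sup>+ y. ennreal (4 / t\<^sup>2) * ennreal (cmod (transform g y) powr 2) \<partial>M)"
    proof (rule nn_integral_mono)
      fix y assume y: "y \<in> space M"
      have "1 \<le> 4 / t\<^sup>2 * (cmod (transform g y))\<^sup>2" if "t < cmod (transform f y)"
      proof -
        have "t / 2 \<le> cmod (transform g y)" using Tf[OF y] that by simp
        then have "(t / 2)\<^sup>2 \<le> (cmod (transform g y))\<^sup>2" using t by (intro power_mono) auto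
        then show ?thesis using t by (simp add: power_divide field_simps)
      qed
      then show "indicator {y \<in> space M. t < cmod (transform f y)} y \<le> ennreal (4 / t\<^sup>2) * ennreal (cmod (transform g y) powr 2)"
        using y by (auto simp: indicator_def simp flip: ennreal_mult' ennreal_1 intro!: ennreal_leI)
    qed
    also have "\<dots> = ennreal (4 / t\<^sup>2) * mass M 2 (transform g)"
      unfolding mass_def by (rule nn_integral_cmult) measurable
    also have "\<dots> \<le> ennreal (4 / t\<^sup>2) * mass M 2 g"
      by (intro mult_left_mono L2_bound gi) auto
    also have "\<dots> \<le> ennreal (4 / t\<^sup>2) * (\<integral>\<^sup>+ x. ennreal ((cmod (f x))\<^sup>2) * indicator {..\<tau> x} t \<partial>M)"
      unfolding mass_def by (intro mult_left_mono nn_integral_mono) (auto simp: g_def big_def indicator_def)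
    finally show ?thesis .
  qed
  have [measurable]: "\<tau> \<in> borel_measurable M" unfolding \<tau>_def by measurable
  have [measurable]: "(\<lambda>x. indicator {..\<tau> x} t :: ennreal) \<in> borel_measurable M" for t
    unfolding indicator_def atMost_iff by measurable
  have [measurable]: "(\<lambda>z. indicator {0..\<tau> (fst z)} (snd z) :: ennreal) \<in> borel_measurable (M \<Otimes>\<^sub>M lborel)"
    unfolding indicator_def atLeastAtMost_iff by measurable
  have "mass M q (transform f) = (\<integral>\<^sup>+ y. \<integral>\<^sup>+ t. ennreal (q * t powr (q - 1)) * indicator {0<..} t * indicator {y \<in> space M. t < cmod (transform f y)} y \<partial>lborel \<partial>M)"
    unfolding mass_def
  proof (rule nn_integral_cong)
    fix y assume y: "y \<in> space M"
    let ?u = "cmod (transform f y)"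
    have "ennreal (?u powr q) = ennreal q * ennreal (?u powr q / q)"
      using q2 by (simp flip: ennreal_mult')
    also have "\<dots> = (\<integral>\<^sup>+ t. ennreal q * (ennreal (t powr (q - 1)) * indicator {0..?u} t) \<partial>lborel)"
      using q2 by (subst powr_layer_cake[symmetric]) (auto intro!: nn_integral_cmult[symmetric])
    also have "\<dots> = (\<integral>\<^sup>+ t. ennreal (q * t powr (q - 1)) * indicator {0<..} t * indicator {z \<in> space M. t < cmod (transform f z)} y \<partial>lborel)"
    proof (rule nn_integral_cong_AE)
      have "AE t in lborel. t \<noteq> 0 \<and> t \<noteq> ?u"
        using AE_lborel_singleton[of 0] AE_lborel_singleton[of ?u] by eventually_elim auto
      then show "AE t in lborel. ennreal q * (ennreal (t powr (q - 1)) * indicator {0..?u} t) =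
          ennreal (q * t powr (q - 1)) * indicator {0<..} t * indicator {z \<in> space M. t < cmod (transform f z)} y"
        by eventually_elim (use y q2 in \<open>auto simp: indicator_def ennreal_mult'\<close>)
    qed
    finally show "ennreal (?u powr q) = (\<integral>\<^sup>+ t. ennreal (q * t powr (q - 1)) * indicator {0<..} t * indicator {y \<in> space M. t < cmod (transform f y)} y \<partial>lborel)"
      by simp
  qed
  also have "\<dots> = (\<integral>\<^sup>+ t. \<integral>\<^sup>+ y. ennreal (q * t powr (q - 1)) * indicator {0<..} t * indicator {y \<in> space M. t < cmod (transform f y)} y \<partial>M \<partial>lborel)"
    by (rule LM.Fubini'[symmetric]) measurable
  also have "\<dots> \<le> (\<integral>\<^sup>+ t. \<integral>\<^sup>+ x. ennreal (4 * q) * ennreal ((cmod (f x))\<^sup>2) * (ennreal (t powr (q - 3)) * indicator {0..\<tau> x} t) \<partial>M \<partial>lborel)"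
  proof (rule nn_integral_mono)
    fix t :: real
    show "(\<integral>\<^sup>+ y. ennreal (q * t powr (q - 1)) * indicator {0<..} t * indicator {y \<in> space M. t < cmod (transform f y)} y \<partial>M) \<le>
      (\<integral>\<^sup>+ x. ennreal (4 * q) * ennreal ((cmod (f x))\<^sup>2) * (ennreal (t powr (q - 3)) * indicator {0..\<tau> x} t) \<partial>M)"
    proof (cases "t > 0")
      case True
      have te: "q * t powr (q - 1) * (4 / t\<^sup>2) = 4 * q * t powr (q - 3)"
      proof -
        have "t powr (q - 1) = t powr ((q - 3) + real 2)" by simp
        also have "\<dots> = t powr (q - 3) * t\<^sup>2" unfolding powr_add using True by (subst powr_realpow) auto
        finally show ?thesis using True by simp
      qed
      have "(\<integral>\<^sup>+ y. ennreal (q * t powr (q - 1)) * indicator {0<..} t * indicator {y \<in> space M. t < cmod (transform f y)} y \<partial>M)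
         = ennreal (q * t powr (q - 1)) * emeasure M {y \<in> space M. t < cmod (transform f y)}"
        using True by (simp add: nn_integral_cmult)
      also have "\<dots> \<le> ennreal (q * t powr (q - 1)) * (ennreal (4 / t\<^sup>2) * (\<integral>\<^sup>+ x. ennreal ((cmod (f x))\<^sup>2) * indicator {..\<tau> x} t \<partial>M))"
        by (intro mult_left_mono weak True) auto
      also have "\<dots> = ennreal (4 * q * t powr (q - 3)) * (\<integral>\<^sup>+ x. ennreal ((cmod (f x))\<^sup>2) * indicator {..\<tau> x} t \<partial>M)"
      proof -
        have "ennreal (q * t powr (q - 1) * (4 / t\<^sup>2)) = ennreal (q * t powr (q - 1)) * ennreal (4 / t\<^sup>2)"
          using q2 by (intro ennreal_mult) auto
        then show ?thesis unfolding te by (simp only: mult.assoc)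
      qed
      also have "\<dots> = (\<integral>\<^sup>+ x. ennreal (4 * q * t powr (q - 3)) * (ennreal ((cmod (f x))\<^sup>2) * indicator {..\<tau> x} t) \<partial>M)"
        by (rule nn_integral_cmult[symmetric]) measurable
      also have "\<dots> = (\<integral>\<^sup>+ x. ennreal (4 * q) * ennreal ((cmod (f x))\<^sup>2) * (ennreal (t powr (q - 3)) * indicator {0..\<tau> x} t) \<partial>M)"
        using True q2 by (intro nn_integral_cong) (auto simp: indicator_def ennreal_mult' mult_ac)
      finally show ?thesis .
    qed simp
  qed
  also have "\<dots> = (\<integral>\<^sup>+ x. \<integral>\<^sup>+ t. ennreal (4 * q) * ennreal ((cmod (f x))\<^sup>2) * (ennreal (t powr (q - 3)) * indicator {0..\<tau> x} t) \<partial>lborel \<partial>M)"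
    by (rule LM.Fubini') measurable
  also have "\<dots> = (\<integral>\<^sup>+ x. ennreal (4 * q / (q - 2) * (2 * N) powr (q - 2)) * ennreal (cmod (f x) powr p) \<partial>M)"
  proof (rule nn_integral_cong)
    fix x assume "x \<in> space M"
    have "\<tau> x \<ge> 0" using N by (simp add: \<tau>_def)
    then have "(\<integral>\<^sup>+ t. ennreal (4 * q) * ennreal ((cmod (f x))\<^sup>2) * (ennreal (t powr (q - 3)) * indicator {0..\<tau> x} t) \<partial>lborel)
       = ennreal (4 * q) * ennreal ((cmod (f x))\<^sup>2) * ennreal (\<tau> x powr (q - 2) / (q - 2))"
      using powr_layer_cake[of "\<tau> x" "q - 2"] q2 by (subst nn_integral_cmult) auto
    also have "\<dots> = ennreal (4 * q * (cmod (f x))\<^sup>2 * (\<tau> x powr (q - 2) / (q - 2)))"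
      using q2 by (intro ennreal_mult3) auto
    also have "4 * q * (cmod (f x))\<^sup>2 * (\<tau> x powr (q - 2) / (q - 2)) = 4 * q / (q - 2) * (2 * N) powr (q - 2) * cmod (f x) powr p"
    proof (cases "f x = 0")
      case False
      have "(1 - p) * (q - 2) + 2 = p" using p by (simp add: q field_simps)
      then have "cmod (f x) powr ((1 - p) * (q - 2)) * (cmod (f x))\<^sup>2 = cmod (f x) powr p"
        using False by (simp add: powr_numeral[symmetric] powr_add[symmetric] del: powr_numeral)
      then show ?thesis by (simp add: \<tau>_def powr_mult powr_powr mult_ac)
    qed (use p in simp)
    finally show "(\<integral>\<^sup>+ t. ennreal (4 * q) * ennreal ((cmod (f x))\<^sup>2) * (ennreal (t powr (q - 3)) * indicator {0..\<tau> x} t) \<partial>lborel)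
       = ennreal (4 * q / (q - 2) * (2 * N) powr (q - 2)) * ennreal (cmod (f x) powr p)"
      using q2 by (subst ennreal_mult[symmetric]) auto
  qed
  also have "\<dots> = ennreal (4 * q / (q - 2) * (2 * N) powr (q - 2)) * mass M p f"
    unfolding mass_def by (rule nn_integral_cmult) measurable
  also have "\<dots> \<le> ennreal (4 * q / (q - 2) * (2 * N) powr (q - 2)) * ennreal N"
    using N by (intro mult_left_mono) auto
  also have "\<dots> = ennreal (4 * q / (q - 2) * (2 * N) powr (q - 2) * N)"
    using N q2 by (subst ennreal_mult[symmetric]) auto
  also have "4 * q / (q - 2) * (2 * N) powr (q - 2) * N = 4 * q / (q - 2) * 2 powr (q - 2) * N powr (q - 1)"
  proof -
    have "N powr (q - 2) * N = N powr (q - 1)" using N powr_mult_base[of N "q - 2"] by (simp add: mult.commute)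
    then show ?thesis by (simp add: powr_mult mult.assoc)
  qed
  finally show ?thesis .
qed

text \<open>
  The bound is stated for every \<open>N\<close> above the mass, not for the mass itself, so that it needs no
  separate treatment of the values \<open>0\<close> and \<open>\<infinity>\<close>. For conjugate exponents, \<open>q / p = q - 1\<close>.
\<close>

lemma hausdorff_young:
  fixes p q :: real
  assumes p: "1 < p" "p \<le> 2" and q: "q = p / (p - 1)"
  obtains C where "C > 0"
    "\<And>f N. integrable M f \<Longrightarrow> N > 0 \<Longrightarrow> mass M p f \<le> ennreal N \<Longrightarrow> mass M q (transform f) \<le> ennreal (C * N powr (q - 1))"
proof (cases "p = 2")
  case True
  then have "q = 2" using q by simp
  show ?thesis
  proof (rule that[of 1])
    fix f N assume "integrable M f" "N > (0::real)" "mass M p f \<le> ennreal N"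
    then show "mass M q (transform f) \<le> ennreal (1 * N powr (q - 1))"
      using L2_bound[of f] True \<open>q = 2\<close> by (auto intro: order_trans)
  qed simp
next
  case False
  then have p2: "p < 2" using p by simp
  then have q2: "q > 2" unfolding q using p by (simp add: pos_less_divide_eq)
  show ?thesis
  proof (rule that[of "4 * q / (q - 2) * 2 powr (q - 2)"])
    show "4 * q / (q - 2) * 2 powr (q - 2) > 0" using q2 by simp
  qed (use hausdorff_young_off_diagonal[OF p(1) p2 q] in auto)
qed

end

section \<open>Extension of the transform beyond integrable functions\<close>

lemma mass_commute: "mass M q (\<lambda>x. f x - g x) = mass M q (\<lambda>x. g x - f x)"
  by (simp add: mass_def norm_minus_commute)

lemma mass_cong: "(\<And>x. x \<in> space M \<Longrightarrow> cmod (f x) = cmod (g x)) \<Longrightarrow> mass M q f = mass M q g"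
  unfolding mass_def by (intro nn_integral_cong) simp

lemma mass_mono:
  "q \<ge> 0 \<Longrightarrow> (\<And>x. x \<in> space M \<Longrightarrow> cmod (f x) \<le> cmod (g x)) \<Longrightarrow> mass M q f \<le> mass M q g"
  unfolding mass_def by (intro nn_integral_mono ennreal_leI powr_mono2) auto

lemma integrable_iff_mass:
  "integrable M f \<longleftrightarrow> f \<in> borel_measurable M \<and> mass M 1 f < \<infinity>"
  by (simp add: integrable_iff_bounded mass_def)

text \<open>
  The key step in the completeness of \<open>L\<^sup>q\<close>. The factors \<open>2 ^ k\<close> keep the weighted sum of the \<open>q\<close>-th powers
  of the increments integrable; where that sum is finite, the increments are bounded by a
  geometric sequence.
\<close>

lemma fast_Cauchy_AE_convergent:
  fixes v :: "nat \<Rightarrow> 'a \<Rightarrow> complex"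
  assumes q: "q > 0" and [measurable]: "\<And>k. v k \<in> borel_measurable M"
    and fast: "\<And>k. mass M q (\<lambda>y. v (Suc k) y - v k y) \<le> ennreal ((1 / 4) ^ k)"
  shows "AE y in M. convergent (\<lambda>k. v k y)"
proof -
  define S where "S = (\<lambda>y. \<Sum>k. ennreal (2 ^ k) * ennreal (cmod (v (Suc k) y - v k y) powr q))"
  have [measurable]: "S \<in> borel_measurable M" unfolding S_def by measurable
  have "(\<integral>\<^sup>+ y. S y \<partial>M) = (\<Sum>k. ennreal (2 ^ k) * mass M q (\<lambda>y. v (Suc k) y - v k y))"
    unfolding S_def mass_def by (subst nn_integral_suminf) (auto simp: nn_integral_cmult)
  also have "\<dots> \<le> (\<Sum>k. ennreal ((1 / 2) ^ k))"
  proof (intro suminf_le summableI)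
    fix k
    have "ennreal (2 ^ k) * mass M q (\<lambda>y. v (Suc k) y - v k y) \<le> ennreal (2 ^ k) * ennreal ((1 / 4) ^ k)"
      by (intro mult_left_mono fast) auto
    also have "\<dots> = ennreal ((1 / 2) ^ k)"
      by (simp flip: ennreal_mult power_mult_distrib)
    finally show "ennreal (2 ^ k) * mass M q (\<lambda>y. v (Suc k) y - v k y) \<le> ennreal ((1 / 2) ^ k)" .
  qed
  also have "\<dots> = ennreal 2"
    using geometric_sums[of "1 / 2 :: real"] by (intro suminf_ennreal_eq) auto
  finally have "(\<integral>\<^sup>+ y. S y \<partial>M) \<noteq> \<infinity>" by (auto simp: top_unique)
  then have "AE y in M. S y \<noteq> \<infinity>"
    by (intro nn_integral_PInf_AE) auto
  then show ?thesis
  proof eventually_elim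
    fix y assume "S y \<noteq> \<infinity>"
    then obtain \<sigma> where \<sigma>: "\<sigma> \<ge> 0" "S y = ennreal \<sigma>" by (cases "S y") auto
    have bound: "cmod (v (Suc k) y - v k y) \<le> \<sigma> powr (1 / q) * ((1 / 2) powr (1 / q)) ^ k" for k
    proof -
      let ?d = "cmod (v (Suc k) y - v k y)"
      have "ennreal (2 ^ k * ?d powr q) \<le> S y"
        unfolding S_def using sum_le_suminf[of "\<lambda>k. ennreal (2 ^ k) * ennreal (cmod (v (Suc k) y - v k y) powr q)" "{k}"]
        by (simp add: ennreal_mult)
      then have "2 ^ k * ?d powr q \<le> \<sigma>" using \<sigma> by simp
      then have "?d powr q \<le> \<sigma> * (1 / 2) ^ k" by (simp add: field_simps power_divide)
      then have "(?d powr q) powr (1 / q) \<le> (\<sigma> * (1 / 2) ^ k) powr (1 / q)"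
        using q by (intro powr_mono2) auto
      also have "\<dots> = \<sigma> powr (1 / q) * ((1 / 2) ^ k) powr (1 / q)" by (rule powr_mult)
      also have "((1 / 2 :: real) ^ k) powr (1 / q) = ((1 / 2) powr (1 / q)) ^ k"
        by (simp add: powr_power powr_powr mult.commute flip: powr_realpow)
      finally show ?thesis using q by (simp add: powr_powr)
    qed
    have r1: "(1 / 2 :: real) powr (1 / q) < 1"
      using q powr_less_mono2[of "1 / q" "1 / 2" 1] by simp
    have "summable (\<lambda>k. \<sigma> powr (1 / q) * ((1 / 2) powr (1 / q)) ^ k)"
      using r1 by (intro summable_mult summable_geometric) simp
    then have "summable (\<lambda>k. v (Suc k) y - v k y)"
      by (rule summable_comparison_test') (use bound in auto)
    then have "convergent (\<lambda>n. \<Sum>k<n. v (Suc k) y - v k y)"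
      by (simp add: summable_iff_convergent)
    then have "convergent (\<lambda>n. v n y - v 0 y)"
      by (simp add: sum_lessThan_telescope[of "\<lambda>k. v k y"])
    then have "convergent (\<lambda>n. (v n y - v 0 y) + v 0 y)"
      by (rule convergent_add) (rule convergent_const)
    then show "convergent (\<lambda>k. v k y)" by simp
  qed
qed

context bounded_kernel
begin

text \<open>
  The graph of the continuous extension of the transform from \<open>L\<^sup>1 \<inter> L\<^sup>p\<close> to \<open>L\<^sup>p\<close>, in the form of
  \<open>is_weinstein_transform\<close>. It is kept as a relation: different \<open>F\<close> for the same \<open>f\<close> agree only
  almost everywhere.
\<close>

definition extends_transform :: "real \<Rightarrow> real \<Rightarrow> ('a \<Rightarrow> complex) \<Rightarrow> ('a \<Rightarrow> complex) \<Rightarrow> bool" where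
  "extends_transform p q f F \<longleftrightarrow> F \<in> borel_measurable M \<and> mass M q F < \<infinity> \<and>
     (\<exists>u :: nat \<Rightarrow> 'a \<Rightarrow> complex.
        (\<forall>n. integrable M (u n) \<and> mass M p (u n) < \<infinity>) \<and>
        (\<lambda>n. mass M p (\<lambda>x. u n x - f x)) \<longlonglongrightarrow> 0 \<and>
        (\<lambda>n. mass M q (\<lambda>y. transform (u n) y - F y)) \<longlonglongrightarrow> 0)"

end

text \<open>
  Truncations to an exhausting sequence of sets of finite measure; the third property bounds every
  difference of two truncations by the tail of the earlier one.
\<close>

lemma (in sigma_finite_measure) integrable_truncations:
  fixes f :: "'a \<Rightarrow> complex"
  assumes p: "p \<ge> 1" and [measurable]: "f \<in> borel_measurable M" and fin: "mass M p f < \<infinity>"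
  obtains w :: "nat \<Rightarrow> 'a \<Rightarrow> complex" where
    "\<And>n. integrable M (w n)" "\<And>n x. cmod (w n x) \<le> cmod (f x)"
    "\<And>m n x. n \<le> m \<Longrightarrow> cmod (w m x - w n x) \<le> cmod (w n x - f x)"
    "(\<lambda>n. mass M p (\<lambda>x. w n x - f x)) \<longlonglongrightarrow> 0"
proof -
  obtain A :: "nat \<Rightarrow> 'a set" where A: "range A \<subseteq> sets M" "(\<Union>i. A i) = space M"
    "\<And>i. emeasure M (A i) \<noteq> \<infinity>" "incseq A"
    by (rule sigma_finite_incseq) blast
  have [measurable]: "A n \<in> sets M" for n using A(1) by auto
  define w where "w = (\<lambda>n x. if x \<in> A n then f x else 0)"
  have [measurable]: "w n \<in> borel_measurable M" for n unfolding w_def by measurable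
  have int: "integrable M (w n)" for n
  proof -
    have "mass M 1 (w n) \<le> (\<integral>\<^sup>+ x. indicator (A n) x + ennreal (cmod (f x) powr p) \<partial>M)"
      unfolding mass_def
    proof (rule nn_integral_mono)
      fix x
      have "cmod (f x) \<le> 1 + cmod (f x) powr p"
      proof (cases "cmod (f x) \<le> 1")
        case True
        then show ?thesis by (simp add: add_increasing2)
      next
        case False
        then have "cmod (f x) powr 1 \<le> cmod (f x) powr p" using p by (intro powr_mono) auto
        then show ?thesis using False by simp
      qed
      then show "ennreal (cmod (w n x) powr 1) \<le> indicator (A n) x + ennreal (cmod (f x) powr p)"
        by (auto simp: w_def simp flip: ennreal_1 ennreal_plus intro!: ennreal_leI)
    qed
    also have "\<dots> = emeasure M (A n) + mass M p f"
      by (subst nn_integral_add) (auto simp: mass_def)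
    also have "\<dots> < \<infinity>" using A(3)[of n] fin by (simp add: less_top)
    finally show ?thesis by (simp add: integrable_iff_mass)
  qed
  have "(\<lambda>n. \<integral>\<^sup>+ x. ennreal (cmod (w n x - f x) powr p) \<partial>M) \<longlonglongrightarrow> (\<integral>\<^sup>+ x. 0 \<partial>M)"
  proof (rule nn_integral_dominated_convergence[where w = "\<lambda>x. ennreal (cmod (f x) powr p)"])
    show "(\<integral>\<^sup>+ x. ennreal (cmod (f x) powr p) \<partial>M) < \<infinity>" using fin by (simp add: mass_def)
    show "AE x in M. ennreal (cmod (w n x - f x) powr p) \<le> ennreal (cmod (f x) powr p)" for n
      using p by (intro AE_I2) (auto simp: w_def)
    show "AE x in M. (\<lambda>n. ennreal (cmod (w n x - f x) powr p)) \<longlonglongrightarrow> 0"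
    proof (rule AE_I2)
      fix x assume "x \<in> space M"
      then obtain n0 where "x \<in> A n0" using A(2) by auto
      then have "x \<in> A n" if "n \<ge> n0" for n using A(4) that by (auto simp: incseq_def)
      then have "eventually (\<lambda>n. ennreal (cmod (w n x - f x) powr p) = 0) sequentially"
        unfolding eventually_sequentially by (intro exI[of _ n0]) (auto simp: w_def)
      then show "(\<lambda>n. ennreal (cmod (w n x - f x) powr p)) \<longlonglongrightarrow> 0" by (rule tendsto_eventually)
    qed
  qed auto
  then have lim: "(\<lambda>n. mass M p (\<lambda>x. w n x - f x)) \<longlonglongrightarrow> 0" by (simp add: mass_def)
  have "cmod (w m x - w n x) \<le> cmod (w n x - f x)" if "n \<le> m" for m n x
    using incseqD[OF A(4) that] by (auto simp: w_def)
  then show ?thesis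
    by (intro that[of w] int lim) (auto simp: w_def)
qed

context L2_bounded_kernel
begin

text \<open>
  Along a subsequence of truncations whose tails decrease fast enough, the Hausdorff-Young inequality
  makes the transforms a fast Cauchy sequence in \<open>L\<^sup>q\<close>. The almost everywhere limit is the required \<open>F\<close>; convergence
  in \<open>L\<^sup>q\<close> follows by Fatou's lemma.
\<close>

lemma extends_transform_exists:
  fixes p q :: real
  assumes p: "1 < p" "p \<le> 2" and q: "q = p / (p - 1)"
    and f [measurable]: "f \<in> borel_measurable M" and fin: "mass M p f < \<infinity>"
  shows "\<exists>F. extends_transform p q f F"
proof -
  have q1: "q > 1" unfolding q using p by (simp add: pos_less_divide_eq)
  obtain C where C: "C > 0" and HY: "\<And>f N. integrable M f \<Longrightarrow> N > 0 \<Longrightarrow> mass M p f \<le> ennreal N \<Longrightarrow>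
      mass M q (transform f) \<le> ennreal (C * N powr (q - 1))"
    using hausdorff_young[OF p q] by blast
  obtain w where w: "\<And>n. integrable M (w n)" "\<And>n x. cmod (w n x) \<le> cmod (f x)"
    "\<And>m n x. n \<le> m \<Longrightarrow> cmod (w m x - w n x) \<le> cmod (w n x - f x)"
    "(\<lambda>n. mass M p (\<lambda>x. w n x - f x)) \<longlonglongrightarrow> 0"
    using integrable_truncations[OF _ f fin] p by auto
  have [measurable]: "w n \<in> borel_measurable M" for n using w(1) by (rule borel_measurable_integrable)
  \<comment> \<open>Chosen so that tails of mass at most \<open>\<epsilon> k\<close> have transforms of mass at most \<open>(1 / 4) ^ k\<close>.\<close>
  define \<epsilon> where "\<epsilon> = (\<lambda>k::nat. ((1 / 4) ^ k / C) powr (1 / (q - 1)))"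
  have \<epsilon>: "\<epsilon> k > 0" "C * \<epsilon> k powr (q - 1) = (1 / 4) ^ k" for k
    using C q1 by (simp_all add: \<epsilon>_def powr_powr)
  have "\<exists>n0. \<forall>n\<ge>n0. mass M p (\<lambda>x. w n x - f x) \<le> ennreal (\<epsilon> k)" for k
    using order_tendstoD(2)[OF w(4), of "ennreal (\<epsilon> k)"] \<epsilon>(1)[of k]
    by (auto simp: eventually_sequentially intro: less_imp_le)
  then obtain g where g: "\<And>k n. n \<ge> g k \<Longrightarrow> mass M p (\<lambda>x. w n x - f x) \<le> ennreal (\<epsilon> k)"
    by metis
  \<comment> \<open>The sum makes the sequence of indices monotone, the summand \<open>k\<close> strictly so.\<close>
  define r where "r = (\<lambda>k. k + (\<Sum>j\<le>k. g j))"
  have r: "strict_mono r" unfolding strict_mono_Suc_iff by (auto simp: r_def)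
  have rg: "r k \<ge> g k" for k
    unfolding r_def using member_le_sum[of k "{..k}" g] by simp
  define v where "v = (\<lambda>k. transform (w (r k)))"
  have [measurable]: "v k \<in> borel_measurable M" for k unfolding v_def by measurable
  have cauchy: "mass M q (\<lambda>y. v m y - v k y) \<le> ennreal ((1 / 4) ^ k)" if "k \<le> m" for k m
  proof -
    have "mass M p (\<lambda>x. w (r m) x - w (r k) x) \<le> mass M p (\<lambda>x. w (r k) x - f x)"
      using p strict_mono_leD[OF r that] by (intro mass_mono w(3)) auto
    also have "\<dots> \<le> ennreal (\<epsilon> k)" by (rule g[OF rg])
    finally have "mass M q (transform (\<lambda>x. w (r m) x - w (r k) x)) \<le> ennreal ((1 / 4) ^ k)"
      using HY[of "\<lambda>x. w (r m) x - w (r k) x" "\<epsilon> k"] w(1) \<epsilon> by simp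
    moreover have "mass M q (\<lambda>y. v m y - v k y) = mass M q (transform (\<lambda>x. w (r m) x - w (r k) x))"
      using transform_diff[OF w(1) w(1)] by (intro mass_cong) (simp add: v_def)
    ultimately show ?thesis by simp
  qed
  define F where "F = (\<lambda>y. lim (\<lambda>k. v k y))"
  have FM [measurable]: "F \<in> borel_measurable M" unfolding F_def by measurable
  have conv: "AE y in M. (\<lambda>k. v k y) \<longlonglongrightarrow> F y"
    using fast_Cauchy_AE_convergent[of q v] q1 cauchy
    by (auto simp: F_def convergent_LIMSEQ_iff)
  have lim_le: "mass M q (\<lambda>y. v k y - F y) \<le> ennreal ((1 / 4) ^ k)" for k
  proof -
    have "mass M q (\<lambda>y. v k y - F y) = (\<integral>\<^sup>+ y. liminf (\<lambda>m. ennreal (cmod (v m y - v k y) powr q)) \<partial>M)"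
      unfolding mass_def
    proof (rule nn_integral_cong_AE)
      show "AE y in M. ennreal (cmod (v k y - F y) powr q) = liminf (\<lambda>m. ennreal (cmod (v m y - v k y) powr q))"
        using conv
      proof eventually_elim
        fix y assume c: "(\<lambda>k. v k y) \<longlonglongrightarrow> F y"
        have "(\<lambda>m. ennreal (cmod (v m y - v k y) powr q)) \<longlonglongrightarrow> ennreal (cmod (F y - v k y) powr q)"
          using q1 by (intro tendsto_ennrealI tendsto_powr2 tendsto_intros c) auto
        then show "ennreal (cmod (v k y - F y) powr q) = liminf (\<lambda>m. ennreal (cmod (v m y - v k y) powr q))"
          using lim_imp_Liminf[OF sequentially_bot] by (metis norm_minus_commute)
      qed
    qed
    also have "\<dots> \<le> liminf (\<lambda>m. mass M q (\<lambda>y. v m y - v k y))"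
      unfolding mass_def by (rule nn_integral_liminf) measurable
    also have "\<dots> \<le> liminf (\<lambda>m::nat. ennreal ((1 / 4) ^ k))"
      using cauchy by (intro Liminf_mono) (auto simp: eventually_sequentially)
    finally show ?thesis by (simp add: Liminf_const)
  qed
  have mass_w: "mass M p (w n) < \<infinity>" for n
  proof -
    have "mass M p (w n) \<le> mass M p f" using p w(2) by (intro mass_mono) auto
    then show ?thesis using fin by (rule le_less_trans)
  qed
  have "mass M q F < \<infinity>"
  proof -
    have "mass M q (\<lambda>y. F y - 0) \<le> ennreal (2 powr q) * (mass M q (\<lambda>y. F y - v 0 y) + mass M q (\<lambda>y. v 0 y - 0))"
      using q1 by (intro mass_diff_triangle) auto
    also have "\<dots> < \<infinity>"
    proof -
      have "mass M q (\<lambda>y. F y - v 0 y) < \<infinity>"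
        using lim_le[of 0] by (subst mass_commute) (auto simp: less_top[symmetric] top_unique)
      moreover obtain N where "N \<ge> 0" "mass M p (w (r 0)) = ennreal N"
        using mass_w[of "r 0"] by (cases "mass M p (w (r 0))") auto
      then have "mass M p (w (r 0)) \<le> ennreal (N + 1)" "N + 1 > 0" by (auto intro: ennreal_leI)
      then have "mass M q (v 0) \<le> ennreal (C * (N + 1) powr (q - 1))"
        unfolding v_def using HY[OF w(1)] by blast
      then have "mass M q (v 0) < \<infinity>" by (auto simp: less_top[symmetric] top_unique)
      ultimately show ?thesis by (simp add: ennreal_mult_less_top)
    qed
    finally show ?thesis by simp
  qed
  moreover have "(\<lambda>k. mass M q (\<lambda>y. transform (w (r k)) y - F y)) \<longlonglongrightarrow> 0"
  proof (rule tendsto_sandwich[OF _ _ tendsto_const])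
    have "(\<lambda>k. ennreal ((1 / 4) ^ k)) \<longlonglongrightarrow> ennreal 0"
      by (intro tendsto_ennrealI LIMSEQ_power_zero) simp
    then show "(\<lambda>k. ennreal ((1 / 4) ^ k)) \<longlonglongrightarrow> 0" by simp
  qed (use lim_le in \<open>auto simp: v_def\<close>)
  moreover have "(\<lambda>k. mass M p (\<lambda>x. w (r k) x - f x)) \<longlonglongrightarrow> 0"
    using LIMSEQ_subseq_LIMSEQ[OF w(4) r] by (simp add: o_def)
  ultimately have "extends_transform p q f F"
    unfolding extends_transform_def using FM w(1) mass_w
    by (intro conjI exI[of _ "\<lambda>k. w (r k)"]) auto
  then show ?thesis by blast
qed

text \<open>
  The Hausdorff-Young inequality for \<open>f - g\<close>, where only the transform of \<open>g\<close> is given by an integral. In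
  this form the extension enters the uncertainty inequality.
\<close>

lemma extends_transform_approx:
  fixes p q :: real
  assumes p: "1 < p" "p \<le> 2" and q: "q = p / (p - 1)"
  obtains C where "C > 0"
    "\<And>f F g N. f \<in> borel_measurable M \<Longrightarrow> extends_transform p q f F \<Longrightarrow> integrable M g \<Longrightarrow> N > 0 \<Longrightarrow>
       mass M p (\<lambda>x. f x - g x) \<le> ennreal N \<Longrightarrow>
       mass M q (\<lambda>y. F y - transform g y) \<le> ennreal (C * N powr (q - 1))"
proof -
  have q1: "q > 1" unfolding q using p by (simp add: pos_less_divide_eq)
  obtain C where C: "C > 0" and HY: "\<And>f N. integrable M f \<Longrightarrow> N > 0 \<Longrightarrow> mass M p f \<le> ennreal N \<Longrightarrow>
      mass M q (transform f) \<le> ennreal (C * N powr (q - 1))"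
    using hausdorff_young[OF p q] by blast
  define K where "K = 2 powr q * (1 + C * (2 powr p * 2) powr (q - 1))"
  show ?thesis
  proof (rule that[of K])
    show "K > 0" using C by (simp add: K_def add_pos_nonneg)
    fix f F g and N :: real
    assume [measurable]: "f \<in> borel_measurable M" and ext: "extends_transform p q f F"
      and g: "integrable M g" and N: "N > 0" "mass M p (\<lambda>x. f x - g x) \<le> ennreal N"
    obtain u where u: "\<And>n. integrable M (u n)" "(\<lambda>n. mass M p (\<lambda>x. u n x - f x)) \<longlonglongrightarrow> 0"
      "(\<lambda>n. mass M q (\<lambda>y. transform (u n) y - F y)) \<longlonglongrightarrow> 0"
      and [measurable]: "F \<in> borel_measurable M"
      using ext unfolding extends_transform_def by blast
    have [measurable]: "g \<in> borel_measurable M" "u n \<in> borel_measurable M" for n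
      using g u by (auto intro: borel_measurable_integrable)
    have "eventually (\<lambda>n. mass M p (\<lambda>x. u n x - f x) < ennreal N \<and>
        mass M q (\<lambda>y. transform (u n) y - F y) < ennreal (N powr (q - 1))) sequentially"
      using N by (intro eventually_conj order_tendstoD(2)[OF u(2)] order_tendstoD(2)[OF u(3)]) auto
    then obtain n where n: "mass M p (\<lambda>x. u n x - f x) \<le> ennreal N"
        "mass M q (\<lambda>y. transform (u n) y - F y) \<le> ennreal (N powr (q - 1))"
      by (auto simp: eventually_sequentially intro: less_imp_le)
    have "mass M p (\<lambda>x. u n x - g x) \<le> ennreal (2 powr p) * (mass M p (\<lambda>x. u n x - f x) + mass M p (\<lambda>x. f x - g x))"
      using p by (intro mass_diff_triangle) auto
    also have "\<dots> \<le> ennreal (2 powr p) * (ennreal N + ennreal N)"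
      by (intro mult_left_mono add_mono n N) auto
    also have "\<dots> = ennreal (2 powr p * 2 * N)"
      using N by (simp flip: ennreal_plus ennreal_mult)
    finally have "mass M q (transform (\<lambda>x. u n x - g x)) \<le> ennreal (C * (2 powr p * 2 * N) powr (q - 1))"
      using N u(1) g by (intro HY) auto
    moreover have "mass M q (\<lambda>y. transform (u n) y - transform g y) = mass M q (transform (\<lambda>x. u n x - g x))"
      using transform_diff[OF u(1) g] by (intro mass_cong) simp
    ultimately have Tn: "mass M q (\<lambda>y. transform (u n) y - transform g y) \<le> ennreal (C * (2 powr p * 2 * N) powr (q - 1))"
      by simp
    have "mass M q (\<lambda>y. F y - transform g y) \<le> ennreal (2 powr q) *
        (mass M q (\<lambda>y. F y - transform (u n) y) + mass M q (\<lambda>y. transform (u n) y - transform g y))"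
      using q1 by (intro mass_diff_triangle) auto
    also have "\<dots> \<le> ennreal (2 powr q) * (ennreal (N powr (q - 1)) + ennreal (C * (2 powr p * 2 * N) powr (q - 1)))"
      by (intro mult_left_mono add_mono Tn n(2)[unfolded mass_commute[of _ _ "transform (u n)"]]) auto
    also have "\<dots> = ennreal (2 powr q * (N powr (q - 1) + C * (2 powr p * 2 * N) powr (q - 1)))"
      using C by (simp flip: ennreal_plus ennreal_mult)
    also have "2 powr q * (N powr (q - 1) + C * (2 powr p * 2 * N) powr (q - 1)) = K * N powr (q - 1)"
      unfolding powr_mult[of "2 powr p * 2" N] by (simp only: K_def distrib_left distrib_right mult_1_right mult.assoc)
    finally show "mass M q (\<lambda>y. F y - transform g y) \<le> ennreal (K * N powr (q - 1))" .
  qed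
qed

end

section \<open>The uncertainty inequality for a general weight\<close>

lemma half_power_powr: "((1 / 2 :: real) ^ k) powr b = ((1 / 2) powr b) ^ k"
  by (simp add: powr_power powr_powr mult.commute flip: powr_realpow)

lemma le_suminf_ennreal: "f k \<le> suminf f" for f :: "nat \<Rightarrow> ennreal"
  using sum_le_suminf[of f "{k}"] by simp

lemma dyadic_shell_exists:
  fixes x a :: real
  assumes "0 < x" "x < a"
  shows "\<exists>k. a * (1 / 2) ^ Suc k \<le> x \<and> x < a * (1 / 2) ^ k"
proof -
  have "\<exists>n. (1 / 2) ^ n < x / a" using assms by (intro real_arch_pow_inv) auto
  then have ex: "\<exists>n. a * (1 / 2) ^ n \<le> x" using assms by (auto simp: field_simps intro: less_imp_le)
  define n where "n = (LEAST n. a * (1 / 2) ^ n \<le> x)"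
  have n: "a * (1 / 2) ^ n \<le> x" unfolding n_def by (rule LeastI_ex[OF ex])
  have "n \<noteq> 0" using n assms by (intro notI) simp
  then obtain k where k: "n = Suc k" by (cases n) auto
  have "\<not> a * (1 / 2) ^ k \<le> x" using not_less_Least[of k "\<lambda>n. a * (1 / 2) ^ n \<le> x"] by (simp add: n_def[symmetric] k)
  then show ?thesis using n k by (intro exI[of _ k]) auto
qed

text \<open>
  A dyadic decomposition into the shells \<open>a / 2 ^ (k + 1) \<le> w < a / 2 ^ k\<close>; the geometric series converges because
  \<open>\<sigma> < D\<close>.
\<close>

lemma nn_integral_negative_power:
  fixes w :: "'a \<Rightarrow> real"
  assumes [measurable]: "w \<in> borel_measurable M" and w0: "\<And>x. x \<in> space M \<Longrightarrow> w x > 0"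
    and vol: "\<And>r. r > 0 \<Longrightarrow> emeasure M {x \<in> space M. w x < r} \<le> ennreal (c * r powr D)"
    and c: "c \<ge> 0" and \<sigma>: "0 < \<sigma>" "\<sigma> < D" and a: "a > 0"
  shows "(\<integral>\<^sup>+ x. ennreal (w x powr (- \<sigma>)) * indicator {x \<in> space M. w x < a} x \<partial>M)
    \<le> ennreal (c * 2 powr \<sigma> / (1 - (1 / 2) powr (D - \<sigma>)) * a powr (D - \<sigma>))"
proof -
  define h where "h = (\<lambda>k::nat. a * (1 / 2) ^ k)"
  have h0: "h k > 0" for k using a by (simp add: h_def)
  define \<rho> where "\<rho> = (1 / 2 :: real) powr (D - \<sigma>)"
  have \<rho>: "0 < \<rho>" "\<rho> < 1" using \<sigma> powr_less_mono2[of "D - \<sigma>" "1 / 2 :: real" 1] by (simp_all add: \<rho>_def)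
  have "(\<integral>\<^sup>+ x. ennreal (w x powr (- \<sigma>)) * indicator {x \<in> space M. w x < a} x \<partial>M)
     \<le> (\<integral>\<^sup>+ x. (\<Sum>k. ennreal (h (Suc k) powr (- \<sigma>)) * indicator {x \<in> space M. w x < h k} x) \<partial>M)"
  proof (rule nn_integral_mono)
    fix x assume x: "x \<in> space M"
    show "ennreal (w x powr (- \<sigma>)) * indicator {x \<in> space M. w x < a} x \<le>
        (\<Sum>k. ennreal (h (Suc k) powr (- \<sigma>)) * indicator {x \<in> space M. w x < h k} x)"
    proof (cases "w x < a")
      case True
      then obtain k where k: "h (Suc k) \<le> w x" "w x < h k"
        using dyadic_shell_exists[OF w0[OF x] True] by (auto simp: h_def)
      have "w x powr (- \<sigma>) \<le> h (Suc k) powr (- \<sigma>)"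
        using k h0[of "Suc k"] \<sigma> by (intro powr_mono2') auto
      then have "ennreal (w x powr (- \<sigma>)) * indicator {x \<in> space M. w x < a} x \<le>
          ennreal (h (Suc k) powr (- \<sigma>)) * indicator {x \<in> space M. w x < h k} x"
        using k x by (auto simp: indicator_def intro!: ennreal_leI)
      also have "\<dots> \<le> (\<Sum>k. ennreal (h (Suc k) powr (- \<sigma>)) * indicator {x \<in> space M. w x < h k} x)"
        by (rule le_suminf_ennreal)
      finally show ?thesis .
    qed simp
  qed
  also have "\<dots> = (\<Sum>k. ennreal (h (Suc k) powr (- \<sigma>)) * emeasure M {x \<in> space M. w x < h k})"
    by (subst nn_integral_suminf) (auto intro!: suminf_cong nn_integral_cmult_indicator)
  also have "\<dots> \<le> (\<Sum>k. ennreal (c * 2 powr \<sigma> * a powr (D - \<sigma>) * \<rho> ^ k))"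
  proof (intro suminf_le summableI)
    fix k
    have "ennreal (h (Suc k) powr (- \<sigma>)) * emeasure M {x \<in> space M. w x < h k} \<le>
        ennreal (h (Suc k) powr (- \<sigma>)) * ennreal (c * h k powr D)"
      by (intro mult_left_mono vol h0) auto
    also have "\<dots> = ennreal (h (Suc k) powr (- \<sigma>) * (c * h k powr D))"
      using c by (simp add: ennreal_mult)
    also have "h (Suc k) powr (- \<sigma>) * (c * h k powr D) = c * 2 powr \<sigma> * a powr (D - \<sigma>) * \<rho> ^ k"
    proof -
      have "h (Suc k) powr (- \<sigma>) = (h k * (1 / 2)) powr (- \<sigma>)" by (simp add: h_def)
      also have "\<dots> = h k powr (- \<sigma>) * (1 / 2) powr (- \<sigma>)" by (rule powr_mult)
      also have "(1 / 2 :: real) powr (- \<sigma>) = 2 powr \<sigma>" by (simp add: powr_minus powr_divide)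
      finally have 1: "h (Suc k) powr (- \<sigma>) = 2 powr \<sigma> * h k powr (- \<sigma>)" by simp
      have "h k powr (- \<sigma>) * h k powr D = h k powr (D - \<sigma>)" by (simp flip: powr_add)
      also have "\<dots> = a powr (D - \<sigma>) * \<rho> ^ k" by (simp only: h_def powr_mult half_power_powr \<rho>_def)
      finally show ?thesis unfolding 1 by (simp add: mult_ac)
    qed
    finally show "ennreal (h (Suc k) powr (- \<sigma>)) * emeasure M {x \<in> space M. w x < h k} \<le> ennreal (c * 2 powr \<sigma> * a powr (D - \<sigma>) * \<rho> ^ k)" .
  qed
  also have "\<dots> = ennreal (c * 2 powr \<sigma> * a powr (D - \<sigma>) * (1 / (1 - \<rho>)))"
    using \<rho> c by (intro suminf_ennreal_eq sums_mult geometric_sums) auto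
  finally show ?thesis by (simp add: \<rho>_def mult_ac)
qed

lemma nn_integral_mult_le_Hoelder:
  fixes u v :: "'a \<Rightarrow> real"
  assumes pq: "1 < p" "1 < q" "1 / p + 1 / q = 1"
    and [measurable]: "u \<in> borel_measurable M" "v \<in> borel_measurable M"
    and u0: "\<And>x. u x \<ge> 0" and v0: "\<And>x. v x \<ge> 0"
    and A: "A > 0" "(\<integral>\<^sup>+ x. ennreal (u x powr p) \<partial>M) \<le> ennreal A"
    and B: "B > 0" "(\<integral>\<^sup>+ x. ennreal (v x powr q) \<partial>M) \<le> ennreal B"
  shows "(\<integral>\<^sup>+ x. ennreal (u x * v x) \<partial>M) \<le> ennreal (A powr (1 / p) * B powr (1 / q))"
proof -
  let ?m = "A powr (1 / p) * B powr (1 / q)"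
  have m: "?m > 0" using A B by simp
  have pt: "u x * v x \<le> ?m / (p * A) * u x powr p + ?m / (q * B) * v x powr q" for x
  proof -
    have "(u x / A powr (1 / p)) * (v x / B powr (1 / q)) \<le>
        (u x / A powr (1 / p)) powr p / p + (v x / B powr (1 / q)) powr q / q"
      by (rule Youngs_inequality) (use pq u0 v0 in auto)
    also have "(u x / A powr (1 / p)) powr p = u x powr p / A"
      using A pq by (simp add: powr_divide powr_powr)
    also have "(v x / B powr (1 / q)) powr q = v x powr q / B"
      using B pq by (simp add: powr_divide powr_powr)
    finally have "(u x * v x) / ?m \<le> u x powr p / A / p + v x powr q / B / q" by simp
    then have "u x * v x \<le> (u x powr p / A / p + v x powr q / B / q) * ?m"
      using m by (simp only: pos_divide_le_eq)
    then show ?thesis by (simp add: algebra_simps)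
  qed
  have "(\<integral>\<^sup>+ x. ennreal (u x * v x) \<partial>M) \<le>
      (\<integral>\<^sup>+ x. ennreal (?m / (p * A)) * ennreal (u x powr p) + ennreal (?m / (q * B)) * ennreal (v x powr q) \<partial>M)"
  proof (rule nn_integral_mono)
    fix x
    show "ennreal (u x * v x) \<le> ennreal (?m / (p * A)) * ennreal (u x powr p) + ennreal (?m / (q * B)) * ennreal (v x powr q)"
      using pt[of x] pq A B by (simp add: ennreal_leI flip: ennreal_mult' ennreal_plus)
  qed
  also have "\<dots> = ennreal (?m / (p * A)) * (\<integral>\<^sup>+ x. ennreal (u x powr p) \<partial>M) + ennreal (?m / (q * B)) * (\<integral>\<^sup>+ x. ennreal (v x powr q) \<partial>M)"
    by (simp add: nn_integral_add nn_integral_cmult)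
  also have "\<dots> \<le> ennreal (?m / (p * A)) * ennreal A + ennreal (?m / (q * B)) * ennreal B"
    by (intro add_mono mult_left_mono A B) auto
  also have "\<dots> = ennreal (?m / (p * A) * A + ?m / (q * B) * B)"
    using A B pq by (simp flip: ennreal_mult' ennreal_plus)
  also have "?m / (p * A) * A + ?m / (q * B) * B = ?m * (1 / p + 1 / q)"
    using A B by (simp add: distrib_left)
  finally show ?thesis using pq by simp
qed

context L2_bounded_kernel
begin

text \<open>
  The transform is split at \<open>w = r\<close>, the function at \<open>w = 1 / r\<close>. Where \<open>w \<ge> r\<close>, the weight \<open>w powr t\<close> bounds
  \<open>F\<close>. Where \<open>w < r\<close>, the low part \<open>g\<close> of \<open>f\<close> has a bounded transform, and \<open>F - transform g\<close> is
  controlled by the high part of \<open>f\<close>, to which the Hausdorff-Young inequality applies. The \<open>L\<^sup>1\<close>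
  norm of \<open>g\<close> is bounded by Hoelder's inequality against \<open>w powr (- s)\<close>; the condition \<open>s * q < D\<close>
  makes the latter locally \<open>q\<close>-integrable. With the radii \<open>r\<close> and \<open>1 / r\<close> both contributions of \<open>f\<close> scale
  like \<open>r powr (s * q)\<close>.
\<close>

lemma extends_transform_low_high_split:
  fixes p q s t D c :: real and w :: "'a \<Rightarrow> real"
  assumes p: "1 < p" "p \<le> 2" and q: "q = p / (p - 1)"
    and [measurable]: "w \<in> borel_measurable M" and w0: "\<And>x. x \<in> space M \<Longrightarrow> w x > 0"
    and vol: "\<And>r. r > 0 \<Longrightarrow> emeasure M {x \<in> space M. w x < r} \<le> ennreal (c * r powr D)"
    and c: "c > 0" and s: "0 < s" "s * q < D" and t: "t > 0"
  obtains C where "C > 0"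
    "\<And>f F A B r. f \<in> borel_measurable M \<Longrightarrow> extends_transform p q f F \<Longrightarrow> A > 0 \<Longrightarrow> B > 0 \<Longrightarrow> r > 0 \<Longrightarrow>
       mass M p (\<lambda>x. complex_of_real (w x powr s) * f x) \<le> ennreal A \<Longrightarrow>
       mass M q (\<lambda>x. complex_of_real (w x powr t) * F x) \<le> ennreal B \<Longrightarrow>
       mass M q F \<le> ennreal (C * r powr (s * q) * A powr (q - 1) + r powr (- t * q) * B)"
proof -
  have q1: "q > 1" unfolding q using p by (simp add: pos_less_divide_eq)
  have pq: "1 / p + 1 / q = 1" "p * (q - 1) = q" "q / p = q - 1"
    using p by (simp_all add: q field_simps)
  obtain C where C: "C > 0" and approx: "\<And>f F g N. f \<in> borel_measurable M \<Longrightarrow> extends_transform p q f F \<Longrightarrow> integrable M g \<Longrightarrow> N > 0 \<Longrightarrow>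
       mass M p (\<lambda>x. f x - g x) \<le> ennreal N \<Longrightarrow>
       mass M q (\<lambda>y. F y - transform g y) \<le> ennreal (C * N powr (q - 1))"
    using extends_transform_approx[OF p q] by blast
  define c' where "c' = c * 2 powr (s * q) / (1 - (1 / 2) powr (D - s * q))"
  have c': "c' > 0"
    using c s powr_less_mono2[of "D - s * q" "1 / 2 :: real" 1] by (simp add: c'_def)
  define K where "K = 2 powr q * (c * c' + C)"
  show ?thesis
  proof (rule that[of K])
    show "K > 0" using c c' C by (simp add: K_def add_pos_pos)
    fix f F and A B r :: real
    assume fM [measurable]: "f \<in> borel_measurable M" and ext: "extends_transform p q f F"
      and A: "A > 0" and B: "B > 0" and r: "r > 0"
      and fA: "mass M p (\<lambda>x. complex_of_real (w x powr s) * f x) \<le> ennreal A"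
      and FB: "mass M q (\<lambda>x. complex_of_real (w x powr t) * F x) \<le> ennreal B"
    have [measurable]: "F \<in> borel_measurable M" using ext by (simp add: extends_transform_def)
    define V where "V = c' * r powr (s * q - D)"
    have V: "V > 0" using c' r by (simp add: V_def)
    define g where "g = (\<lambda>x. if w x < 1 / r then f x else 0)"
    have [measurable]: "g \<in> borel_measurable M" unfolding g_def by measurable
    have g1: "(\<integral>\<^sup>+ x. ennreal (cmod (g x)) \<partial>M) \<le> ennreal (A powr (1 / p) * V powr (1 / q))"
    proof -
      let ?u = "\<lambda>x. w x powr s * cmod (f x)"
      let ?v = "\<lambda>x. w x powr (- s) * indicator {x \<in> space M. w x < 1 / r} x"
      have "(\<integral>\<^sup>+ x. ennreal (cmod (g x)) \<partial>M) = (\<integral>\<^sup>+ x. ennreal (?u x * ?v x) \<partial>M)"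
      proof (rule nn_integral_cong)
        fix x assume x: "x \<in> space M"
        have "w x powr s * w x powr (- s) = 1" using w0[OF x] by (simp flip: powr_add)
        then have "cmod (f x) = ?u x * w x powr (- s)" by (simp add: mult_ac)
        then show "ennreal (cmod (g x)) = ennreal (?u x * ?v x)" using x by (simp add: g_def indicator_def)
      qed
      also have "\<dots> \<le> ennreal (A powr (1 / p) * V powr (1 / q))"
      proof (rule nn_integral_mult_le_Hoelder[OF p(1) q1 pq(1)])
        show "(\<integral>\<^sup>+ x. ennreal (?u x powr p) \<partial>M) \<le> ennreal A"
          using fA by (simp add: mass_def norm_mult)
        have "(\<integral>\<^sup>+ x. ennreal (?v x powr q) \<partial>M) =
            (\<integral>\<^sup>+ x. ennreal (w x powr (- (s * q))) * indicator {x \<in> space M. w x < 1 / r} x \<partial>M)"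
          by (intro nn_integral_cong) (auto simp: indicator_def powr_powr)
        also have "\<dots> \<le> ennreal (c' * (1 / r) powr (D - s * q))"
          unfolding c'_def using c s q1 r by (intro nn_integral_negative_power w0 vol) auto
        also have "(1 / r) powr (D - s * q) = r powr (s * q - D)"
          using r by (simp add: powr_divide powr_diff)
        finally show "(\<integral>\<^sup>+ x. ennreal (?v x powr q) \<partial>M) \<le> ennreal V" by (simp add: V_def)
      qed (use A V in auto)
      finally show ?thesis .
    qed
    then have gi: "integrable M g"
      by (intro integrableI_bounded) (auto simp: top_unique less_top[symmetric])
    have g1': "(LINT x|M. cmod (g x)) \<le> A powr (1 / p) * V powr (1 / q)"
      using g1 gi by (subst (asm) nn_integral_eq_integral) auto
    define N where "N = r powr (s * p) * A"
    have N: "N > 0" using r A by (simp add: N_def)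
    have "mass M p (\<lambda>x. f x - g x) \<le> (\<integral>\<^sup>+ x. ennreal (r powr (s * p)) * ennreal (cmod (complex_of_real (w x powr s) * f x) powr p) \<partial>M)"
      unfolding mass_def
    proof (rule nn_integral_mono)
      fix x assume x: "x \<in> space M"
      have "cmod (f x - g x) powr p \<le> r powr (s * p) * (w x powr s * cmod (f x)) powr p"
      proof (cases "w x < 1 / r")
        case False
        then have "1 \<le> r * w x" using r by (simp add: field_simps)
        then have "1 \<le> (r * w x) powr (s * p)" using s p by (intro ge_one_powr_ge_zero) auto
        then have "1 * cmod (f x) powr p \<le> (r * w x) powr (s * p) * cmod (f x) powr p"
          by (intro mult_right_mono) auto
        also have "\<dots> = r powr (s * p) * (w x powr s * cmod (f x)) powr p"
          by (simp add: powr_mult powr_powr)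
        finally show ?thesis using False by (simp add: g_def)
      qed (simp add: g_def)
      then show "ennreal (cmod (f x - g x) powr p) \<le> ennreal (r powr (s * p)) * ennreal (cmod (complex_of_real (w x powr s) * f x) powr p)"
        by (simp add: norm_mult ennreal_leI flip: ennreal_mult')
    qed
    also have "\<dots> = ennreal (r powr (s * p)) * mass M p (\<lambda>x. complex_of_real (w x powr s) * f x)"
      unfolding mass_def by (rule nn_integral_cmult) measurable
    also have "\<dots> \<le> ennreal (r powr (s * p)) * ennreal A" by (intro mult_left_mono fA) auto
    also have "\<dots> = ennreal N" using A by (simp add: N_def ennreal_mult)
    finally have high: "mass M q (\<lambda>y. F y - transform g y) \<le> ennreal (C * N powr (q - 1))"
      by (intro approx[OF fM ext gi N])
    have NA: "N powr (q - 1) = r powr (s * q) * A powr (q - 1)"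
    proof -
      have "N powr (q - 1) = (r powr (s * p)) powr (q - 1) * A powr (q - 1)" unfolding N_def by (rule powr_mult)
      also have "(r powr (s * p)) powr (q - 1) = r powr (s * (p * (q - 1)))" by (simp add: powr_powr mult.assoc)
      finally show ?thesis unfolding pq(2) .
    qed
    let ?L = "{y \<in> space M. w y < r}"
    let ?b = "A powr (1 / p) * V powr (1 / q)"
    have "mass M q F \<le> (\<integral>\<^sup>+ y. ennreal (2 powr q * ?b powr q) * indicator ?L y
        + (ennreal (2 powr q) * ennreal (cmod (F y - transform g y) powr q)
        + ennreal (r powr (- t * q)) * ennreal (cmod (complex_of_real (w y powr t) * F y) powr q)) \<partial>M)"
      unfolding mass_def
    proof (rule nn_integral_mono)
      fix y assume y: "y \<in> space M"
      show "ennreal (cmod (F y) powr q) \<le> ennreal (2 powr q * ?b powr q) * indicator ?L y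
        + (ennreal (2 powr q) * ennreal (cmod (F y - transform g y) powr q)
        + ennreal (r powr (- t * q)) * ennreal (cmod (complex_of_real (w y powr t) * F y) powr q))"
      proof (cases "w y < r")
        case True
        have "cmod (F y) \<le> cmod (transform g y) + cmod (F y - transform g y)"
          using norm_triangle_ineq[of "transform g y" "F y - transform g y"] by simp
        also have "cmod (transform g y) \<le> ?b" using transform_bound[OF gi y] g1' by simp
        finally have "cmod (F y) powr q \<le> (?b + cmod (F y - transform g y)) powr q"
          using q1 by (intro powr_mono2) auto
        also have "\<dots> \<le> 2 powr q * (?b powr q + cmod (F y - transform g y) powr q)"
          using q1 by (intro powr_add_le) auto
        finally have "ennreal (cmod (F y) powr q) \<le> ennreal (2 powr q * ?b powr q + 2 powr q * cmod (F y - transform g y) powr q)"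
          by (intro ennreal_leI) (simp add: distrib_left)
        also have "\<dots> = ennreal (2 powr q * ?b powr q) * indicator ?L y + ennreal (2 powr q) * ennreal (cmod (F y - transform g y) powr q)"
          using True y by (simp add: ennreal_mult)
        also have "\<dots> \<le> ennreal (2 powr q * ?b powr q) * indicator ?L y
          + (ennreal (2 powr q) * ennreal (cmod (F y - transform g y) powr q)
          + ennreal (r powr (- t * q)) * ennreal (cmod (complex_of_real (w y powr t) * F y) powr q))"
          by (intro add_left_mono) simp
        finally show ?thesis .
      next
        case False
        then have "1 \<le> w y / r" using r by simp
        then have "1 \<le> (w y / r) powr (t * q)" using t q1 by (intro ge_one_powr_ge_zero) auto
        then have "1 * cmod (F y) powr q \<le> (w y / r) powr (t * q) * cmod (F y) powr q"
          by (intro mult_right_mono) auto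
        also have "\<dots> = r powr (- t * q) * (w y powr t * cmod (F y)) powr q"
          using r by (simp add: powr_divide powr_mult powr_powr powr_minus_divide)
        finally have "ennreal (cmod (F y) powr q) \<le> ennreal (r powr (- t * q)) * ennreal (cmod (complex_of_real (w y powr t) * F y) powr q)"
          by (simp add: norm_mult ennreal_leI flip: ennreal_mult')
        then show ?thesis by (simp add: add_increasing)
      qed
    qed
    also have "\<dots> = ennreal (2 powr q * ?b powr q) * emeasure M ?L
        + (ennreal (2 powr q) * mass M q (\<lambda>y. F y - transform g y)
        + ennreal (r powr (- t * q)) * mass M q (\<lambda>y. complex_of_real (w y powr t) * F y))"
      unfolding mass_def by (simp add: nn_integral_add nn_integral_cmult nn_integral_cmult_indicator)
    also have "\<dots> \<le> ennreal (2 powr q * ?b powr q) * ennreal (c * r powr D)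
        + (ennreal (2 powr q) * ennreal (C * N powr (q - 1)) + ennreal (r powr (- t * q)) * ennreal B)"
      by (intro add_mono mult_left_mono vol r high FB) auto
    also have "\<dots> = ennreal (2 powr q * ?b powr q * (c * r powr D) + (2 powr q * (C * N powr (q - 1)) + r powr (- t * q) * B))"
      using c C B by (simp add: ennreal_mult)
    also have "2 powr q * ?b powr q * (c * r powr D) + (2 powr q * (C * N powr (q - 1)) + r powr (- t * q) * B)
       = K * r powr (s * q) * A powr (q - 1) + r powr (- t * q) * B"
    proof -
      have "?b powr q = A powr (q / p) * V" using q1 V by (simp add: powr_mult powr_powr)
      then have b: "?b powr q = A powr (q - 1) * (c' * r powr (s * q - D))" by (simp only: pq(3) V_def)
      have rD: "r powr (s * q - D) * r powr D = r powr (s * q)" by (simp flip: powr_add)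
      have "2 powr q * ?b powr q * (c * r powr D) = 2 powr q * (c * c') * (r powr (s * q - D) * r powr D) * A powr (q - 1)"
        unfolding b by (simp only: mult_ac)
      then show ?thesis unfolding rD NA K_def by (simp add: algebra_simps)
    qed
    finally show "mass M q F \<le> ennreal (K * r powr (s * q) * A powr (q - 1) + r powr (- t * q) * B)" .
  qed
qed

text \<open>
  Optimization over \<open>r\<close>: the chosen value balances the two terms of the preceding estimate, up to
  constants.
\<close>

lemma extends_transform_uncertainty:
  fixes p q s t D c :: real and w :: "'a \<Rightarrow> real"
  assumes p: "1 < p" "p \<le> 2" and q: "q = p / (p - 1)"
    and wM: "w \<in> borel_measurable M" and w0: "\<And>x. x \<in> space M \<Longrightarrow> w x > 0"
    and vol: "\<And>r. r > 0 \<Longrightarrow> emeasure M {x \<in> space M. w x < r} \<le> ennreal (c * r powr D)"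
    and c: "c > 0" and s: "0 < s" "s * q < D" and t: "t > 0"
  obtains K where "K > 0"
    "\<And>f F A B. f \<in> borel_measurable M \<Longrightarrow> extends_transform p q f F \<Longrightarrow> A > 0 \<Longrightarrow> B > 0 \<Longrightarrow>
       mass M p (\<lambda>x. complex_of_real (w x powr s) * f x) \<le> ennreal A \<Longrightarrow>
       mass M q (\<lambda>x. complex_of_real (w x powr t) * F x) \<le> ennreal B \<Longrightarrow>
       mass M q F \<le> ennreal (K * A powr ((q - 1) * (t / (s + t))) * B powr (s / (s + t)))"
proof -
  have q1: "q > 1" unfolding q using p by (simp add: pos_less_divide_eq)
  obtain C where C: "C > 0" and split: "\<And>f F A B r. f \<in> borel_measurable M \<Longrightarrow> extends_transform p q f F \<Longrightarrow> A > 0 \<Longrightarrow> B > 0 \<Longrightarrow> r > 0 \<Longrightarrow>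
       mass M p (\<lambda>x. complex_of_real (w x powr s) * f x) \<le> ennreal A \<Longrightarrow>
       mass M q (\<lambda>x. complex_of_real (w x powr t) * F x) \<le> ennreal B \<Longrightarrow>
       mass M q F \<le> ennreal (C * r powr (s * q) * A powr (q - 1) + r powr (- t * q) * B)"
    using extends_transform_low_high_split[OF p q wM w0 vol c s t] by blast
  show ?thesis
  proof (rule that[of "C + 1"])
    show "C + 1 > 0" using C by simp
    fix f F and A B :: real
    assume *: "f \<in> borel_measurable M" "extends_transform p q f F" and A: "A > 0" and B: "B > 0"
      and **: "mass M p (\<lambda>x. complex_of_real (w x powr s) * f x) \<le> ennreal A"
       "mass M q (\<lambda>x. complex_of_real (w x powr t) * F x) \<le> ennreal B"
    \<comment> \<open>The value at which \<open>r powr (s * q) * A powr (q - 1)\<close> and \<open>r powr (- t * q) * B\<close> coincide.\<close>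
    define r where "r = (B / A powr (q - 1)) powr (1 / ((s + t) * q))"
    have r: "r > 0" using A B by (simp add: r_def)
    let ?X = "A powr ((q - 1) * (t / (s + t))) * B powr (s / (s + t))"
    have st: "1 - s / (s + t) = t / (s + t)" "1 - t / (s + t) = s / (s + t)"
      using s t by (simp_all add: field_simps)
    have 1: "r powr (s * q) * A powr (q - 1) = ?X"
    proof -
      have "r powr (s * q) = (B / A powr (q - 1)) powr (s / (s + t))"
      proof -
        have "1 / ((s + t) * q) * (s * q) = s / (s + t)" using q1 by simp
        then show ?thesis unfolding r_def powr_powr by (simp only:)
      qed
      also have "\<dots> = B powr (s / (s + t)) / A powr ((q - 1) * (s / (s + t)))"
        using A B by (simp add: powr_divide powr_powr)
      finally have "r powr (s * q) * A powr (q - 1) = B powr (s / (s + t)) * (A powr (q - 1) / A powr ((q - 1) * (s / (s + t))))"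
        by simp
      also have "A powr (q - 1) / A powr ((q - 1) * (s / (s + t))) = A powr ((q - 1) * (1 - s / (s + t)))"
        by (simp only: powr_diff[symmetric] right_diff_distrib mult_1_right)
      finally show ?thesis unfolding st by simp
    qed
    have 2: "r powr (- t * q) * B = ?X"
    proof -
      have "r powr (- t * q) = (B / A powr (q - 1)) powr (- (t / (s + t)))"
      proof -
        have "1 / ((s + t) * q) * (- t * q) = - (t / (s + t))" using q1 by simp
        then show ?thesis unfolding r_def powr_powr by (simp only:)
      qed
      also have "\<dots> = A powr ((q - 1) * (t / (s + t))) / B powr (t / (s + t))"
        using A B by (simp add: powr_minus powr_divide powr_powr)
      finally have "r powr (- t * q) * B = A powr ((q - 1) * (t / (s + t))) * (B powr 1 / B powr (t / (s + t)))"
        using B by simp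
      also have "B powr 1 / B powr (t / (s + t)) = B powr (1 - t / (s + t))"
        by (simp only: powr_diff)
      finally show ?thesis unfolding st by simp
    qed
    have "C * r powr (s * q) * A powr (q - 1) + r powr (- t * q) * B = (C + 1) * ?X"
      unfolding 2 mult.assoc[of C] 1 by (simp only: distrib_right mult_1_left)
    then show "mass M q F \<le> ennreal ((C + 1) * A powr ((q - 1) * (t / (s + t))) * B powr (s / (s + t)))"
      using split[OF * A B r **] by (simp only: mult.assoc)
  qed
qed

text \<open>
  With \<open>mass_weight_eq_0\<close> below, this covers the case that the weighted norm of \<open>f\<close> vanishes, in
  which no radius balances the two terms.
\<close>

lemma extends_transform_null:
  fixes p q :: real
  assumes p: "1 < p" "p \<le> 2" and q: "q = p / (p - 1)"
    and "f \<in> borel_measurable M" "extends_transform p q f F" and f0: "mass M p f = 0"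
  shows "mass M q F = 0"
proof -
  have q1: "q > 1" unfolding q using p by (simp add: pos_less_divide_eq)
  obtain C where C: "C > 0" and approx: "\<And>f F g N. f \<in> borel_measurable M \<Longrightarrow> extends_transform p q f F \<Longrightarrow> integrable M g \<Longrightarrow> N > 0 \<Longrightarrow>
       mass M p (\<lambda>x. f x - g x) \<le> ennreal N \<Longrightarrow>
       mass M q (\<lambda>y. F y - transform g y) \<le> ennreal (C * N powr (q - 1))"
    using extends_transform_approx[OF p q] by blast
  have le: "mass M q F \<le> ennreal (C * N powr (q - 1))" if "N > 0" for N
    using approx[OF assms(4,5), of "\<lambda>_. 0" N] f0 that by (simp add: transform_def)
  have eps: "mass M q F \<le> 0 + ennreal e" if e: "e > 0" for e
  proof -
    have "C * ((e / C) powr (1 / (q - 1))) powr (q - 1) = e"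
      using e C q1 by (simp add: powr_powr)
    then show ?thesis using le[of "(e / C) powr (1 / (q - 1))"] e C by simp
  qed
  have "mass M q F \<le> 0"
    by (rule ennreal_le_epsilon) (rule eps)
  then show ?thesis by simp
qed

end

section \<open>The Weinstein transform\<close>

lemma fst_borel_measurable [measurable]:
  "fst \<in> borel_measurable (borel :: ('a::topological_space \<times> 'b::topological_space) measure)"
  by (intro borel_measurable_continuous_onI continuous_intros)

lemma space_weinstein_measure [simp]: "space (weinstein_measure \<alpha>) = half_space"
  by (simp add: weinstein_measure_def space_restrict_space)

lemma borel_measurable_weinstein_measure:
  fixes f :: "(real ^ 'd) \<times> real \<Rightarrow> 'b::topological_space"
  assumes "f \<in> borel_measurable borel"
  shows "f \<in> borel_measurable (weinstein_measure \<alpha>)"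
  using measurable_restrict_space1[of f lborel borel half_space] assms
  by (simp add: weinstein_measure_def)

lemma sigma_finite_weinstein_measure: "sigma_finite_measure (weinstein_measure \<alpha>)"
  unfolding weinstein_measure_alt
proof (subst sigma_finite_measure.sigma_finite_iff_density_finite)
  show "sigma_finite_measure (restrict_space lborel half_space)"
    by (intro sigma_finite_measure_restrict_space lborel.sigma_finite_measure_axioms) simp
  have "(\<lambda>x. ennreal (weinstein_const \<alpha> CARD('a) * snd x powr (2 * \<alpha> + 1))) \<in> borel_measurable (borel :: ((real ^ 'a) \<times> real) measure)"
    by measurable
  then show "(\<lambda>x. ennreal (weinstein_const \<alpha> CARD('a) * snd x powr (2 * \<alpha> + 1))) \<in> borel_measurable (restrict_space (lborel :: ((real ^ 'a) \<times> real) measure) half_space)"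
    by (intro measurable_restrict_space1) simp
qed auto

lemma norm_weinstein_kernel_le:
  assumes "\<alpha> > -1/2"
  shows "cmod (weinstein_kernel \<alpha> x y) \<le> 1"
proof -
  have "cmod (exp (- (\<i> * complex_of_real r))) = 1" for r :: real
    using norm_exp_i_times[of "- r"] by simp
  then show ?thesis using bessel_j_bound[OF assms] by (simp add: weinstein_kernel_def norm_mult)
qed

lemma bounded_kernel_weinstein:
  assumes a: "\<alpha> > -1/2"
  shows "bounded_kernel (weinstein_measure \<alpha> :: ((real ^ 'd) \<times> real) measure) (weinstein_kernel \<alpha>)"
proof -
  interpret sigma_finite_measure "weinstein_measure \<alpha> :: ((real ^ 'd) \<times> real) measure"
    by (rule sigma_finite_weinstein_measure)
  have [measurable]: "bessel_j \<alpha> \<in> borel_measurable borel"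
    by (rule borel_measurable_continuous_onI[OF continuous_bessel_j[OF a]])
  have m: "(\<lambda>z. weinstein_kernel \<alpha> (fst z) (snd z)) \<in>
      borel_measurable ((borel :: ((real ^ 'd) \<times> real) measure) \<Otimes>\<^sub>M (borel :: ((real ^ 'd) \<times> real) measure))"
    unfolding weinstein_kernel_def by measurable
  have [measurable]: "(\<lambda>x. x) \<in> (weinstein_measure \<alpha> :: ((real ^ 'd) \<times> real) measure) \<rightarrow>\<^sub>M borel"
    by (rule borel_measurable_weinstein_measure) simp
  have "(\<lambda>z. (fst z, snd z)) \<in> (weinstein_measure \<alpha> :: ((real ^ 'd) \<times> real) measure) \<Otimes>\<^sub>M (weinstein_measure \<alpha> :: ((real ^ 'd) \<times> real) measure) \<rightarrow>\<^sub>M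
      (borel :: ((real ^ 'd) \<times> real) measure) \<Otimes>\<^sub>M (borel :: ((real ^ 'd) \<times> real) measure)"
    by (intro measurable_Pair measurable_compose[OF measurable_fst] measurable_compose[OF measurable_snd]) measurable
  from measurable_compose[OF this m] show ?thesis
    using norm_weinstein_kernel_le[OF a] by unfold_locales (auto simp: case_prod_unfold)
qed

lemma heat_kernel_sym: "heat_kernel \<alpha> e x y = heat_kernel \<alpha> e y x"
  by (simp add: heat_kernel_def hankel_kernel_def norm_minus_commute[of "fst x"] mult.commute[of "(snd x)\<^sup>2 / _"])
    (simp add: algebra_simps)

text \<open>
  By this value, the case \<open>x = y = 0\<close> of \<open>gauss_weinstein_kernels\<close> says that Gaussians are
  integrable. The point \<open>0\<close> is not in the half-space, but the kernel is given by the same formula there.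
\<close>

lemma weinstein_kernel_0:
  assumes a: "\<alpha> > -1/2"
  shows "weinstein_kernel \<alpha> 0 l = 1"
proof -
  have "bessel_j \<alpha> 0 = (\<Sum>k. (\<lambda>k. (-1) ^ k * bessel_coeff (\<alpha> + 1) k) k * 0 ^ k)"
    by (simp add: bessel_j_series[OF a])
  also have "\<dots> = (-1) ^ 0 * bessel_coeff (\<alpha> + 1) 0" by (rule powser_zero)
  finally show ?thesis by (simp add: weinstein_kernel_def bessel_coeff_def)
qed

text \<open>
  Schur's test with the Gaussian weights \<open>exp (- \<bar>l\<bar>\<^sup>2 / (n + 1))\<close>, for which the kernel of the quadratic form
  is the heat kernel.
\<close>

lemma L2_bounded_kernel_weinstein:
  assumes a: "\<alpha> > -1/2"
  shows "L2_bounded_kernel (weinstein_measure \<alpha> :: ((real ^ 'd) \<times> real) measure) (weinstein_kernel \<alpha>)"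
proof -
  let ?M = "weinstein_measure \<alpha> :: ((real ^ 'd) \<times> real) measure"
  interpret bounded_kernel ?M "weinstein_kernel \<alpha>"
    by (rule bounded_kernel_weinstein[OF a])
  define e where "e = (\<lambda>n. 1 / real (Suc n))"
  have e: "e n > 0" for n by (simp add: e_def)
  define G where "G = (\<lambda>n (l :: (real ^ 'd) \<times> real). exp (- e n * (norm l)\<^sup>2))"
  have G1: "integrable ?M (G n)" for n
  proof -
    have "integrable ?M (\<lambda>l. complex_of_real (G n l))"
      using gauss_weinstein_kernels[OF a e, where x = 0 and y = "0 :: (real ^ 'd) \<times> real"]
      by (simp add: G_def weinstein_kernel_0[OF a] has_bochner_integral_iff)
    then show ?thesis by (simp only: complex_of_real_integrable_eq)
  qed
  have G2: "(\<lambda>n. G n l) \<longlonglongrightarrow> 1" for l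
  proof -
    have "e \<longlonglongrightarrow> 0" unfolding e_def by (rule LIMSEQ_Suc[OF lim_1_over_n])
    then have "(\<lambda>n. G n l) \<longlonglongrightarrow> exp (- 0 * (norm l)\<^sup>2)" unfolding G_def by (intro tendsto_intros)
    then show ?thesis by simp
  qed
  show ?thesis
  proof
    fix f :: "(real ^ 'd) \<times> real \<Rightarrow> complex" assume "integrable ?M f"
    then show "mass ?M 2 (transform f) \<le> mass ?M 2 f"
    proof (rule schur_L2[where G = G and H = "\<lambda>n. heat_kernel \<alpha> (e n)"])
      show "has_bochner_integral ?M (\<lambda>l. complex_of_real (G n l) * (weinstein_kernel \<alpha> x l * cnj (weinstein_kernel \<alpha> y l)))
          (complex_of_real (heat_kernel \<alpha> (e n) x y))" for n x y
        unfolding G_def by (rule gauss_weinstein_kernels[OF a e])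
      show "(\<integral>\<^sup>+ y. ennreal (heat_kernel \<alpha> (e n) x y) \<partial>?M) \<le> 1" for n x
        by (simp only: nn_integral_heat_kernel[OF a e] order_refl)
    qed (use G1 G2 heat_kernel_nonneg[OF a e] heat_kernel_sym in \<open>auto simp: G_def\<close>)
  qed
qed

text \<open>
  The half-ball of radius \<open>r\<close> lies in the product of a ball of \<open>\<real>\<^sup>d\<close> with an interval of length \<open>r\<close>; this gives
  the growth exponent \<open>D = 2 * \<alpha> + d + 2\<close>.
\<close>

lemma emeasure_weinstein_ball:
  assumes a: "\<alpha> > -1/2"
  obtains c where "c > 0"
    "\<And>r. r > 0 \<Longrightarrow> emeasure (weinstein_measure \<alpha> :: ((real ^ 'd) \<times> real) measure) {x \<in> half_space. norm x < r}
       \<le> ennreal (c * r powr (2 * \<alpha> + real CARD('d) + 2))"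
proof -
  let ?M = "weinstein_measure \<alpha> :: ((real ^ 'd) \<times> real) measure"
  let ?b = "\<alpha> + 1"
  let ?c = "weinstein_const \<alpha> CARD('d)"
  define K where "K = ?c * (unit_ball_vol (real CARD('d)) * (1 / (2 * ?b)))"
  have c: "?c > 0" by (rule weinstein_const_pos[OF a])
  interpret R: sigma_finite_measure "radial_measure ?b" by (rule sigma_finite_radial_measure)
  show ?thesis
  proof (rule that[of K])
    show "K > 0" using c a by (simp add: K_def)
    fix r :: real assume r: "r > 0"
    have [measurable]: "{x :: (real ^ 'd) \<times> real. norm x < r} \<in> sets borel"
      by (intro borel_open open_Collect_less continuous_intros)
    have "emeasure ?M {x \<in> half_space. norm x < r} = (\<integral>\<^sup>+ x. indicator {x. norm x < r} x \<partial>?M)"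
    proof -
      have "{x \<in> half_space. norm x < r} \<in> sets ?M"
      proof -
        have [measurable]: "norm \<in> borel_measurable ?M"
          by (rule borel_measurable_weinstein_measure) measurable
        have "{x \<in> space ?M. norm x < r} \<in> sets ?M" by measurable
        then show ?thesis by simp
      qed
      then have "emeasure ?M {x \<in> half_space. norm x < r} = (\<integral>\<^sup>+ x. indicator {x \<in> half_space. norm x < r} x \<partial>?M)"
        by simp
      also have "\<dots> = (\<integral>\<^sup>+ x. indicator {x. norm x < r} x \<partial>?M)"
        by (intro nn_integral_cong) (auto simp: indicator_def)
      finally show ?thesis .
    qed
    also have "\<dots> = ennreal ?c * (\<integral>\<^sup>+ x. indicator {x. norm x < r} x \<partial>((lborel :: (real ^ 'd) measure) \<Otimes>\<^sub>M radial_measure ?b))"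
      by (rule nn_integral_weinstein_measure[OF a]) simp
    also have "\<dots> \<le> ennreal ?c * (\<integral>\<^sup>+ x. indicator (ball 0 r) (fst x) * indicator {..r} (snd x) \<partial>((lborel :: (real ^ 'd) measure) \<Otimes>\<^sub>M radial_measure ?b))"
    proof (intro mult_left_mono nn_integral_mono)
      fix x :: "(real ^ 'd) \<times> real"
      have "norm (fst x) \<le> norm x" "\<bar>snd x\<bar> \<le> norm x"
        using norm_fst_le[of "fst x" "snd x"] norm_snd_le[of "snd x" "fst x"] by simp_all
      then show "indicator {x. norm x < r} x \<le> (indicator (ball 0 r) (fst x) * indicator {..r} (snd x) :: ennreal)"
        by (auto simp: indicator_def)
    qed simp
    also have "(\<integral>\<^sup>+ x. indicator (ball 0 r) (fst x) * indicator {..r} (snd x) \<partial>((lborel :: (real ^ 'd) measure) \<Otimes>\<^sub>M radial_measure ?b))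
       = (\<integral>\<^sup>+ v. indicator (ball 0 r :: (real ^ 'd) set) v * (\<integral>\<^sup>+ t. indicator {..r} t \<partial>radial_measure ?b) \<partial>lborel)"
    proof -
      have [measurable]: "(indicator (ball 0 r :: (real ^ 'd) set) :: _ \<Rightarrow> ennreal) \<in> borel_measurable borel"
        "(indicator {..r} :: real \<Rightarrow> ennreal) \<in> borel_measurable borel"
        by (auto intro: borel_measurable_indicator)
      have "(\<lambda>x. indicator (ball 0 r) (fst x) * indicator {..r} (snd x) :: ennreal) \<in> borel_measurable ((lborel :: (real ^ 'd) measure) \<Otimes>\<^sub>M radial_measure ?b)"
        by measurable
      then show ?thesis
        by (subst R.nn_integral_fst[symmetric]) (auto simp: nn_integral_cmult)
    qed
    also have "\<dots> = emeasure lborel (ball 0 r :: (real ^ 'd) set) * (\<integral>\<^sup>+ t. indicator {..r} t \<partial>radial_measure ?b)"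
      by (subst nn_integral_multc) (auto intro!: borel_measurable_indicator)
    also have "(\<integral>\<^sup>+ t. indicator {..r} t \<partial>radial_measure ?b) = (\<integral>\<^sup>+ t. ennreal (t powr (2 * ?b - 1)) * indicator {0..r} t \<partial>lborel)"
      unfolding radial_measure_def
      by (subst nn_integral_density) (auto intro!: nn_integral_cong simp: indicator_def)
    also have "\<dots> = ennreal (r powr (2 * ?b) / (2 * ?b))"
      using a r by (intro powr_layer_cake) auto
    also have "emeasure lborel (ball 0 r :: (real ^ 'd) set) = ennreal (unit_ball_vol (real CARD('d)) * r ^ CARD('d))"
      using r by (subst emeasure_ball) auto
    also have "ennreal ?c * (ennreal (unit_ball_vol (real CARD('d)) * r ^ CARD('d)) * ennreal (r powr (2 * ?b) / (2 * ?b)))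
        = ennreal (?c * ((unit_ball_vol (real CARD('d)) * r ^ CARD('d)) * (r powr (2 * ?b) / (2 * ?b))))"
    proof -
      have "ennreal ?c * ennreal (unit_ball_vol (real CARD('d)) * r ^ CARD('d)) * ennreal (r powr (2 * ?b) / (2 * ?b))
          = ennreal (?c * (unit_ball_vol (real CARD('d)) * r ^ CARD('d)) * (r powr (2 * ?b) / (2 * ?b)))"
        using c a r by (intro ennreal_mult3) auto
      then show ?thesis by (simp only: mult.assoc)
    qed
    also have "?c * ((unit_ball_vol (real CARD('d)) * r ^ CARD('d)) * (r powr (2 * ?b) / (2 * ?b))) = K * r powr (2 * \<alpha> + real CARD('d) + 2)"
    proof -
      have "r ^ CARD('d) * r powr (2 * ?b) = r powr (real CARD('d) + 2 * ?b)"
        using r by (simp only: powr_add powr_realpow)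
      also have "real CARD('d) + 2 * ?b = 2 * \<alpha> + real CARD('d) + 2" by simp
      finally show ?thesis by (simp add: K_def)
    qed
    finally show "emeasure ?M {x \<in> half_space. norm x < r} \<le> ennreal (K * r powr (2 * \<alpha> + real CARD('d) + 2))" .
  qed
qed

lemma ennreal_powr_ennreal: "x \<ge> 0 \<Longrightarrow> ennreal_powr (ennreal x) a = ennreal (x powr a)"
  by (simp add: ennreal_powr_def)

lemma ennreal_powr_top [simp]: "ennreal_powr top a = top"
  by (simp add: ennreal_powr_def)

lemma ennreal_powr_0 [simp]: "ennreal_powr 0 a = 0"
  by (simp add: ennreal_powr_def)

lemma ennreal_powr_less_top_iff: "ennreal_powr c a < top \<longleftrightarrow> c < top"
  by (auto simp: ennreal_powr_def less_top[symmetric])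

lemma ennreal_powr_powr: "ennreal_powr (ennreal_powr c a) b = ennreal_powr c (a * b)"
  by (cases c) (auto simp: ennreal_powr_ennreal powr_powr)

lemma ennreal_powr_1 [simp]: "ennreal_powr c 1 = c"
  by (cases c) (auto simp: ennreal_powr_ennreal)

lemma ennreal_powr_eq_0_iff [simp]: "ennreal_powr c a = 0 \<longleftrightarrow> c = 0"
  by (cases c) (auto simp: ennreal_powr_ennreal)

lemma tendsto_ennreal_powr_0:
  assumes f: "f \<longlonglongrightarrow> 0" and a: "a > 0"
  shows "(\<lambda>n. ennreal_powr (f n) a) \<longlonglongrightarrow> 0"
proof -
  have fin: "eventually (\<lambda>n. f n < \<infinity>) sequentially"
    using order_tendstoD(2)[OF f, of \<infinity>] by simp
  have "(\<lambda>n. enn2real (f n)) \<longlonglongrightarrow> enn2real 0"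
    using f by (intro tendsto_enn2real) auto
  then have "(\<lambda>n. enn2real (f n) powr a) \<longlonglongrightarrow> 0"
    by (intro tendsto_zero_powrI[where b = a]) (use a in auto)
  then have "(\<lambda>n. ennreal (enn2real (f n) powr a)) \<longlonglongrightarrow> ennreal 0"
    by (rule tendsto_ennrealI)
  then have "(\<lambda>n. ennreal (enn2real (f n) powr a)) \<longlonglongrightarrow> 0" by simp
  then show ?thesis
    by (rule Lim_transform_eventually) (use fin in \<open>auto elim!: eventually_mono simp: ennreal_powr_def\<close>)
qed

lemma tendsto_ennreal_powr_0_iff:
  assumes a: "a > 0"
  shows "(\<lambda>n. ennreal_powr (f n) a) \<longlonglongrightarrow> 0 \<longleftrightarrow> f \<longlonglongrightarrow> 0"
  using tendsto_ennreal_powr_0[of f a] tendsto_ennreal_powr_0[of "\<lambda>n. ennreal_powr (f n) a" "1 / a"] a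
  by (auto simp: ennreal_powr_powr)

lemma Lnorm_mass: "Lnorm \<alpha> p f = ennreal_powr (mass (weinstein_measure \<alpha>) p f) (1 / p)"
  by (simp add: Lnorm_def mass_def)

lemma Lspace_iff_mass:
  "f \<in> Lspace \<alpha> p \<longleftrightarrow> f \<in> borel_measurable (weinstein_measure \<alpha>) \<and> mass (weinstein_measure \<alpha>) p f < \<infinity>"
  by (simp add: Lspace_def Lnorm_mass ennreal_powr_less_top_iff)

lemma is_weinstein_transform_iff:
  fixes f :: "(real ^ 'd) \<times> real \<Rightarrow> complex"
  assumes a: "\<alpha> > -1/2" and p: "p > 1"
  shows "is_weinstein_transform \<alpha> p f F \<longleftrightarrow>
    bounded_kernel.extends_transform (weinstein_measure \<alpha>) (weinstein_kernel \<alpha>) p (p / (p - 1)) f F"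
proof -
  interpret bounded_kernel "weinstein_measure \<alpha> :: ((real ^ 'd) \<times> real) measure" "weinstein_kernel \<alpha>"
    by (rule bounded_kernel_weinstein[OF a])
  have q: "1 / (p / (p - 1)) > 0" "1 / p > 0" using p by auto
  have T: "weinstein_L1 \<alpha> u = transform u" for u :: "(real ^ 'd) \<times> real \<Rightarrow> complex"
    by (simp add: weinstein_L1_def transform_def fun_eq_iff)
  show ?thesis
    unfolding is_weinstein_transform_def extends_transform_def Lnorm_mass Int_iff Lspace_iff_mass T
      tendsto_ennreal_powr_0_iff[OF q(1)] tendsto_ennreal_powr_0_iff[OF q(2)] integrable_iff_mass
    by blast
qed

lemma mass_weight_eq_0:
  assumes [measurable]: "w \<in> borel_measurable M" "f \<in> borel_measurable M"
    and w0: "\<And>x. x \<in> space M \<Longrightarrow> w x > (0::real)"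
    and 0: "mass M p (\<lambda>x. complex_of_real (w x powr s) * f x) = 0"
  shows "mass M p f = 0"
proof -
  have "AE x in M. ennreal (cmod (complex_of_real (w x powr s) * f x) powr p) = 0"
    using 0 unfolding mass_def by (subst (asm) nn_integral_0_iff_AE) auto
  moreover have "AE x in M. w x > 0" using w0 by (intro AE_I2)
  ultimately have "AE x in M. ennreal (cmod (f x) powr p) = 0"
    by eventually_elim (auto simp: norm_mult)
  then show ?thesis unfolding mass_def by (subst nn_integral_0_iff_AE) auto
qed

theorem theoremA:
  fixes \<alpha> p q s t :: real
  assumes "\<alpha> > - 1 / 2"
    and "1 < p" and "p \<le> 2" and "q = p / (p - 1)"
    and "0 < s" and "s < (2 * \<alpha> + real CARD('d::finite) + 2) / q"
    and "0 < t"
  shows "\<exists>K>0. \<forall>\<phi> :: (real ^ 'd) \<times> real \<Rightarrow> complex. \<phi> \<in> Lspace \<alpha> p \<longrightarrow>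
           Lnorm \<alpha> q (weinstein \<alpha> p \<phi>) \<le>
             ennreal K *
             ennreal_powr (Lnorm \<alpha> p (\<lambda>x. complex_of_real (norm x powr s) * \<phi> x)) (t / (s + t)) *
             ennreal_powr (Lnorm \<alpha> q (\<lambda>y. complex_of_real (norm y powr t) * weinstein \<alpha> p \<phi> y))
               (s / (s + t))"
proof -
  let ?M = "weinstein_measure \<alpha> :: ((real ^ 'd) \<times> real) measure"
  have a: "\<alpha> > -1/2" using assms(1) by simp
  interpret L2_bounded_kernel ?M "weinstein_kernel \<alpha>"
    by (rule L2_bounded_kernel_weinstein[OF a])
  have q1: "q > 1" unfolding assms(4) using assms(2) by (simp add: pos_less_divide_eq)
  have qp: "(q - 1) * (1 / q) = 1 / p" using assms(2) by (simp add: assms(4) field_simps)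
  have nM: "norm \<in> borel_measurable ?M"
    by (rule borel_measurable_weinstein_measure) measurable
  have n0: "norm x > 0" if "x \<in> space ?M" for x :: "(real ^ 'd) \<times> real"
    using that by (auto simp: half_space_def)
  obtain c where c: "c > 0" and vol: "\<And>r. r > 0 \<Longrightarrow> emeasure ?M {x \<in> half_space. norm x < r}
       \<le> ennreal (c * r powr (2 * \<alpha> + real CARD('d) + 2))"
    using emeasure_weinstein_ball[OF a] by blast
  have sD: "s * q < 2 * \<alpha> + real CARD('d) + 2"
    using assms(6) q1 by (simp add: pos_less_divide_eq)
  obtain K where K: "K > 0" and unc: "\<And>f F A B. f \<in> borel_measurable ?M \<Longrightarrow> extends_transform p q f F \<Longrightarrow> A > 0 \<Longrightarrow> B > 0 \<Longrightarrow>
       mass ?M p (\<lambda>x. complex_of_real (norm x powr s) * f x) \<le> ennreal A \<Longrightarrow>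
       mass ?M q (\<lambda>x. complex_of_real (norm x powr t) * F x) \<le> ennreal B \<Longrightarrow>
       mass ?M q F \<le> ennreal (K * A powr ((q - 1) * (t / (s + t))) * B powr (s / (s + t)))"
    using extends_transform_uncertainty[OF assms(2-4) nM n0 _ c assms(5) sD assms(7)] vol by auto
  show ?thesis
  proof (intro exI[of _ "K powr (1 / q)"] conjI allI impI)
    show "K powr (1 / q) > 0" using K by simp
    fix \<phi> :: "(real ^ 'd) \<times> real \<Rightarrow> complex"
    assume "\<phi> \<in> Lspace \<alpha> p"
    then have \<phi>M: "\<phi> \<in> borel_measurable ?M" and fin: "mass ?M p \<phi> < \<infinity>"
      by (auto simp: Lspace_iff_mass)
    define F where "F = weinstein \<alpha> p \<phi>"
    have "\<exists>F. is_weinstein_transform \<alpha> p \<phi> F"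
      using extends_transform_exists[OF assms(2-4) \<phi>M fin]
      by (simp add: is_weinstein_transform_iff[OF a assms(2)] assms(4))
    then have "is_weinstein_transform \<alpha> p \<phi> F"
      unfolding F_def weinstein_def by (rule someI_ex)
    then have ext: "extends_transform p q \<phi> F"
      by (simp add: is_weinstein_transform_iff[OF a assms(2)] assms(4))
    have FM: "F \<in> borel_measurable ?M" and Ffin: "mass ?M q F < \<infinity>"
      using ext by (auto simp: extends_transform_def)
    let ?A = "mass ?M p (\<lambda>x. complex_of_real (norm x powr s) * \<phi> x)"
    let ?B = "mass ?M q (\<lambda>y. complex_of_real (norm y powr t) * F y)"
    have "ennreal_powr (mass ?M q F) (1 / q) \<le> ennreal (K powr (1 / q)) *
        ennreal_powr ?A (1 / p * (t / (s + t))) * ennreal_powr ?B (1 / q * (s / (s + t)))"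
    \<comment> \<open>If a weighted norm vanishes, the right-hand side is \<open>0\<close> even when the other one is \<open>\<infinity>\<close>.\<close>
    proof (cases "?A = 0 \<or> ?B = 0")
      case True
      then have "mass ?M q F = 0"
      proof
        assume "?A = 0"
        then have "mass ?M p \<phi> = 0" using mass_weight_eq_0[OF nM \<phi>M n0] by blast
        then show ?thesis by (rule extends_transform_null[OF assms(2-4) \<phi>M ext])
      next
        assume "?B = 0"
        then show ?thesis using mass_weight_eq_0[OF nM FM n0] by blast
      qed
      then show ?thesis by simp
    next
      case nz: False
      show ?thesis
      proof (cases "?A = \<infinity> \<or> ?B = \<infinity>")
        case True
        then have "ennreal (K powr (1 / q)) *
            ennreal_powr ?A (1 / p * (t / (s + t))) * ennreal_powr ?B (1 / q * (s / (s + t))) = \<infinity>"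
          using nz K by (auto simp: ennreal_mult_eq_top_iff)
        then show ?thesis by simp
      next
        case False
        then obtain A B where AB: "?A = ennreal A" "?B = ennreal B" "A > 0" "B > 0"
          using nz by (cases ?A; cases ?B) (auto simp: less_le)
        obtain m where m: "mass ?M q F = ennreal m" "m \<ge> 0"
          using Ffin by (cases "mass ?M q F") auto
        have "m \<le> K * A powr ((q - 1) * (t / (s + t))) * B powr (s / (s + t))"
          using unc[OF \<phi>M ext AB(3,4)] AB(1,2) K by (simp add: m)
        then have "m powr (1 / q) \<le> (K * A powr ((q - 1) * (t / (s + t))) * B powr (s / (s + t))) powr (1 / q)"
          using m q1 by (intro powr_mono2) auto
        also have "\<dots> = K powr (1 / q) * A powr ((q - 1) * (1 / q) * (t / (s + t))) * B powr (1 / q * (s / (s + t)))"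
          by (simp add: powr_mult powr_powr mult_ac)
        finally have "ennreal (m powr (1 / q)) \<le> ennreal (K powr (1 / q) * A powr (1 / p * (t / (s + t))) * B powr (1 / q * (s / (s + t))))"
          unfolding qp by (rule ennreal_leI)
        then show ?thesis
          using AB m by (simp add: ennreal_powr_ennreal ennreal_mult)
      qed
    qed
    then show "Lnorm \<alpha> q (weinstein \<alpha> p \<phi>) \<le>
        ennreal (K powr (1 / q)) *
        ennreal_powr (Lnorm \<alpha> p (\<lambda>x. complex_of_real (norm x powr s) * \<phi> x)) (t / (s + t)) *
        ennreal_powr (Lnorm \<alpha> q (\<lambda>y. complex_of_real (norm y powr t) * weinstein \<alpha> p \<phi> y)) (s / (s + t))"
      unfolding F_def[symmetric] Lnorm_mass ennreal_powr_powr .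
  qed
qed

end
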